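(* Let $\Lambda$, the intensities $\lambda_i(n;j),\mu_i(n;j),\gamma_i(n)$, the arrays $\mathrm B,\Theta,\mathrm T$ and the generator $\mathbf R$ be as in the context. Assume that for all $i,j\in\Lambda$ with $i\ne j$ $$U_{ij}:=\sum_{n\in\mathbb Z_+}\frac{\overline\lambda_i(n;j)}{\overline\mu_i(n;j)}<+\infty,\qquad L_j:=\sum_{n\in\mathbb Z_+}\frac{\overline\lambda_j(n;j)\,\overline\gamma_j(n)}{\overline\mu_j(n;j)}<+\infty .$$ Then the continuous-time Markov process on $\Lambda\times\mathbb Z_+^\Lambda$ with generator $\mathbf R$ is positive recurrent and reversible. Its stationary probability $\pi(j,\underline n)$ of having the distinguished customer at site $j$ and $n_q$ tasks at each $q\in\Lambda$ is $$\pi(j,\underline n)=\frac1{\Xi_\Lambda}\,\overline\gamma_j(n_j)\prod_{q\in\Lambda}\frac{\overline\lambda_q(n_q;j)}{\overline\mu_q(n_q;j)},\quad j\in\Lambda,\ \underline n=(n_q)\in\mathbb Z_+^\Lambda,\qquad \Xi_\Lambda=\sum_{j\in\Lambda}L_j\prod_{i\in\Lambda\setminus\{j\}}U_{ij}.$$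
   Context: $\Lambda$ is a finite set of sites and $\mathbb Z_+=\{0,1,2,\dots\}$. A state is $(j,\underline n)$ with $j\in\Lambda$ (the loaded site, where the single distinguished customer is) and $\underline n=(n_i)_{i\in\Lambda}\in\mathbb Z_+^\Lambda$ (numbers of tasks at the sites). $\underline e^i$ is the unit vector at $i$, $\underline e^{i\to k}=\underline e^k-\underline e^i$, and $\mathbf 1$ is the indicator. Intensities. $\lambda_i(n;j)\ge0$ ($n\ge 0$) and $\mu_i(n;j)$ ($n\ge1$), $i,j\in\Lambda$, satisfy $\sup[\lambda_i(n;j):n\ge0,\ i,j\in\Lambda]<\infty$ and $\inf[\mu_i(n;j):n\ge1,\ i,j\in\Lambda]>0$; moreover $\lambda_i(n;j)>0$ whenever $\lambda_i(n+1;j)>0$. The values $\gamma_i(n)\ge0$ satisfy $\gamma_i(0)=1$ and $\gamma_i(n)>0$ whenever $\gamma_i(n+1)>0$. Set $\overline\lambda_i(0;j)=\overline\mu_i(0;j)=\overline\gamma_i(0)=1$ and, for $n\ge1$, $$\overline\lambda_i(n;j)=\prod_{0\le m<n}\lambda_i(m;j),\quad \overline\mu_i(n;j)=\prod_{1\le m\le n}\mu_i(m;j),\quad \overline\gamma_i(n)=\prod_{0\le m<n}\gamma_i(m).$$ It is understood that $\overline\gamma_j(n_j)>0$ wherever its reciprocal appears below. Arrays. $\mathrm B(\underline n;j)=(\beta_{ik}(n_i,n_k;j))$, $\Theta(\underline n;j)=(\theta_{ik}(n_i,n_k;j))$, $\mathrm T(\underline n)=(\tau_{ik}(\underline n))$,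 $i,k\in\Lambda$, have zero diagonal entries and strictly positive off-diagonal entries ("irreducibility"). They satisfy, for $i\ne k$ and (in the first two conditions) $n_i\ge1$, $$\frac{\lambda_i(n_i-1;j)}{\mu_i(n_i;j)}\beta_{ik}(n_i,n_k;j)=\frac{\lambda_k(n_k;j)}{\mu_k(n_k+1;j)}\beta_{ki}(n_k+1,n_i-1;j),$$ $$\frac{\lambda_i(n_i-1;j)}{\mu_i(n_i;j)}\theta_{ik}(n_i,n_k;j)=\frac{\lambda_k(n_k;j)}{\mu_k(n_k+1;j)}\theta_{ki}(n_k+1,n_i-1;j),$$ $$\tau_{ik}(\underline n)\prod_{q\in\Lambda}\frac{\overline\lambda_q(n_q;i)}{\overline\mu_q(n_q;i)}=\tau_{ki}(\underline n)\prod_{q\in\Lambda}\frac{\overline\lambda_q(n_q;k)}{\overline\mu_q(n_q;k)}.$$ The generator $\mathbf R$ has the following off-diagonal entries (all others are zero): - $R[(j,\underline n);(j,\underline n+\underline e^k)]=\lambda_k(n_k;j)$ for $k\ne j$; $R[(j,\underline n);(j,\underline n+\underline e^j)]=\lambda_j(n_j;j)\gamma_j(n_j)$; - $R[(j,\underline n);(j,\underline n-\underline e^k)]=\mu_k(n_k;j)\mathbf 1(n_k\ge1)$, $k\in\Lambda$; - $R[(j,\underline n);(j,\underline n+\underline e^{k\to l})]=\beta_{kl}(n_k,n_l;j)\mathbf 1(n_k\ge1)$ for $k\ne l$, $k\neq j$, $l\ne j$; - $R[(j,\underline n);(j,\underline n+\underline e^{j\to l})]=\theta_{jl}(n_j,n_l;j)\mathbf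 1(n_j\ge1)$ for $l\ne j$; - $R[(j,\underline n);(j,\underline n+\underline e^{k\to j})]=\theta_{kj}(n_k,n_j;j)\gamma_j(n_j)\mathbf 1(n_k\ge1)$ for $k\ne j$; - $R[(j,\underline n);(j',\underline n)]=[\overline\gamma_j(n_j)]^{-1}\tau_{jj'}(\underline n)$ for $j'\ne j$.
   Formalization: The Markov process is assumed non-explosive (γ may be unbounded, and the claim can fail otherwise), and positive recurrence is claimed for the states with π>0, a closed class reached almost surely from every state, since states with π=0 are transient when intensities vanish. *)

theory Defs
  imports "HOL-Probability.Probability"
begin

section \<open>Continuous-time Markov processes on a countable state space\<close>

text \<open>
  \<open>Q\<close> is a conservative generator matrix: its off-diagonal entries are the jump intensities and
  \<open>- Q x x\<close> is the total intensity of leaving \<open>x\<close>. An absorbing state is left to itself by the jump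
  chain and has an infinite holding time.
\<close>

definition exit_rate :: "('s \<Rightarrow> 's \<Rightarrow> real) \<Rightarrow> 's \<Rightarrow> real" where
  "exit_rate Q x = - Q x x"

definition jump_prob :: "('s \<Rightarrow> 's \<Rightarrow> real) \<Rightarrow> 's \<Rightarrow> 's \<Rightarrow> real" where
  "jump_prob Q x y =
     (if exit_rate Q x = 0 then of_bool (y = x)
      else if y = x then 0 else Q x y / exit_rate Q x)"

definition jump_path :: "(nat \<Rightarrow> 's) \<Rightarrow> (nat \<Rightarrow> ennreal) \<Rightarrow> real \<Rightarrow> 's" where
  "jump_path y s t = y (LEAST n. ennreal t < (\<Sum>i\<le>n. s i))"

text \<open>
  \<open>P x\<close> is the law of the process started at \<open>x\<close>. The process is described through its jump chain
  \<open>Y\<close> and its holding times \<open>S\<close>: \<open>Y\<close> is the Markov chain with transition matrix \<open>jump_prob Q\<close>,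
  and given \<open>Y\<close> the \<open>S i\<close> are independent exponential variables with parameters
  \<open>exit_rate Q (Y i)\<close>. The displayed probabilities determine the joint law of \<open>(Y, S)\<close>.
  A process takes its values in the state space at all times \<open>t \<ge> 0\<close>, so that almost surely there
  are only finitely many jumps in bounded time. This clause is a genuine restriction on \<open>Q\<close>: with
  unbounded intensities a generator may be explosive even if it is in detailed balance with a
  probability distribution.
\<close>

definition markov_process ::
    "('s \<Rightarrow> 's \<Rightarrow> real) \<Rightarrow> ('s \<Rightarrow> 'w measure) \<Rightarrow> (real \<Rightarrow> 'w \<Rightarrow> 's) \<Rightarrow> bool" where
  "markov_process Q P X \<longleftrightarrow>
     (\<exists>(Y :: nat \<Rightarrow> 'w \<Rightarrow> 's) (S :: nat \<Rightarrow> 'w \<Rightarrow> ennreal). \<forall>x.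
        prob_space (P x) \<and>
        (\<forall>n. Y n \<in> measurable (P x) (count_space UNIV)) \<and>
        (\<forall>n. S n \<in> borel_measurable (P x)) \<and>
        (\<forall>n ys (ss :: nat \<Rightarrow> real). (\<forall>i\<le>n. 0 \<le> ss i) \<longrightarrow>
           measure (P x)
             {\<omega> \<in> space (P x). \<forall>i\<le>n. Y i \<omega> = ys i \<and> ennreal (ss i) < S i \<omega>} =
           of_bool (ys 0 = x) * (\<Prod>i<n. jump_prob Q (ys i) (ys (Suc i))) *
             (\<Prod>i\<le>n. exp (- exit_rate Q (ys i) * ss i))) \<and>
        (AE \<omega> in P x. (\<Sum>n. S n \<omega>) = \<infinity>) \<and>
        (\<forall>\<omega> \<in> space (P x). \<forall>t\<ge>0. X t \<omega> = jump_path (\<lambda>n. Y n \<omega>) (\<lambda>n. S n \<omega>) t))"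

definition exit_time :: "(real \<Rightarrow> 'w \<Rightarrow> 's) \<Rightarrow> 'w \<Rightarrow> ennreal" where
  "exit_time X \<omega> = (INF t\<in>{t. 0 \<le> t \<and> X t \<omega> \<noteq> X 0 \<omega>}. ennreal t)"

definition return_time :: "(real \<Rightarrow> 'w \<Rightarrow> 's) \<Rightarrow> 's \<Rightarrow> 'w \<Rightarrow> ennreal" where
  "return_time X x \<omega> =
     (INF t\<in>{t. 0 \<le> t \<and> exit_time X \<omega> \<le> ennreal t \<and> X t \<omega> = x}. ennreal t)"

definition positive_recurrent_state ::
    "('s \<Rightarrow> 'w measure) \<Rightarrow> (real \<Rightarrow> 'w \<Rightarrow> 's) \<Rightarrow> 's \<Rightarrow> bool" where
  "positive_recurrent_state P X x \<longleftrightarrow>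
     (AE \<omega> in P x. \<forall>t\<ge>0. X t \<omega> = x) \<or> (\<integral>\<^sup>+\<omega>. return_time X x \<omega> \<partial>P x) < \<infinity>"

text \<open>
  Positive recurrence of a process that may have inessential states: \<open>C\<close> is closed, its states are
  positive recurrent, and each of them is almost surely visited from every initial state. In
  particular \<open>C\<close> is the only recurrent class; for \<open>C = UNIV\<close> this says that the process is
  irreducible and positive recurrent.
\<close>

definition positive_recurrent ::
    "('s \<Rightarrow> 'w measure) \<Rightarrow> (real \<Rightarrow> 'w \<Rightarrow> 's) \<Rightarrow> 's set \<Rightarrow> bool" where
  "positive_recurrent P X C \<longleftrightarrow>
     C \<noteq> {} \<and>
     (\<forall>x\<in>C. AE \<omega> in P x. \<forall>t\<ge>0. X t \<omega> \<in> C) \<and>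
     (\<forall>x\<in>C. positive_recurrent_state P X x) \<and>
     (\<forall>x. \<forall>y\<in>C. AE \<omega> in P x. \<exists>t\<ge>0. X t \<omega> = y)"

text \<open>
  Joint probability of \<open>X (t i) = y i\<close>, \<open>i < m\<close>, for the process with initial distribution \<open>p\<close>.
\<close>

definition joint_prob ::
    "('s \<Rightarrow> 'w measure) \<Rightarrow> (real \<Rightarrow> 'w \<Rightarrow> 's) \<Rightarrow> ('s \<Rightarrow> real) \<Rightarrow>
     nat \<Rightarrow> (nat \<Rightarrow> real) \<Rightarrow> (nat \<Rightarrow> 's) \<Rightarrow> real" where
  "joint_prob P X p m t y =
     (\<Sum>\<^sub>\<infinity>x. p x * measure (P x) {\<omega> \<in> space (P x). \<forall>i<m. X (t i) \<omega> = y i})"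

definition stationary_distribution ::
    "('s \<Rightarrow> 'w measure) \<Rightarrow> (real \<Rightarrow> 'w \<Rightarrow> 's) \<Rightarrow> ('s \<Rightarrow> real) \<Rightarrow> bool" where
  "stationary_distribution P X p \<longleftrightarrow>
     (\<forall>x. 0 \<le> p x) \<and> (p has_sum 1) UNIV \<and>
     (\<forall>t\<ge>0. \<forall>y. (\<Sum>\<^sub>\<infinity>x. p x * measure (P x) {\<omega> \<in> space (P x). X t \<omega> = y}) = p y)"

text \<open>
  Reversibility in equilibrium: started from the distribution \<open>p\<close>, the processes \<open>X t\<close> and
  \<open>X (T - t)\<close>, \<open>0 \<le> t \<le> T\<close>, have the same finite-dimensional distributions.
\<close>

definition reversible ::
    "('s \<Rightarrow> 'w measure) \<Rightarrow> (real \<Rightarrow> 'w \<Rightarrow> 's) \<Rightarrow> ('s \<Rightarrow> real) \<Rightarrow> bool" where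
  "reversible P X p \<longleftrightarrow>
     (\<forall>T m t y. (\<forall>i<m. 0 \<le> t i \<and> t i \<le> T) \<longrightarrow>
        joint_prob P X p m t y = joint_prob P X p m (\<lambda>i. T - t i) y)"


section \<open>The network with a distinguished customer\<close>

text \<open>
  Sites are the elements of a finite type \<open>'a\<close>. A state is \<open>(j, n)\<close> with \<open>j\<close> the loaded site.
  Argument order: \<open>lam i n j\<close> is $\lambda_i(n;j)$, \<open>mu i n j\<close> is $\mu_i(n;j)$, \<open>beta i k a b j\<close> is
  $\beta_{ik}(a,b;j)$, \<open>theta i k a b j\<close> is $\theta_{ik}(a,b;j)$ and \<open>tau i k n\<close> is $\tau_{ik}(n)$.
\<close>

type_synonym 'a state = "'a \<times> ('a \<Rightarrow> nat)"

definition lam_bar :: "('a \<Rightarrow> nat \<Rightarrow> 'a \<Rightarrow> real) \<Rightarrow> 'a \<Rightarrow> nat \<Rightarrow> 'a \<Rightarrow> real" where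
  "lam_bar lam i n j = (\<Prod>m<n. lam i m j)"

definition mu_bar :: "('a \<Rightarrow> nat \<Rightarrow> 'a \<Rightarrow> real) \<Rightarrow> 'a \<Rightarrow> nat \<Rightarrow> 'a \<Rightarrow> real" where
  "mu_bar mu i n j = (\<Prod>m=1..n. mu i m j)"

definition gam_bar :: "('a \<Rightarrow> nat \<Rightarrow> real) \<Rightarrow> 'a \<Rightarrow> nat \<Rightarrow> real" where
  "gam_bar gam i n = (\<Prod>m<n. gam i m)"

text \<open>
  Different summands below have different target states, so at most one of them is nonzero.
\<close>

definition rate ::
    "('a::finite \<Rightarrow> nat \<Rightarrow> 'a \<Rightarrow> real) \<Rightarrow> ('a \<Rightarrow> nat \<Rightarrow> 'a \<Rightarrow> real) \<Rightarrow> ('a \<Rightarrow> nat \<Rightarrow> real) \<Rightarrow>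
     ('a \<Rightarrow> 'a \<Rightarrow> nat \<Rightarrow> nat \<Rightarrow> 'a \<Rightarrow> real) \<Rightarrow> ('a \<Rightarrow> 'a \<Rightarrow> nat \<Rightarrow> nat \<Rightarrow> 'a \<Rightarrow> real) \<Rightarrow>
     ('a \<Rightarrow> 'a \<Rightarrow> ('a \<Rightarrow> nat) \<Rightarrow> real) \<Rightarrow> 'a state \<Rightarrow> 'a state \<Rightarrow> real" where
  "rate lam mu gam beta theta tau = (\<lambda>(j, n) (j', n').
     if j' \<noteq> j then (if n' = n then inverse (gam_bar gam j (n j)) * tau j j' n else 0)
     else
       (\<Sum>k\<in>UNIV. if n' = n(k := n k + 1)
          then (if k = j then lam j (n j) j * gam j (n j) else lam k (n k) j) else 0) +
       (\<Sum>k\<in>UNIV. if n k \<ge> 1 \<and> n' = n(k := n k - 1) then mu k (n k) j else 0) +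
       (\<Sum>k\<in>UNIV. \<Sum>l\<in>UNIV - {k}.
          if n k \<ge> 1 \<and> n' = n(k := n k - 1, l := n l + 1)
          then (if k = j then theta j l (n j) (n l) j
                else if l = j then theta k j (n k) (n j) j * gam j (n j)
                else beta k l (n k) (n l) j)
          else 0))"

definition generator ::
    "('a::finite \<Rightarrow> nat \<Rightarrow> 'a \<Rightarrow> real) \<Rightarrow> ('a \<Rightarrow> nat \<Rightarrow> 'a \<Rightarrow> real) \<Rightarrow> ('a \<Rightarrow> nat \<Rightarrow> real) \<Rightarrow>
     ('a \<Rightarrow> 'a \<Rightarrow> nat \<Rightarrow> nat \<Rightarrow> 'a \<Rightarrow> real) \<Rightarrow> ('a \<Rightarrow> 'a \<Rightarrow> nat \<Rightarrow> nat \<Rightarrow> 'a \<Rightarrow> real) \<Rightarrow>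
     ('a \<Rightarrow> 'a \<Rightarrow> ('a \<Rightarrow> nat) \<Rightarrow> real) \<Rightarrow> 'a state \<Rightarrow> 'a state \<Rightarrow> real" where
  "generator lam mu gam beta theta tau x y =
     (if y = x then - (\<Sum>\<^sub>\<infinity>z\<in>UNIV - {x}. rate lam mu gam beta theta tau x z)
      else rate lam mu gam beta theta tau x y)"

definition U_sum :: "('a \<Rightarrow> nat \<Rightarrow> 'a \<Rightarrow> real) \<Rightarrow> ('a \<Rightarrow> nat \<Rightarrow> 'a \<Rightarrow> real) \<Rightarrow> 'a \<Rightarrow> 'a \<Rightarrow> real" where
  "U_sum lam mu i j = (\<Sum>n. lam_bar lam i n j / mu_bar mu i n j)"

definition L_sum ::
    "('a \<Rightarrow> nat \<Rightarrow> 'a \<Rightarrow> real) \<Rightarrow> ('a \<Rightarrow> nat \<Rightarrow> 'a \<Rightarrow> real) \<Rightarrow> ('a \<Rightarrow> nat \<Rightarrow> real) \<Rightarrow> 'a \<Rightarrow> real" where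
  "L_sum lam mu gam j = (\<Sum>n. lam_bar lam j n j * gam_bar gam j n / mu_bar mu j n j)"

definition partition_function ::
    "('a::finite \<Rightarrow> nat \<Rightarrow> 'a \<Rightarrow> real) \<Rightarrow> ('a \<Rightarrow> nat \<Rightarrow> 'a \<Rightarrow> real) \<Rightarrow> ('a \<Rightarrow> nat \<Rightarrow> real) \<Rightarrow> real" where
  "partition_function lam mu gam =
     (\<Sum>j\<in>UNIV. L_sum lam mu gam j * (\<Prod>i\<in>UNIV - {j}. U_sum lam mu i j))"

definition stat_prob ::
    "('a::finite \<Rightarrow> nat \<Rightarrow> 'a \<Rightarrow> real) \<Rightarrow> ('a \<Rightarrow> nat \<Rightarrow> 'a \<Rightarrow> real) \<Rightarrow> ('a \<Rightarrow> nat \<Rightarrow> real) \<Rightarrow>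
     'a state \<Rightarrow> real" where
  "stat_prob lam mu gam = (\<lambda>(j, n).
     1 / partition_function lam mu gam * gam_bar gam j (n j) *
       (\<Prod>q\<in>UNIV. lam_bar lam q (n q) j / mu_bar mu q (n q) j))"

end

theory Submission
  imports Defs
begin

text \<open>
  A path with states \<open>x 0, \<dots>, x n\<close> and holding times \<open>s 0, \<dots>, s n\<close> of total length \<open>T\<close> has density
  \<open>w (x 0) * Q (x 0) (x 1) * \<dots> * Q (x (n - 1)) (x n) * exp (- (q (x 0) * s 0 + \<dots> + q (x n) * s n))\<close>
  under the process with initial distribution \<open>w\<close>. Detailed balance makes it invariant under
  reversal of the path, and this is reversibility; stationarity is the special case of a single time.
  Applied to the excursions from \<open>x\<close>, the same reversal bounds the expected length of an excursion by
  \<open>1 / (w x * q x)\<close>. As the process does not explode, an excursion of finite length ends with a return to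
  \<open>x\<close>, so the states of the support are positive recurrent, and they are hit from everywhere: within
  the support by recurrence, and from outside because there the total number of tasks cannot increase.
  The positive and the negative part of the difference of two stationary distributions are again
  invariant. Every state of the support is accessible from everywhere, so either part is positive on the
  whole support if it is not zero; as both cannot be positive at one state, the difference vanishes.
\<close>

section \<open>Path weights and the jump chain\<close>

text \<open>The argument therefore stays on the path measure: non-explosion enters as divergence of
  the total holding time, which leaves finitely many jumps before \<open>T\<close>. The law of the
  process is prescribed only on events \<open>Y i = ys i\<close>, \<open>S i > ss i\<close>; it has
  to be extended to all measurable functions of finitely many holding times. The density is
  symmetric because the last sojourn is cut off at \<open>T\<close>: it contributes the tail
  \<open>exp (- q s)\<close> without the factor \<open>q\<close>, so exactly \<open>n\<close> exit
  rates meet the \<open>n\<close> jump probabilities and form intensities. In the bound on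
  excursions the surplus exit rate of the final state is cancelled by its mean holding time instead.
  Arrival intensities may vanish, so the support of \<open>w\<close> can be a proper subset of the
  state space. Detailed balance says nothing about recurrence from the other states, which is why
  they need a separate argument.\<close>

fun path_weight :: "('s \<Rightarrow> 's \<Rightarrow> real) \<Rightarrow> 's list \<Rightarrow> real" where
  "path_weight K (x # y # l) = K x y * path_weight K (y # l)"
| "path_weight K _ = 1"

lemma path_weight_snoc:
  "path_weight K (l @ [x, y]) = path_weight K (l @ [x]) * K x y"
proof (induction l)
  case (Cons a l)
  then show ?case by (cases l) auto
qed simp

text \<open>Detailed balance turns one edge around at a time, carrying the factor \<open>m\<close>
  along the list. It is used twice: with \<open>w\<close> and the intensities
  \<open>off_diag\<close>, and with \<open>w x * exit_rate Q x\<close> and the jump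
  probabilities.\<close>

lemma path_weight_rev:
  assumes "\<And>x y. m x * K x y = m y * K y x" and "ys \<noteq> []"
  shows "m (hd ys) * path_weight K ys = m (last ys) * path_weight K (rev ys)"
  using assms
proof (induction K ys rule: path_weight.induct)
  case (1 K x y l)
  have "m x * path_weight K (x # y # l) = K y x * (m y * path_weight K (y # l))"
    using 1(2)[of x y] by (simp add: ac_simps)
  also have "\<dots> = m (last (y # l)) * path_weight K (rev (y # l)) * K y x"
    using 1 by (simp add: ac_simps)
  also have "\<dots> = m (last (x # y # l)) * path_weight K (rev (x # y # l))"
    by (simp add: path_weight_snoc)
  finally show ?case by simp
qed auto

lemma path_weight_conv_prod:
  "ys \<noteq> [] \<Longrightarrow> path_weight K ys = (\<Prod>i<length ys - 1. K (ys ! i) (ys ! Suc i))"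
proof (induction K ys rule: path_weight.induct)
  case (1 K x y l)
  then show ?case by (simp add: prod.lessThan_Suc_shift del: prod.lessThan_Suc)
qed auto

lemma path_weight_nonneg: "(\<And>x y. 0 \<le> K x y) \<Longrightarrow> 0 \<le> path_weight K ys"
  by (induction K ys rule: path_weight.induct) auto

section \<open>Infinite sums as integrals over counting measures\<close>

lemma nn_integral_count_space_eq_infsum:
  fixes f :: "'b \<Rightarrow> real"
  assumes "\<And>x. x \<in> A \<Longrightarrow> 0 \<le> f x" "f summable_on A"
  shows "(\<integral>\<^sup>+x. ennreal (f x) \<partial>count_space A) = ennreal (infsum f A)"
proof -
  have "Infinite_Sum.abs_summable_on f A"
    using assms(2) summable_on_iff_abs_summable_on_real[of f A] by blast
  then have "Infinite_Set_Sum.abs_summable_on f A"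
    by (simp only: abs_summable_equivalent)
  then show ?thesis
    using assms by (simp add: nn_integral_conv_infsetsum infsetsum_infsum)
qed

text \<open>Summability need not be checked: for a divergent series the integral is infinite and
  both sides take their default value 0.\<close>

lemma infsum_eq_nn_integral:
  fixes f :: "'b \<Rightarrow> real"
  assumes "\<And>x. x \<in> A \<Longrightarrow> 0 \<le> f x"
  shows "infsum f A = enn2real (\<integral>\<^sup>+x. ennreal (f x) \<partial>count_space A)"
proof (cases "f summable_on A")
  case True
  then show ?thesis
    using assms by (simp add: nn_integral_count_space_eq_infsum infsum_nonneg)
next
  case False
  have "(\<integral>\<^sup>+x. ennreal (f x) \<partial>count_space A) = \<infinity>"
  proof (rule ccontr)
    assume "\<not> ?thesis"
    then have "integrable (count_space A) f"
      using assms by (intro integrableI_nonneg) (auto simp: AE_count_space top.not_eq_extremum)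
    then have "Infinite_Sum.abs_summable_on f A"
      by (subst abs_summable_equivalent) (simp add: abs_summable_on_def)
    then have "f summable_on A"
      by (rule abs_summable_summable)
    with False show False ..
  qed
  then show ?thesis
    using False by (simp add: infsum_not_exists)
qed

section \<open>Conservative generators and the law of finite jump paths\<close>

locale generator_matrix =
  fixes Q :: "'s::countable \<Rightarrow> 's \<Rightarrow> real"
  assumes nonneg: "x \<noteq> y \<Longrightarrow> 0 \<le> Q x y"
    and conservative: "(Q x has_sum exit_rate Q x) (UNIV - {x})"
begin

text \<open>The diagonal entries of \<open>Q\<close> are minus the exit rates. Replacing them by 0
  keeps path weights nonnegative and lets sums run over all states.\<close>

definition off_diag :: "'s \<Rightarrow> 's \<Rightarrow> real" where
  "off_diag x y = (if y = x then 0 else Q x y)"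

lemma off_diag_nonneg: "0 \<le> off_diag x y"
  using nonneg[of x y] by (auto simp: off_diag_def)

lemma exit_rate_nonneg: "0 \<le> exit_rate Q x"
  by (rule has_sum_nonneg[OF conservative]) (use nonneg in auto)

lemma off_diag_has_sum: "(off_diag x has_sum exit_rate Q x) UNIV"
proof -
  have "(off_diag x has_sum exit_rate Q x) (UNIV - {x}) \<longleftrightarrow> (Q x has_sum exit_rate Q x) (UNIV - {x})"
    by (rule has_sum_cong) (auto simp: off_diag_def)
  moreover have "(off_diag x has_sum exit_rate Q x) (UNIV - {x}) \<longleftrightarrow> (off_diag x has_sum exit_rate Q x) UNIV"
    by (rule has_sum_cong_neutral) (auto simp: off_diag_def)
  ultimately show ?thesis using conservative by simp
qed

lemma off_diag_eq_0: "exit_rate Q x = 0 \<Longrightarrow> off_diag x y = 0"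
  using nonneg_has_sum_le_0D[OF off_diag_has_sum, of x y] off_diag_nonneg by simp

lemma jump_prob_nonneg: "0 \<le> jump_prob Q x y"
  using nonneg[of x y] exit_rate_nonneg[of x] by (auto simp: jump_prob_def)

lemma jump_prob_mult_exit_rate: "exit_rate Q x * jump_prob Q x y = off_diag x y"
  using off_diag_eq_0[of x y] by (auto simp: jump_prob_def off_diag_def)

lemma jump_prob_has_sum: "(jump_prob Q x has_sum 1) UNIV"
proof (cases "exit_rate Q x = 0")
  case True
  have "((\<lambda>y. of_bool (y = x)) has_sum (1::real)) {x}"
    by (rule has_sum_finiteI) auto
  then have "((\<lambda>y. of_bool (y = x)) has_sum (1::real)) UNIV"
    by (subst (asm) has_sum_cong_neutral[where T=UNIV]) auto
  with True show ?thesis by (simp add: jump_prob_def[abs_def])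
next
  case False
  then have "jump_prob Q x = (\<lambda>y. inverse (exit_rate Q x) * off_diag x y)"
    by (auto simp: jump_prob_def off_diag_def fun_eq_iff field_simps)
  then show ?thesis
    using has_sum_cmult_right[OF off_diag_has_sum, of "inverse (exit_rate Q x)" x] False by simp
qed

definition jump_pmf :: "'s \<Rightarrow> 's pmf" where
  "jump_pmf x = embed_pmf (jump_prob Q x)"

lemma pmf_jump_pmf: "pmf (jump_pmf x) y = jump_prob Q x y"
  unfolding jump_pmf_def
proof (rule pmf_embed_pmf)
  show "(\<integral>\<^sup>+y. ennreal (jump_prob Q x y) \<partial>count_space UNIV) = 1"
    using jump_prob_has_sum[of x] jump_prob_nonneg
    by (subst nn_integral_count_space_eq_infsum) (auto simp: has_sum_imp_summable infsumI)
qed (rule jump_prob_nonneg)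

text \<open>Lists make the first \<open>n\<close> jumps a random variable with countably many
  values, on which time reversal is simply \<open>rev\<close>. The recursion conditions on the first
  jump, the form needed for first-step analysis.\<close>

fun paths :: "nat \<Rightarrow> 's \<Rightarrow> 's list pmf" where
  "paths 0 x = return_pmf [x]"
| "paths (Suc n) x = map_pmf ((#) x) (jump_pmf x \<bind> paths n)"

lemma set_pmf_paths: "ys \<in> set_pmf (paths n x) \<Longrightarrow> length ys = Suc n \<and> hd ys = x"
  by (induction n arbitrary: x ys) auto

lemma pmf_paths:
  assumes "length ys = Suc n"
  shows "pmf (paths n x) ys = of_bool (hd ys = x) * path_weight (jump_prob Q) ys"
  using assms
proof (induction n arbitrary: x ys)
  case 0
  then show ?case by (auto simp: length_Suc_conv pmf_return)
next
  case (Suc n)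
  then obtain a b l where ys: "ys = a # b # l" "length l = n"
    by (auto simp: length_Suc_conv)
  show ?case
  proof (cases "a = x")
    case True
    have "pmf (paths (Suc n) x) ys = pmf (jump_pmf x \<bind> paths n) (b # l)"
      using ys True by (simp add: pmf_map_inj')
    also have "\<dots> = (\<integral>y. pmf (paths n y) (b # l) \<partial>jump_pmf x)"
      by (rule pmf_bind)
    also have "\<dots> = (\<integral>y. indicator {b} y * path_weight (jump_prob Q) (b # l) \<partial>jump_pmf x)"
      using Suc.IH[of "b # l"] ys by (intro Bochner_Integration.integral_cong) (auto simp: indicator_def)
    also have "\<dots> = jump_prob Q x b * path_weight (jump_prob Q) (b # l)"
      by (simp add: measure_pmf_single pmf_jump_pmf)
    finally show ?thesis using ys True by simp
  next
    case False
    then have "pmf (paths (Suc n) x) ys = 0"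
      using set_pmf_paths[of ys "Suc n" x] ys by (auto simp: set_pmf_iff simp del: paths.simps)
    then show ?thesis using False ys by simp
  qed
qed

end

section \<open>The joint law of jump chain and holding times\<close>

lemma emeasure_split_countable:
  fixes f :: "'w \<Rightarrow> 'b::countable"
  assumes [measurable]: "f \<in> measurable M (count_space UNIV)" "Measurable.pred M R"
  shows "emeasure M {\<omega>\<in>space M. R \<omega>} =
    (\<integral>\<^sup>+y. emeasure M {\<omega>\<in>space M. f \<omega> = y \<and> R \<omega>} \<partial>count_space UNIV)"
proof -
  have "{\<omega>\<in>space M. R \<omega>} = (\<Union>y. {\<omega>\<in>space M. f \<omega> = y \<and> R \<omega>})" by auto
  then show ?thesis
    by (simp only:) (rule emeasure_UN_countable, auto simp: disjoint_family_on_def)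
qed

text \<open>Rate 0 belongs to an absorbing state, whose holding time is infinite; the exponential
  density with parameter 0 would be the zero function. This is why holding times live in
  \<open>ennreal\<close>.\<close>

definition holding_law :: "real \<Rightarrow> ennreal measure" where
  "holding_law q = (if q = 0 then return borel \<infinity> else distr (density lborel (exponential_density q)) borel ennreal)"

lemma sets_holding_law[measurable_cong, simp]: "sets (holding_law q) = sets borel"
  by (simp add: holding_law_def)

lemma space_holding_law[simp]: "space (holding_law q) = UNIV"
  by (simp add: holding_law_def)

lemma prob_space_holding_law: "0 \<le> q \<Longrightarrow> prob_space (holding_law q)"
  unfolding holding_law_def
  by (auto intro!: prob_space_return prob_space.prob_space_distr prob_space_exponential_density)

lemma emeasure_holding_law_greaterThan:
  assumes "0 \<le> q" "0 \<le> s"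
  shows "emeasure (holding_law q) {ennreal s<..} = ennreal (exp (- q * s))"
proof (cases "q = 0")
  case False
  then have q: "0 < q" using assms by simp
  interpret E: prob_space "density lborel (exponential_density q)"
    using q by (rule prob_space_exponential_density)
  have "emeasure (holding_law q) {ennreal s<..} = emeasure (density lborel (exponential_density q)) (ennreal -` {ennreal s<..})"
    using False by (simp add: holding_law_def emeasure_distr)
  also have "ennreal -` {ennreal s<..} = space (density lborel (exponential_density q)) - {..s}"
    using assms(2) by (auto simp: ennreal_less_iff)
  also have "emeasure (density lborel (exponential_density q)) \<dots> = 1 - emeasure (density lborel (exponential_density q)) {..s}"
    using E.emeasure_space_1 by (subst emeasure_compl) auto
  also have "\<dots> = ennreal (exp (- q * s))"
    using q assms by (simp add: emeasure_erlang_density erlang_CDF_def ennreal_minus mult.commute flip: ennreal_1)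
  finally show ?thesis .
qed (simp add: holding_law_def)

text \<open>Rays are the events of one holding time whose probabilities
  \<open>markov_process\<close> prescribes. \<open>UNIV\<close> is added because no ray contains 0,
  so the rays alone do not cover the space.\<close>

definition upper_rays :: "ennreal set set" where
  "upper_rays = insert UNIV {{ennreal a<..} |a. 0 \<le> a}"

lemma Int_stable_upper_rays: "Int_stable upper_rays"
proof -
  have max: "max (ennreal a) (ennreal b) = ennreal (max a b)" for a b
    by (cases a b rule: le_cases) (simp_all add: max.absorb1 max.absorb2 ennreal_leI)
  have "{ennreal a<..} \<inter> {ennreal b<..} = {ennreal (max a b)<..}" for a b
    unfolding max[symmetric] by (simp add: set_eq_iff)
  moreover have "0 \<le> max a b" if "0 \<le> a" for a b :: real
    using that by simp
  ultimately show ?thesis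
    unfolding Int_stable_def upper_rays_def by blast
qed

lemma borel_eq_upper_rays: "(borel :: ennreal measure) = sigma UNIV upper_rays"
proof (rule measure_eqI)
  have "{a<..} \<in> sigma_sets UNIV upper_rays" for a :: ennreal
  proof (cases a)
    case top
    have "{a<..} = UNIV - UNIV" using top by auto
    then show ?thesis by (simp add: sigma_sets.Empty)
  qed (auto simp: upper_rays_def)
  then have "sigma_sets UNIV (range greaterThan) \<subseteq> sigma_sets UNIV upper_rays"
    by (intro sigma_sets_mono) auto
  moreover have "sigma_sets UNIV upper_rays \<subseteq> sigma_sets UNIV (range greaterThan)"
    by (intro sigma_sets_mono) (auto simp: upper_rays_def intro: sigma_sets_top)
  ultimately show "sets (borel :: ennreal measure) = sets (sigma UNIV upper_rays)"
    by (simp add: borel_Ioi)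
qed (simp add: emeasure_sigma borel_def)

lemma sets_PiM_upper_rays:
  "sets (PiM {..n} (\<lambda>_. borel :: ennreal measure)) =
    sigma_sets (\<Pi>\<^sub>E i\<in>{..n::nat}. UNIV) {Pi\<^sub>E {..n} A |A. \<forall>i. A i \<in> upper_rays}"
proof -
  let ?E = "{{f\<in>(\<Pi>\<^sub>E i\<in>{..n}. UNIV). \<forall>i\<in>j. f i \<in> A i} | A j. j \<in> {{..n}} \<and> A \<in> Pi j (\<lambda>_. upper_rays)}"
  have E: "?E = {Pi\<^sub>E {..n} A |A. \<forall>i. A i \<in> upper_rays}"
  proof (intro set_eqI iffI)
    fix X assume "X \<in> ?E"
    then obtain A where A: "X = {f\<in>(\<Pi>\<^sub>E i\<in>{..n}. UNIV). \<forall>i\<in>{..n}. f i \<in> A i}" "A \<in> Pi {..n} (\<lambda>_. upper_rays)"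
      by auto
    have "X = Pi\<^sub>E {..n} (\<lambda>i. if i \<le> n then A i else UNIV)" "\<forall>i. (if i \<le> n then A i else UNIV) \<in> upper_rays"
      using A(2) unfolding A(1) by (auto simp: upper_rays_def PiE_iff extensional_def)
    then show "X \<in> {Pi\<^sub>E {..n} A |A. \<forall>i. A i \<in> upper_rays}" by blast
  next
    fix X assume "X \<in> {Pi\<^sub>E {..n} A |A. \<forall>i. A i \<in> upper_rays}"
    then obtain A where A: "X = Pi\<^sub>E {..n} A" "\<forall>i. A i \<in> upper_rays" by auto
    have "X = {f\<in>(\<Pi>\<^sub>E i\<in>{..n}. UNIV). \<forall>i\<in>{..n}. f i \<in> A i}"
      unfolding A(1) by (auto simp: PiE_iff extensional_def)
    moreover have "A \<in> Pi {..n} (\<lambda>_. upper_rays)" using A(2) by auto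
    ultimately show "X \<in> ?E" by blast
  qed
  have "sets (PiM {..n} (\<lambda>_. borel :: ennreal measure)) = sets (sigma (\<Pi>\<^sub>E i\<in>{..n}. UNIV) ?E)"
    unfolding borel_eq_upper_rays
    by (rule sets_PiM_sigma) (auto simp: upper_rays_def intro!: exI[of _ "{UNIV}"])
  also have "\<dots> = sigma_sets (\<Pi>\<^sub>E i\<in>{..n}. UNIV) ?E"
    by (rule sets_measure_of) auto
  finally show ?thesis unfolding E .
qed

section \<open>Joint law of a finite path and its holding times\<close>

locale jump_holding_process = generator_matrix Q for Q :: "'s::countable \<Rightarrow> 's \<Rightarrow> real" +
  fixes P :: "'s \<Rightarrow> 'w measure" and Y :: "nat \<Rightarrow> 'w \<Rightarrow> 's" and S :: "nat \<Rightarrow> 'w \<Rightarrow> ennreal"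
  assumes prob_space_P: "prob_space (P x)"
    and measurable_Y[measurable]: "Y n \<in> measurable (P x) (count_space UNIV)"
    and measurable_S[measurable]: "S n \<in> borel_measurable (P x)"
    and law: "(\<forall>i\<le>n. 0 \<le> ss i) \<Longrightarrow>
           measure (P x)
             {\<omega> \<in> space (P x). \<forall>i\<le>n. Y i \<omega> = ys i \<and> ennreal (ss i) < S i \<omega>} =
           of_bool (ys 0 = x) * (\<Prod>i<n. jump_prob Q (ys i) (ys (Suc i))) *
             (\<Prod>i\<le>n. exp (- exit_rate Q (ys i) * ss i))"
begin

definition path :: "nat \<Rightarrow> 'w \<Rightarrow> 's list" where
  "path n \<omega> = map (\<lambda>i. Y i \<omega>) [0..<Suc n]"

lemma path_eq_iff: "path n \<omega> = ys \<longleftrightarrow> length ys = Suc n \<and> (\<forall>i\<le>n. Y i \<omega> = ys ! i)"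
  unfolding path_def list_eq_iff_nth_eq by (auto simp: less_Suc_eq_le simp del: upt_Suc)

lemma measurable_path[measurable]: "path n \<in> measurable (P x) (count_space UNIV)"
proof -
  have "path n -` {ys} \<inter> space (P x) \<in> sets (P x)" for ys
  proof (cases "length ys = Suc n")
    case True
    have "path n -` {ys} \<inter> space (P x) = {\<omega>\<in>space (P x). path n \<omega> = ys}" by auto
    also have "\<dots> = {\<omega>\<in>space (P x). \<forall>i\<in>{..n}. Y i \<omega> = ys ! i}"
      using True by (simp add: path_eq_iff Ball_def)
    also have "\<dots> \<in> sets (P x)" by measurable
    finally show ?thesis .
  next
    case False
    then have "path n \<omega> \<noteq> ys" for \<omega> by (simp add: path_eq_iff)
    then have "path n -` {ys} \<inter> space (P x) = {}" by blast
    then show ?thesis by simp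
  qed
  then show ?thesis by (auto simp: measurable_count_space_eq2_countable)
qed

lemma law_path:
  assumes "\<And>i. i \<le> n \<Longrightarrow> 0 \<le> ss i"
  shows "emeasure (P x) {\<omega>\<in>space (P x). path n \<omega> = ys \<and> (\<forall>i\<le>n. ennreal (ss i) < S i \<omega>)} =
    ennreal (pmf (paths n x) ys * (\<Prod>i\<le>n. exp (- exit_rate Q (ys ! i) * ss i)))"
proof (cases "length ys = Suc n")
  case True
  interpret prob_space "P x" by (rule prob_space_P)
  have "{\<omega>\<in>space (P x). path n \<omega> = ys \<and> (\<forall>i\<le>n. ennreal (ss i) < S i \<omega>)} =
    {\<omega>\<in>space (P x). \<forall>i\<le>n. Y i \<omega> = ys ! i \<and> ennreal (ss i) < S i \<omega>}"
    using True by (simp add: path_eq_iff) blast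
  moreover have "hd ys = ys ! 0" "ys \<noteq> []"
    using True by (cases ys; simp)+
  ultimately show ?thesis
    using True law[of n ss x "(!) ys"] assms by (simp add: emeasure_eq_measure pmf_paths path_weight_conv_prod)
next
  case False
  then have "pmf (paths n x) ys = 0"
    using set_pmf_paths[of ys n x] by (auto simp: set_pmf_iff)
  moreover have "{\<omega>\<in>space (P x). path n \<omega> = ys \<and> (\<forall>i\<le>n. ennreal (ss i) < S i \<omega>)} = {}"
    using False by (auto simp: path_eq_iff)
  ultimately show ?thesis by (simp only:) simp
qed

text \<open>With all thresholds equal to 0 the exponential factors are 1, and the prescribed
  probabilities sum over all paths to 1.\<close>

lemma AE_S_pos: "AE \<omega> in P x. 0 < S i \<omega>"
proof -
  interpret prob_space "P x" by (rule prob_space_P)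
  have "emeasure (P x) {\<omega>\<in>space (P x). \<forall>j\<in>{..i}. 0 < S j \<omega>} =
    (\<integral>\<^sup>+ys. emeasure (P x) {\<omega>\<in>space (P x). path i \<omega> = ys \<and> (\<forall>j\<in>{..i}. 0 < S j \<omega>)} \<partial>count_space UNIV)"
    by (rule emeasure_split_countable) measurable
  also have "\<dots> = (\<integral>\<^sup>+ys. ennreal (pmf (paths i x) ys) \<partial>count_space UNIV)"
    using law_path[of i "\<lambda>_. 0" x] by (intro nn_integral_cong) (simp add: Ball_def)
  also have "\<dots> = 1" by (simp add: nn_integral_pmf)
  finally have "AE \<omega> in P x. \<forall>j\<in>{..i}. 0 < S j \<omega>"
    by (subst AE_iff_emeasure_eq_1) auto
  then show ?thesis by eventually_elim auto
qed

lemma emeasure_path: "emeasure (P x) {\<omega>\<in>space (P x). path n \<omega> = ys} = ennreal (pmf (paths n x) ys)"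
proof -
  have "AE \<omega> in P x. \<forall>i\<in>{..n}. 0 < S i \<omega>"
    by (intro AE_finite_allI AE_S_pos) auto
  then have "emeasure (P x) {\<omega>\<in>space (P x). path n \<omega> = ys} =
    emeasure (P x) {\<omega>\<in>space (P x). path n \<omega> = ys \<and> (\<forall>i\<in>{..n}. 0 < S i \<omega>)}"
    by (intro emeasure_eq_AE) auto
  then show ?thesis
    using law_path[of n "\<lambda>_. 0" x ys] by (simp add: Ball_def)
qed

lemma distr_path: "distr (P x) (count_space UNIV) (path n) = measure_pmf (paths n x)"
proof (rule measure_eqI_countable[where A=UNIV])
  fix ys
  have "path n -` {ys} \<inter> space (P x) = {\<omega>\<in>space (P x). path n \<omega> = ys}" by auto
  then show "emeasure (distr (P x) (count_space UNIV) (path n)) {ys} = emeasure (measure_pmf (paths n x)) {ys}"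
    using emeasure_path[of x n ys] by (simp add: emeasure_distr emeasure_pmf_single)
qed auto

lemma emeasure_path_pred:
  "emeasure (P x) {\<omega>\<in>space (P x). R (path n \<omega>)} = emeasure (measure_pmf (paths n x)) {ys. R ys}"
proof -
  have "path n -` {ys. R ys} \<inter> space (P x) = {\<omega>\<in>space (P x). R (path n \<omega>)}" by auto
  then show ?thesis
    unfolding distr_path[symmetric] by (simp add: emeasure_distr)
qed

lemma AE_path: "(\<And>ys. ys \<in> set_pmf (paths n x) \<Longrightarrow> R ys) \<Longrightarrow> AE \<omega> in P x. R (path n \<omega>)"
proof -
  assume "\<And>ys. ys \<in> set_pmf (paths n x) \<Longrightarrow> R ys"
  then have "AE ys in distr (P x) (count_space UNIV) (path n). R ys"
    unfolding distr_path by (simp add: AE_measure_pmf_iff)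
  then show ?thesis by (simp add: AE_distr_iff)
qed

text \<open>Two finite measures that agree on the boxes of rays coincide, and on boxes the value is
  given by \<open>law_path\<close>. The indicator of a fixed path stands in for conditioning on it:
  given the path, the holding times are independent.\<close>

lemma holding_times_law:
  assumes f: "f \<in> borel_measurable (PiM {..n} (\<lambda>_. borel))"
  shows "(\<integral>\<^sup>+\<omega>. f (\<lambda>i\<in>{..n}. S i \<omega>) * indicator {\<omega>. path n \<omega> = ys} \<omega> \<partial>P x) =
    ennreal (pmf (paths n x) ys) * (\<integral>\<^sup>+s. f s \<partial>PiM {..n} (\<lambda>i. holding_law (exit_rate Q (ys ! i))))"
proof -
  note prob_space_holding_law[OF exit_rate_nonneg, simp]
  interpret prob_space "P x" by (rule prob_space_P)
  let ?H = "PiM {..n} (\<lambda>i. holding_law (exit_rate Q (ys ! i)))" and ?B = "PiM {..n} (\<lambda>_. borel :: ennreal measure)"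
  let ?c = "ennreal (pmf (paths n x) ys)" and ?S = "\<lambda>\<omega>. \<lambda>i\<in>{..n}. S i \<omega>"
  have ind[measurable]: "(\<lambda>\<omega>. indicator {\<omega>. path n \<omega> = ys} \<omega> :: ennreal) \<in> borel_measurable (P x)"
    by (subst borel_measurable_indicator_iff) measurable
  have [measurable]: "?S \<in> measurable (P x) ?B" by measurable
  interpret H: product_sigma_finite "\<lambda>i. holding_law (exit_rate Q (ys ! i))"
    by (auto intro!: product_sigma_finite.intro prob_space_imp_sigma_finite)
  let ?E = "{Pi\<^sub>E {..n} A |A. \<forall>i. A i \<in> upper_rays}"
  note setsB = sets_PiM_upper_rays[of n]
  have setsH: "sets ?H = sets ?B" by (intro sets_PiM_cong) auto
  have eq: "distr (density (P x) (indicator {\<omega>. path n \<omega> = ys})) ?B ?S = density ?H (\<lambda>_. ?c)"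
  proof (rule measure_eqI_generator_eq[of ?E _ _ _ "\<lambda>_. \<Pi>\<^sub>E i\<in>{..n}. UNIV"])
    show "Int_stable ?E"
    proof (rule Int_stableI)
      fix X X' assume "X \<in> ?E" "X' \<in> ?E"
      then obtain A A' where "X = Pi\<^sub>E {..n} A" "\<forall>i. A i \<in> upper_rays"
        "X' = Pi\<^sub>E {..n} A'" "\<forall>i. A' i \<in> upper_rays"
        by blast
      then have "X \<inter> X' = Pi\<^sub>E {..n} (\<lambda>i. A i \<inter> A' i)" "\<forall>i. A i \<inter> A' i \<in> upper_rays"
        using Int_stable_upper_rays by (auto simp: Int_stable_def PiE_Int)
      then show "X \<inter> X' \<in> ?E" by blast
    qed
  next
    fix X assume "X \<in> ?E"
    then obtain A where PiE: "X = Pi\<^sub>E {..n} A" and A: "\<forall>i. A i \<in> upper_rays"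
      by blast
    \<comment> \<open>A factor \<open>UNIV\<close> receives the threshold 0: its mass is
      \<open>exp 0 = 1\<close>, and almost surely \<open>S i > 0\<close>, so it may be replaced by
      the ray above 0.\<close>
    have "\<exists>a\<ge>0. A i = UNIV \<and> a = 0 \<or> A i = {ennreal a<..}" if "i \<le> n" for i
      using A[rule_format, of i] by (auto simp: upper_rays_def)
    then obtain a where a: "\<And>i. i \<le> n \<Longrightarrow> 0 \<le> a i" "\<And>i. i \<le> n \<Longrightarrow> A i = UNIV \<and> a i = 0 \<or> A i = {ennreal (a i)<..}"
      by metis
    have XB: "X \<in> sets ?B"
      unfolding setsB using \<open>X \<in> ?E\<close> by (rule sigma_sets.Basic)
    have A_sets: "A i \<in> sets borel" if "i \<le> n" for i
      using a(2)[OF that] by (elim disjE) simp_all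
    have H1: "emeasure (holding_law (exit_rate Q (ys ! i))) (A i) = ennreal (exp (- exit_rate Q (ys ! i) * a i))" if "i \<le> n" for i
    proof -
      interpret h: prob_space "holding_law (exit_rate Q (ys ! i))" by simp
      show ?thesis
        using a(2)[OF that] emeasure_holding_law_greaterThan[OF exit_rate_nonneg a(1)[OF that], of "ys ! i"]
          h.emeasure_space_1 by (elim disjE) simp_all
    qed
    have "emeasure (density ?H (\<lambda>_. ?c)) X = ?c * emeasure ?H X"
      using XB setsH by (simp add: emeasure_density_const)
    also have "emeasure ?H X = (\<Prod>i\<le>n. emeasure (holding_law (exit_rate Q (ys ! i))) (A i))"
      unfolding PiE using A_sets by (subst H.emeasure_PiM) auto
    also have "\<dots> = ennreal (\<Prod>i\<le>n. exp (- exit_rate Q (ys ! i) * a i))"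
      using H1 by (simp add: prod_ennreal)
    also have "?c * \<dots> = emeasure (P x) {\<omega>\<in>space (P x). path n \<omega> = ys \<and> (\<forall>i\<le>n. ennreal (a i) < S i \<omega>)}"
      using law_path[of n a x ys] a(1) by (simp add: ennreal_mult' prod_nonneg)
    also have "\<dots> = emeasure (P x) {\<omega>\<in>space (P x). path n \<omega> = ys \<and> ?S \<omega> \<in> X}"
    proof (rule emeasure_eq_AE)
      have "AE \<omega> in P x. \<forall>i\<in>{..n}. 0 < S i \<omega>"
        by (intro AE_finite_allI AE_S_pos) auto
      then show "AE \<omega> in P x. \<omega> \<in> {\<omega>\<in>space (P x). path n \<omega> = ys \<and> (\<forall>i\<le>n. ennreal (a i) < S i \<omega>)} \<longleftrightarrow>
        \<omega> \<in> {\<omega>\<in>space (P x). path n \<omega> = ys \<and> ?S \<omega> \<in> X}"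
      proof eventually_elim
        case (elim \<omega>)
        have "S i \<omega> \<in> A i \<longleftrightarrow> ennreal (a i) < S i \<omega>" if "i \<le> n" for i
          using a(2)[OF that] elim that by (elim disjE) simp_all
        then show ?case unfolding PiE by (simp add: PiE_iff Ball_def)
      qed
      have "{\<omega>\<in>space (P x). path n \<omega> = ys \<and> (\<forall>i\<in>{..n}. ennreal (a i) < S i \<omega>)} \<in> sets (P x)" by measurable
      then show "{\<omega>\<in>space (P x). path n \<omega> = ys \<and> (\<forall>i\<le>n. ennreal (a i) < S i \<omega>)} \<in> sets (P x)" by (simp add: Ball_def)
      note XB[measurable]
      show "{\<omega>\<in>space (P x). path n \<omega> = ys \<and> ?S \<omega> \<in> X} \<in> sets (P x)" by measurable
    qed
    also have "\<dots> = emeasure (distr (density (P x) (indicator {\<omega>. path n \<omega> = ys})) ?B ?S) X"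
    proof -
      note XB[measurable]
      have "?S -` X \<inter> space (P x) \<in> sets (P x)" by measurable
      then show ?thesis
        using XB by (subst emeasure_distr)
          (auto simp: emeasure_density indicator_inter_arith[symmetric] nn_integral_indicator' 
            intro!: arg_cong[where f="emeasure (P x)"])
    qed
    finally show "emeasure (distr (density (P x) (indicator {\<omega>. path n \<omega> = ys})) ?B ?S) X = emeasure (density ?H (\<lambda>_. ?c)) X"
      by simp
  next
    show "emeasure (distr (density (P x) (indicator {\<omega>. path n \<omega> = ys})) ?B ?S) (\<Pi>\<^sub>E i\<in>{..n}. UNIV) \<noteq> \<infinity>" for i :: nat
    proof -
      have "emeasure (density (P x) (indicator {\<omega>. path n \<omega> = ys})) (space (P x)) \<le> (\<integral>\<^sup>+\<omega>. 1 \<partial>P x)"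
        by (subst emeasure_density) (simp, simp, intro nn_integral_mono, simp add: indicator_def)
      then interpret D: finite_measure "density (P x) (indicator {\<omega>. path n \<omega> = ys})"
        by (intro finite_measureI) (auto simp: emeasure_space_1 top_unique)
      interpret D': finite_measure "distr (density (P x) (indicator {\<omega>. path n \<omega> = ys})) ?B ?S"
        by (rule D.finite_measure_distr) simp
      show ?thesis by simp
    qed
    show "sets (density ?H (\<lambda>_. ?c)) = sigma_sets (\<Pi>\<^sub>E i\<in>{..n}. UNIV) ?E"
      using setsH setsB by simp
    show "range (\<lambda>_. \<Pi>\<^sub>E i\<in>{..n}. UNIV) \<subseteq> ?E"
      by (auto simp: upper_rays_def intro!: exI[of _ "\<lambda>_. UNIV"])
  qed (auto simp: setsB)
  have [measurable]: "f \<in> borel_measurable ?B" "f \<in> borel_measurable ?H"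
    using f by (auto simp: measurable_cong_sets[OF setsH refl])
  have "(\<integral>\<^sup>+\<omega>. f (?S \<omega>) * indicator {\<omega>. path n \<omega> = ys} \<omega> \<partial>P x) = 
    (\<integral>\<^sup>+s. f s \<partial>distr (density (P x) (indicator {\<omega>. path n \<omega> = ys})) ?B ?S)"
    by (simp add: nn_integral_distr nn_integral_density mult.commute)
  also have "\<dots> = ?c * (\<integral>\<^sup>+s. f s \<partial>?H)"
    unfolding eq by (simp add: nn_integral_density nn_integral_cmult)
  finally show ?thesis .
qed

end

section \<open>Reversal of the holding times\<close>

lemma nn_integral_PiM_permute:
  assumes I: "finite I" and p: "bij_betw p I I" and M: "sigma_finite_measure M"
    and f[measurable]: "f \<in> borel_measurable (PiM I (\<lambda>_. M))"
  shows "(\<integral>\<^sup>+s. f (\<lambda>i\<in>I. s (p i)) \<partial>PiM I (\<lambda>_. M)) = (\<integral>\<^sup>+s. f s \<partial>PiM I (\<lambda>_. M))"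
proof -
  interpret product_sigma_finite "\<lambda>_. M" using M by (rule product_sigma_finite.intro)
  have pI: "p i \<in> I" if "i \<in> I" for i using p that by (auto simp: bij_betw_def)
  have [measurable]: "(\<lambda>s. \<lambda>i\<in>I. s (p i)) \<in> measurable (PiM I (\<lambda>_. M)) (PiM I (\<lambda>_. M))"
    by (intro measurable_restrict measurable_component_singleton pI)
  have "distr (PiM I (\<lambda>_. M)) (PiM I (\<lambda>_. M)) (\<lambda>s. \<lambda>i\<in>I. s (p i)) = PiM I (\<lambda>_. M)"
  proof (rule PiM_eqI[OF I])
    fix A assume A: "\<And>i. i \<in> I \<Longrightarrow> A i \<in> sets M"
    define r where "r = the_inv_into I p"
    have r: "bij_betw r I I" unfolding r_def using p by (rule bij_betw_the_inv_into)
    have rp: "r (p i) = i" if "i \<in> I" for i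
      using p that by (auto simp: r_def bij_betw_def intro: the_inv_into_f_f)
    have rI: "r i \<in> I" if "i \<in> I" for i using r that by (auto simp: bij_betw_def)
    have pr: "p (r i) = i" if "i \<in> I" for i
      using p that by (auto simp: r_def bij_betw_def intro: f_the_inv_into_f)
    have "(\<lambda>s. \<lambda>i\<in>I. s (p i)) -` Pi\<^sub>E I A \<inter> space (PiM I (\<lambda>_. M)) = Pi\<^sub>E I (\<lambda>i. A (r i))"
    proof (intro set_eqI iffI)
      fix s assume "s \<in> (\<lambda>s. \<lambda>i\<in>I. s (p i)) -` Pi\<^sub>E I A \<inter> space (PiM I (\<lambda>_. M))"
      then have s: "\<And>i. i \<in> I \<Longrightarrow> s (p i) \<in> A i" "s \<in> extensional I"
        by (auto simp: space_PiM PiE_iff)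
      have "s i \<in> A (r i)" if "i \<in> I" for i
        using s(1)[OF rI[OF that]] pr[OF that] by simp
      with s(2) show "s \<in> Pi\<^sub>E I (\<lambda>i. A (r i))" by (auto simp: PiE_iff)
    next
      fix s assume s: "s \<in> Pi\<^sub>E I (\<lambda>i. A (r i))"
      have "s (p i) \<in> A i" if "i \<in> I" for i
        using s pI[OF that] rp[OF that] by (auto simp: PiE_iff)
      moreover have "s i \<in> space M" if "i \<in> I" for i
        using s that A[OF rI[OF that]] sets.sets_into_space by (fastforce simp: PiE_iff)
      ultimately show "s \<in> (\<lambda>s. \<lambda>i\<in>I. s (p i)) -` Pi\<^sub>E I A \<inter> space (PiM I (\<lambda>_. M))"
        using s by (auto simp: space_PiM PiE_iff)
    qed
    then have "emeasure (distr (PiM I (\<lambda>_. M)) (PiM I (\<lambda>_. M)) (\<lambda>s. \<lambda>i\<in>I. s (p i))) (Pi\<^sub>E I A) =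
      emeasure (PiM I (\<lambda>_. M)) (Pi\<^sub>E I (\<lambda>i. A (r i)))"
      using I A by (subst emeasure_distr) (auto intro!: sets_PiM_I_finite)
    also have "\<dots> = (\<Prod>i\<in>I. emeasure M (A (r i)))"
      using I A rI by (intro emeasure_PiM) auto
    also have "\<dots> = (\<Prod>i\<in>I. emeasure M (A i))"
      using r by (rule prod.reindex_bij_betw)
    finally show "emeasure (distr (PiM I (\<lambda>_. M)) (PiM I (\<lambda>_. M)) (\<lambda>s. \<lambda>i\<in>I. s (p i))) (Pi\<^sub>E I A) = \<dots>" .
  qed simp
  moreover have "(\<integral>\<^sup>+s. f (\<lambda>i\<in>I. s (p i)) \<partial>PiM I (\<lambda>_. M)) =
    (\<integral>\<^sup>+s. f s \<partial>distr (PiM I (\<lambda>_. M)) (PiM I (\<lambda>_. M)) (\<lambda>s. \<lambda>i\<in>I. s (p i)))"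
    by (simp add: nn_integral_distr)
  ultimately show ?thesis by simp
qed

text \<open>Fubini, one coordinate at a time. Nonzero rates are required because only then does a
  holding time have a Lebesgue density.\<close>

lemma nn_integral_PiM_holding_law:
  assumes "finite I" and q: "\<And>i. 0 \<le> q i" "\<And>i. i \<in> I \<Longrightarrow> q i \<noteq> 0"
    and "f \<in> borel_measurable (PiM I (\<lambda>_. borel))"
  shows "(\<integral>\<^sup>+s. f s \<partial>PiM I (\<lambda>i. holding_law (q i))) =
    (\<integral>\<^sup>+s. (\<Prod>i\<in>I. ennreal (exponential_density (q i) (s i))) * f (\<lambda>i\<in>I. ennreal (s i)) \<partial>PiM I (\<lambda>_. lborel))"
  using assms(1) q(2) assms(4)
proof (induction I arbitrary: f)
  case empty
  show ?case by (simp add: PiM_empty nn_integral_count_space_finite)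
next
  case (insert i I)
  note [measurable] = insert.prems(2)
  interpret H: product_sigma_finite "\<lambda>i. holding_law (q i)"
    by (intro product_sigma_finite.intro prob_space_imp_sigma_finite prob_space_holding_law q)
  interpret L: product_sigma_finite "\<lambda>_. lborel :: real measure"
    by (intro product_sigma_finite.intro) (rule lborel.sigma_finite_measure_axioms)
  have qi: "0 < q i" using q(1)[of i] insert.prems(1)[of i] by simp
  define g where "g s = (\<integral>\<^sup>+y. ennreal (exponential_density (q i) y) * f (s(i := ennreal y)) \<partial>lborel)" for s
  have g[measurable]: "g \<in> borel_measurable (PiM I (\<lambda>_. borel))"
    unfolding g_def by measurable
  have setsH: "sets (PiM J (\<lambda>i. holding_law (q i))) = sets (PiM J (\<lambda>_. borel))" for J
    by (intro sets_PiM_cong) auto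
  have fH: "f \<in> borel_measurable (PiM (insert i I) (\<lambda>i. holding_law (q i)))"
    using insert.prems(2) by (simp add: measurable_cong_sets[OF setsH refl])
  have "(\<integral>\<^sup>+s. f s \<partial>PiM (insert i I) (\<lambda>i. holding_law (q i))) =
    (\<integral>\<^sup>+s. \<integral>\<^sup>+y. f (s(i := y)) \<partial>holding_law (q i) \<partial>PiM I (\<lambda>i. holding_law (q i)))"
    using insert.hyps fH by (rule H.product_nn_integral_insert)
  also have "\<dots> = (\<integral>\<^sup>+s. g s \<partial>PiM I (\<lambda>i. holding_law (q i)))"
  proof (rule nn_integral_cong)
    fix s assume "s \<in> space (PiM I (\<lambda>i. holding_law (q i)))"
    then have s: "s \<in> space (PiM I (\<lambda>_. borel :: ennreal measure))" by (simp add: space_PiM)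
    have [measurable]: "(\<lambda>y. f (s(i := y))) \<in> borel_measurable borel"
      using s by measurable
    show "(\<integral>\<^sup>+y. f (s(i := y)) \<partial>holding_law (q i)) = g s"
      using qi by (simp add: holding_law_def g_def nn_integral_distr nn_integral_density)
  qed
  also have "\<dots> = (\<integral>\<^sup>+s. (\<Prod>i\<in>I. ennreal (exponential_density (q i) (s i))) * g (\<lambda>i\<in>I. ennreal (s i)) \<partial>PiM I (\<lambda>_. lborel))"
    using insert.prems(1) by (intro insert.IH g) auto
  also have "\<dots> = (\<integral>\<^sup>+s. \<integral>\<^sup>+y. (\<Prod>j\<in>insert i I. ennreal (exponential_density (q j) ((s(i := y)) j))) *
      f (\<lambda>j\<in>insert i I. ennreal ((s(i := y)) j)) \<partial>lborel \<partial>PiM I (\<lambda>_. lborel))"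
  proof (rule nn_integral_cong)
    fix s :: "'a \<Rightarrow> real"
    have r: "(\<lambda>i\<in>I. ennreal (s i))(i := ennreal y) = (\<lambda>j\<in>insert i I. ennreal ((s(i := y)) j))" for y
      by (auto simp: fun_eq_iff)
    have s: "(\<lambda>i\<in>I. ennreal (s i)) \<in> space (PiM I (\<lambda>_. borel))" by (simp add: space_PiM)
    have [measurable]: "(\<lambda>y. f ((\<lambda>i\<in>I. ennreal (s i))(i := ennreal y))) \<in> borel_measurable borel"
      using s by measurable
    have p: "(\<Prod>j\<in>insert i I. ennreal (exponential_density (q j) ((s(i := y)) j))) =
      (\<Prod>i\<in>I. ennreal (exponential_density (q i) (s i))) * ennreal (exponential_density (q i) y)" for y
    proof -
      have "(\<Prod>j\<in>I. ennreal (exponential_density (q j) ((s(i := y)) j))) = (\<Prod>i\<in>I. ennreal (exponential_density (q i) (s i)))"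
        using insert.hyps by (intro prod.cong) auto
      then show ?thesis using insert.hyps by (simp add: mult.commute)
    qed
    show "(\<Prod>i\<in>I. ennreal (exponential_density (q i) (s i))) * g (\<lambda>i\<in>I. ennreal (s i)) =
      (\<integral>\<^sup>+y. (\<Prod>j\<in>insert i I. ennreal (exponential_density (q j) ((s(i := y)) j))) *
      f (\<lambda>j\<in>insert i I. ennreal ((s(i := y)) j)) \<partial>lborel)"
      unfolding p g_def r[symmetric]
      by (subst nn_integral_cmult[symmetric]) (simp_all add: mult.assoc)
  qed
  also have "\<dots> = (\<integral>\<^sup>+s. (\<Prod>j\<in>insert i I. ennreal (exponential_density (q j) (s j))) *
      f (\<lambda>j\<in>insert i I. ennreal (s j)) \<partial>PiM (insert i I) (\<lambda>_. lborel))"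
    using insert.hyps by (subst L.product_nn_integral_insert) measurable
  finally show ?case .
qed

text \<open>Parametrises the tuples of total length \<open>T\<close> by their first \<open>n\<close>
  entries. Signs are left open, so that changes of variables are affine maps of the whole space;
  \<open>path_density\<close> cuts out the simplex.\<close>

definition simplex_point :: "nat \<Rightarrow> real \<Rightarrow> (nat \<Rightarrow> real) \<Rightarrow> nat \<Rightarrow> real" where
  "simplex_point n T s = (\<lambda>k\<in>{..n}. if k < n then s k else T - (\<Sum>l<n. s l))"

lemma measurable_simplex_point[measurable]:
  "simplex_point n T \<in> measurable (PiM {..<n} (\<lambda>_. lborel)) (PiM {..n} (\<lambda>_. borel))"
  unfolding simplex_point_def
proof (rule measurable_restrict)
  fix k assume "k \<in> {..n}"
  show "(\<lambda>s. if k < n then s k else T - (\<Sum>l<n. s l)) \<in> borel_measurable (PiM {..<n} (\<lambda>_. lborel))"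
    by (cases "k < n") auto
qed

text \<open>
  The last holding time is determined by the others. Reflecting \<open>s 0\<close> exchanges the first and the
  last one, and permuting the remaining coordinates reverses the others.
\<close>

lemma nn_integral_simplex_rev:
  assumes F[measurable]: "F \<in> borel_measurable (PiM {..n} (\<lambda>_. borel))"
  shows "(\<integral>\<^sup>+s. F (simplex_point n T s) \<partial>PiM {..<n} (\<lambda>_. lborel)) =
    (\<integral>\<^sup>+s. F (\<lambda>k\<in>{..n}. simplex_point n T s (n - k)) \<partial>PiM {..<n} (\<lambda>_. lborel))"
proof (cases "n = 0")
  case True
  then have "(\<lambda>k\<in>{..n}. simplex_point n T s (n - k)) = simplex_point n T s" for s
    by (auto simp: simplex_point_def fun_eq_iff)
  then show ?thesis by simp
next
  case False
  interpret L: product_sigma_finite "\<lambda>_. lborel :: real measure"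
    by (intro product_sigma_finite.intro) (rule lborel.sigma_finite_measure_axioms)
  have ins: "{..<n} = insert 0 {1..<n}" using False by auto
  have fin: "finite {1..<n}" "0 \<notin> {1..<n}" by auto
  have sum: "(\<Sum>l<n. (s(0 := y)) l) = y + (\<Sum>l\<in>{1..<n}. s l)" for s :: "nat \<Rightarrow> real" and y
  proof -
    have "(\<Sum>l\<in>{1..<n}. (s(0 := y)) l) = (\<Sum>l\<in>{1..<n}. s l)" by (intro sum.cong) auto
    then show ?thesis unfolding ins using fin by simp
  qed
  define G where "G s y = (\<lambda>k\<in>{..n}. if k = 0 then T - (\<Sum>l\<in>{1..<n}. s l) - y else if k < n then s k else y)"
    for s :: "nat \<Rightarrow> real" and y
  have G[measurable]: "(\<lambda>(s, y). G s y) \<in> measurable (PiM {1..<n} (\<lambda>_. lborel) \<Otimes>\<^sub>M lborel) (PiM {..n} (\<lambda>_. borel))"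
    unfolding G_def split_beta'
  proof (rule measurable_restrict)
    fix k assume "k \<in> {..n}"
    consider "k = 0" | "k \<in> {1..<n}" | "k \<noteq> 0" "\<not> k < n" by force
    then show "(\<lambda>p. if k = 0 then T - (\<Sum>l\<in>{1..<n}. fst p l) - snd p else if k < n then fst p k else snd p)
      \<in> borel_measurable (PiM {1..<n} (\<lambda>_. lborel) \<Otimes>\<^sub>M lborel)"
      by cases auto
  qed
  have comp1[measurable]: "(\<lambda>s. F (simplex_point n T s)) \<in> borel_measurable (PiM (insert 0 {1..<n}) (\<lambda>_. lborel))"
    unfolding ins[symmetric] by measurable
  have "(\<lambda>s. \<lambda>k\<in>{..n}. simplex_point n T s (n - k)) \<in> measurable (PiM {..<n} (\<lambda>_. lborel)) (PiM {..n} (\<lambda>_. borel))"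
  proof (rule measurable_restrict)
    fix k assume "k \<in> {..n}"
    then have "n - k \<in> {..n}" by simp
    from measurable_compose[OF measurable_simplex_point measurable_component_singleton[OF this]]
    show "(\<lambda>s. simplex_point n T s (n - k)) \<in> borel_measurable (PiM {..<n} (\<lambda>_. lborel))" by simp
  qed
  then have comp2[measurable]: "(\<lambda>s. F (\<lambda>k\<in>{..n}. simplex_point n T s (n - k))) \<in> borel_measurable (PiM (insert 0 {1..<n}) (\<lambda>_. lborel))"
    unfolding ins[symmetric] by measurable
  have "(\<integral>\<^sup>+s. F (simplex_point n T s) \<partial>PiM {..<n} (\<lambda>_. lborel)) =
    (\<integral>\<^sup>+s. \<integral>\<^sup>+y. F (simplex_point n T (s(0 := y))) \<partial>lborel \<partial>PiM {1..<n} (\<lambda>_. lborel))"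
    unfolding ins by (rule L.product_nn_integral_insert[OF fin comp1])
  also have "\<dots> = (\<integral>\<^sup>+s. \<integral>\<^sup>+y. F (G s y) \<partial>lborel \<partial>PiM {1..<n} (\<lambda>_. lborel))"
  proof (rule nn_integral_cong)
    fix s :: "nat \<Rightarrow> real" assume s: "s \<in> space (PiM {1..<n} (\<lambda>_. lborel))"
    have "(\<lambda>y. s(0 := y)) \<in> measurable lborel (PiM {..<n} (\<lambda>_. lborel))"
      unfolding ins using s by measurable
    then have "(\<lambda>y. F (simplex_point n T (s(0 := y)))) \<in> borel_measurable borel" by measurable
    then have "(\<integral>\<^sup>+y. F (simplex_point n T (s(0 := y))) \<partial>lborel) =
      (\<integral>\<^sup>+y. F (simplex_point n T (s(0 := (T - (\<Sum>l\<in>{1..<n}. s l)) + (-1) * y))) \<partial>lborel)"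
      by (subst nn_integral_real_affine[where c = "-1" and t = "T - (\<Sum>l\<in>{1..<n}. s l)"]) simp_all
    moreover have "simplex_point n T (s(0 := (T - (\<Sum>l\<in>{1..<n}. s l)) + (-1) * y)) = G s y" for y
      unfolding simplex_point_def sum G_def by (rule ext) (use False in auto)
    ultimately show "(\<integral>\<^sup>+y. F (simplex_point n T (s(0 := y))) \<partial>lborel) = (\<integral>\<^sup>+y. F (G s y) \<partial>lborel)"
      by simp
  qed
  also have "\<dots> = (\<integral>\<^sup>+s. \<integral>\<^sup>+y. F (G (\<lambda>k\<in>{1..<n}. s (n - k)) y) \<partial>lborel \<partial>PiM {1..<n} (\<lambda>_. lborel))"
  proof (rule nn_integral_PiM_permute[symmetric])
    show "bij_betw (\<lambda>k. n - k) {1..<n} {1..<n}"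
      by (rule bij_betwI[where g = "\<lambda>k. n - k"]) auto
    show "(\<lambda>s. \<integral>\<^sup>+y. F (G s y) \<partial>lborel) \<in> borel_measurable (PiM {1..<n} (\<lambda>_. lborel))"
      by measurable
  qed (auto intro: lborel.sigma_finite_measure_axioms)
  also have "\<dots> = (\<integral>\<^sup>+s. \<integral>\<^sup>+y. F (\<lambda>k\<in>{..n}. simplex_point n T (s(0 := y)) (n - k)) \<partial>lborel \<partial>PiM {1..<n} (\<lambda>_. lborel))"
  proof (intro nn_integral_cong arg_cong[where f = F])
    fix s :: "nat \<Rightarrow> real" and y
    have "(\<Sum>l\<in>{1..<n}. (\<lambda>k\<in>{1..<n}. s (n - k)) l) = (\<Sum>l\<in>{1..<n}. s l)"
      by (rule sum.reindex_bij_witness[where i = "\<lambda>k. n - k" and j = "\<lambda>k. n - k"]) auto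
    then show "G (\<lambda>k\<in>{1..<n}. s (n - k)) y = (\<lambda>k\<in>{..n}. simplex_point n T (s(0 := y)) (n - k))"
      unfolding simplex_point_def sum G_def by (intro ext) (use False in auto)
  qed
  also have "\<dots> = (\<integral>\<^sup>+s. F (\<lambda>k\<in>{..n}. simplex_point n T s (n - k)) \<partial>PiM {..<n} (\<lambda>_. lborel))"
    unfolding ins by (rule L.product_nn_integral_insert[OF fin comp2, symmetric])
  finally show ?thesis .
qed

text \<open>Coordinate 0 occurs in every such sum; with the others fixed only one value of it
  produces \<open>c\<close>, and a point has Lebesgue measure 0. The exceptional set is that of
  jumps occurring exactly at an observation time.\<close>

lemma AE_partial_sum_neq:
  fixes k n :: nat
  assumes "k < n"
  shows "AE s in PiM {..<n} (\<lambda>_. lborel). (\<Sum>l\<le>k. s l) \<noteq> (c::real)"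
proof -
  interpret L: product_sigma_finite "\<lambda>_. lborel :: real measure"
    by (intro product_sigma_finite.intro) (rule lborel.sigma_finite_measure_axioms)
  have ins: "{..<n} = insert 0 {1..<n}" "{..k} = insert 0 {1..k}" using assms by auto
  have fin: "finite {1..<n}" "0 \<notin> {1..<n}" by auto
  have meas[measurable]: "(\<lambda>s. \<Sum>l\<le>k. s l) \<in> borel_measurable (PiM {..<n} (\<lambda>_. lborel :: real measure))"
    using assms by (intro borel_measurable_sum) auto
  have ind: "(indicator {s\<in>space (PiM {..<n} (\<lambda>_. lborel)). (\<Sum>l\<le>k. s l) = c} :: _ \<Rightarrow> ennreal)
    \<in> borel_measurable (PiM (insert 0 {1..<n}) (\<lambda>_. lborel))"
    unfolding ins(1)[symmetric] by measurable
  have "emeasure (PiM {..<n} (\<lambda>_. lborel)) {s\<in>space (PiM {..<n} (\<lambda>_. lborel)). (\<Sum>l\<le>k. s l) = c} =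
    (\<integral>\<^sup>+s. indicator {s\<in>space (PiM {..<n} (\<lambda>_. lborel)). (\<Sum>l\<le>k. s l) = c} s \<partial>PiM {..<n} (\<lambda>_. lborel))"
    by (subst nn_integral_indicator) auto
  also have "\<dots> = (\<integral>\<^sup>+s. \<integral>\<^sup>+y. indicator {s\<in>space (PiM {..<n} (\<lambda>_. lborel)). (\<Sum>l\<le>k. s l) = c} (s(0 := y)) \<partial>lborel \<partial>PiM {1..<n} (\<lambda>_. lborel))"
    using L.product_nn_integral_insert[OF fin ind] by (simp only: ins(1)[symmetric])
  also have "\<dots> = (\<integral>\<^sup>+s. \<integral>\<^sup>+y. 0 \<partial>(lborel :: real measure) \<partial>PiM {1..<n} (\<lambda>_. lborel :: real measure))"
  proof (rule nn_integral_cong, rule nn_integral_cong_AE)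
    fix s :: "nat \<Rightarrow> real"
    have "AE y in lborel. y \<noteq> c - (\<Sum>l\<in>{1..k}. s l)" by (rule AE_lborel_singleton)
    then show "AE y in lborel. (indicator {s\<in>space (PiM {..<n} (\<lambda>_. lborel)). (\<Sum>l\<le>k. s l) = c} (s(0 := y)) :: ennreal) = 0"
    proof eventually_elim
      case (elim y)
      have "(\<Sum>l\<le>k. (s(0 := y)) l) = y + (\<Sum>l\<in>{1..k}. s l)"
      proof -
        have "(\<Sum>l\<in>{1..k}. (s(0 := y)) l) = (\<Sum>l\<in>{1..k}. s l)" by (intro sum.cong) auto
        then show ?thesis unfolding ins(2) by simp
      qed
      then show ?case using elim by (auto simp: indicator_def)
    qed
  qed
  finally have "{s\<in>space (PiM {..<n} (\<lambda>_. lborel)). (\<Sum>l\<le>k. s l) = c} \<in> null_sets (PiM {..<n} (\<lambda>_. lborel))"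
    by (auto intro!: null_setsI)
  then show ?thesis by (rule AE_I') auto
qed

section \<open>The density of a path\<close>

text \<open>
  The sojourn intervals are closed here, which makes the event symmetric under reversal of time. The
  half-open intervals of the process differ from them only when a jump occurs at one of the times \<open>t i\<close>.
\<close>

definition sojourn_event :: "nat \<Rightarrow> 's list \<Rightarrow> nat \<Rightarrow> (nat \<Rightarrow> real) \<Rightarrow> (nat \<Rightarrow> 's) \<Rightarrow> (nat \<Rightarrow> real) \<Rightarrow> bool" where
  "sojourn_event n ys m t y u \<longleftrightarrow>
     (\<forall>i\<in>{..<m}. \<exists>k\<in>{..n}. ys ! k = y i \<and> (\<Sum>l<k. u l) \<le> t i \<and> t i \<le> (\<Sum>l\<le>k. u l))"

text \<open>Here \<open>n\<close> is the number of jumps up to \<open>T\<close>; splitting by it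
  makes the observations depend on finitely many holding times. They stay in \<open>ennreal\<close>
  since the last state may be absorbing.\<close>

definition jump_event :: "nat \<Rightarrow> 's list \<Rightarrow> real \<Rightarrow> nat \<Rightarrow> (nat \<Rightarrow> real) \<Rightarrow> (nat \<Rightarrow> 's) \<Rightarrow> (nat \<Rightarrow> ennreal) \<Rightarrow> bool" where
  "jump_event n ys T m t y s \<longleftrightarrow> (\<Sum>l<n. s l) \<le> ennreal T \<and> ennreal T < (\<Sum>l\<le>n. s l) \<and>
     (\<forall>i\<in>{..<m}. \<exists>k\<in>{..n}. ys ! k = y i \<and> (\<Sum>l<k. s l) \<le> ennreal (t i) \<and> ennreal (t i) < (\<Sum>l\<le>k. s l))"

text \<open>No exit rates appear as factors: those of the first \<open>n\<close> states are joined
  with the jump probabilities, and the last state contributes only the tail of its holding time.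
  Thus all \<open>n + 1\<close> times are treated alike.\<close>

definition path_density :: "nat \<Rightarrow> 's list \<Rightarrow> nat \<Rightarrow> (nat \<Rightarrow> real) \<Rightarrow> (nat \<Rightarrow> 's) \<Rightarrow> (nat \<Rightarrow> real) \<Rightarrow> (nat \<Rightarrow> real) \<Rightarrow> ennreal" where
  "path_density n ys m t y q u =
     (\<Prod>i\<le>n. ennreal (exp (- q i * u i))) * of_bool ((\<forall>i\<in>{..n}. 0 \<le> u i) \<and> sojourn_event n ys m t y u)"

lemma measurable_partial_sums:
  fixes M :: "nat \<Rightarrow> 'b :: {second_countable_topology, topological_comm_monoid_add} measure"
  assumes "k \<le> n" "\<And>i. i \<le> n \<Longrightarrow> sets (M i) = sets borel"
  shows "(\<lambda>s. \<Sum>l<k. s l) \<in> borel_measurable (PiM {..n} M)"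
    and "(\<lambda>s. \<Sum>l\<le>k. s l) \<in> borel_measurable (PiM {..n} M)"
proof -
  have "(\<lambda>s. s l) \<in> borel_measurable (PiM {..n} M)" if "l \<le> n" for l
    using measurable_component_singleton[of l "{..n}" M] that assms(2)[OF that]
    by (simp cong: measurable_cong_sets)
  then show "(\<lambda>s. \<Sum>l<k. s l) \<in> borel_measurable (PiM {..n} M)"
    "(\<lambda>s. \<Sum>l\<le>k. s l) \<in> borel_measurable (PiM {..n} M)"
    using assms(1) by (auto intro!: borel_measurable_sum)
qed

lemma measurable_jump_event[measurable]:
  "Measurable.pred (PiM {..n} (\<lambda>_. borel)) (jump_event n ys T m t y)"
proof -
  have aux: "Measurable.pred M (\<lambda>s. c \<and> f s \<le> b \<and> b < g s)"
    if [measurable]: "f \<in> borel_measurable M" "g \<in> borel_measurable M" for M c and b :: ennreal and f g :: "(nat \<Rightarrow> ennreal) \<Rightarrow> ennreal"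
    by measurable
  have *: "Measurable.pred (PiM {..n} (\<lambda>_. borel)) (\<lambda>s. ys ! k = y i \<and> (\<Sum>l<k. s l) \<le> ennreal (t i) \<and> ennreal (t i) < (\<Sum>l\<le>k. s l))"
    if "k \<in> {..n}" for k i
    using that by (intro aux measurable_partial_sums) auto
  show ?thesis
    unfolding jump_event_def
    by (intro pred_intros_logic pred_intros_finite finite_atMost finite_lessThan *) measurable
qed

lemma measurable_path_density[measurable]:
  "path_density n ys m t y q \<in> borel_measurable (PiM {..n} (\<lambda>_. borel))"
proof -
  have aux: "Measurable.pred M (\<lambda>s. c \<and> f s \<le> b \<and> b \<le> g s)"
    if [measurable]: "f \<in> borel_measurable M" "g \<in> borel_measurable M" for M c and b :: real and f g :: "(nat \<Rightarrow> real) \<Rightarrow> real"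
    by measurable
  have *: "Measurable.pred (PiM {..n} (\<lambda>_. borel)) (\<lambda>s. ys ! k = y i \<and> (\<Sum>l<k. s l) \<le> t i \<and> t i \<le> (\<Sum>l\<le>k. s l))"
    if "k \<in> {..n}" for k i
    using that by (intro aux measurable_partial_sums) auto
  have "Measurable.pred (PiM {..n} (\<lambda>_. borel)) (sojourn_event n ys m t y)"
    unfolding sojourn_event_def
    by (intro pred_intros_logic pred_intros_finite finite_atMost finite_lessThan *)
  then have [measurable]: "Measurable.pred (PiM {..n} (\<lambda>_. borel)) (\<lambda>u. (\<forall>i\<in>{..n}. 0 \<le> u i) \<and> sojourn_event n ys m t y u)"
    by measurable
  have "(\<lambda>u. \<Prod>i\<le>n. ennreal (exp (- q i * u i))) \<in> borel_measurable (PiM {..n} (\<lambda>_. borel))"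
    by (rule borel_measurable_prod_ennreal) measurable
  then show ?thesis
    unfolding path_density_def[abs_def] of_bool_def by measurable
qed

text \<open>Once the first \<open>n\<close> times are fixed, the event restricts the last one only
  by the requirement that it exceed what is left of \<open>T\<close>, which has an exponential tail
  probability. Cutting the last sojourn off at \<open>T\<close> does not affect the observations, as
  they are all made by then.\<close>

lemma nn_integral_jump_event_last:
  fixes s :: "nat \<Rightarrow> real"
  assumes t: "\<And>i. i < m \<Longrightarrow> 0 \<le> t i \<and> t i \<le> T" and T: "0 \<le> T" and q: "0 \<le> q n"
    and ne: "\<And>k i. k < n \<Longrightarrow> i < m \<Longrightarrow> (\<Sum>l\<le>k. s l) \<noteq> t i"
    and s: "\<And>i. i < n \<Longrightarrow> 0 \<le> s i"
  shows "(\<integral>\<^sup>+z. of_bool (jump_event n ys T m t y ((\<lambda>i\<in>{..<n}. ennreal (s i))(n := z))) \<partial>holding_law (q n)) =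
    ennreal (exp (- q n * (T - (\<Sum>l<n. s l)))) *
      of_bool (0 \<le> T - (\<Sum>l<n. s l) \<and> sojourn_event n ys m t y (simplex_point n T s))"
proof -
  let ?s = "\<lambda>z. (\<lambda>i\<in>{..<n}. ennreal (s i))(n := z)"
  have s0: "0 \<le> (\<Sum>l\<in>A. s l)" if "A \<subseteq> {..<n}" for A
    using that s by (intro sum_nonneg) auto
  have S1: "(\<Sum>l<k. ?s z l) = ennreal (\<Sum>l<k. s l)" if "k \<le> n" for k z
  proof -
    have "(\<Sum>l<k. ?s z l) = (\<Sum>l<k. ennreal (s l))"
      using that by (intro sum.cong) auto
    then show ?thesis using that s by (subst (asm) sum_ennreal) auto
  qed
  have S2: "(\<Sum>l\<le>k. ?s z l) = ennreal (\<Sum>l\<le>k. s l)" if "k < n" for k z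
    using S1[of "Suc k" z] that by (simp add: lessThan_Suc_atMost)
  have S3: "(\<Sum>l\<le>n. ?s z l) = ennreal (\<Sum>l<n. s l) + z" for z
    using S1[of n z] by (simp add: lessThan_Suc_atMost[symmetric])
  have R1: "(\<Sum>l<k. simplex_point n T s l) = (\<Sum>l<k. s l)" if "k \<le> n" for k
    using that by (intro sum.cong) (auto simp: simplex_point_def)
  have R2: "(\<Sum>l\<le>k. simplex_point n T s l) = (\<Sum>l\<le>k. s l)" if "k < n" for k
    using that by (intro sum.cong) (auto simp: simplex_point_def)
  have R3: "(\<Sum>l\<le>n. simplex_point n T s l) = T"
    using R1[of n] by (simp add: lessThan_Suc_atMost[symmetric]) (simp add: simplex_point_def)
  have iff: "jump_event n ys T m t y (?s z) \<longleftrightarrow>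
    ennreal (T - (\<Sum>l<n. s l)) < z \<and> 0 \<le> T - (\<Sum>l<n. s l) \<and> sojourn_event n ys m t y (simplex_point n T s)" for z
  proof (cases "(\<Sum>l<n. s l) \<le> T")
    case le: True
    show ?thesis
    proof (cases "ennreal T < ennreal (\<Sum>l<n. s l) + z")
      case True
      have "(\<exists>k\<in>{..n}. ys ! k = y i \<and> (\<Sum>l<k. ?s z l) \<le> ennreal (t i) \<and> ennreal (t i) < (\<Sum>l\<le>k. ?s z l)) \<longleftrightarrow>
        (\<exists>k\<in>{..n}. ys ! k = y i \<and> (\<Sum>l<k. simplex_point n T s l) \<le> t i \<and> t i \<le> (\<Sum>l\<le>k. simplex_point n T s l))"
        if i: "i < m" for i
      proof (intro bex_cong refl conj_cong)
        fix k assume "k \<in> {..n}"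
        then have k: "k \<le> n" by simp
        show "(\<Sum>l<k. ?s z l) \<le> ennreal (t i) \<longleftrightarrow> (\<Sum>l<k. simplex_point n T s l) \<le> t i"
          unfolding S1[OF k] R1[OF k] using t[OF i] by simp
        \<comment> \<open>For \<open>k = n\<close> both inequalities hold because
          \<open>t i \<le> T\<close>; for \<open>k < n\<close> they differ only if a jump happens at
          \<open>t i\<close>, which \<open>ne\<close> excludes.\<close>
        show "ennreal (t i) < (\<Sum>l\<le>k. ?s z l) \<longleftrightarrow> t i \<le> (\<Sum>l\<le>k. simplex_point n T s l)"
        proof (cases "k = n")
          case n: True
          have "ennreal (t i) \<le> ennreal T" using t[OF i] by (intro ennreal_leI) simp
          then have "ennreal (t i) < ennreal (\<Sum>l<n. s l) + z" using True by (rule le_less_trans)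
          then show ?thesis unfolding n S3 R3 using t[OF i] by simp
        next
          case False
          then have kn: "k < n" using k by simp
          show ?thesis unfolding S2[OF kn] R2[OF kn]
            using t[OF i] ne[OF kn i] by (auto simp: ennreal_less_iff)
        qed
      qed
      moreover have "ennreal (T - (\<Sum>l<n. s l)) < z"
        using True le s0[of "{..<n}"]
        by (cases z) (auto simp: ennreal_less_iff ennreal_plus[symmetric] T simp del: ennreal_plus)
      ultimately show ?thesis
        unfolding jump_event_def sojourn_event_def S3 S1[OF order_refl]
        using True le by (simp add: ennreal_leI)
    next
      case False
      moreover have "\<not> ennreal (T - (\<Sum>l<n. s l)) < z"
        using False le s0[of "{..<n}"]
        by (cases z) (auto simp: ennreal_less_iff ennreal_plus[symmetric] T simp del: ennreal_plus)
      ultimately show ?thesis unfolding jump_event_def S3 by simp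
    qed
  next
    case False
    then have "\<not> ennreal (\<Sum>l<n. s l) \<le> ennreal T"
      using T by simp
    then have "\<not> jump_event n ys T m t y (?s z)"
      unfolding jump_event_def S1[OF order_refl] by simp
    then show ?thesis using False by simp
  qed
  define B where "B \<longleftrightarrow> 0 \<le> T - (\<Sum>l<n. s l) \<and> sojourn_event n ys m t y (simplex_point n T s)"
  have "(\<integral>\<^sup>+z. of_bool (jump_event n ys T m t y (?s z)) \<partial>holding_law (q n)) =
    (\<integral>\<^sup>+z. of_bool B * indicator {ennreal (T - (\<Sum>l<n. s l))<..} z \<partial>holding_law (q n))"
    unfolding iff B_def[symmetric] by (intro nn_integral_cong) (auto simp: indicator_def)
  also have "\<dots> = of_bool B * emeasure (holding_law (q n)) {ennreal (T - (\<Sum>l<n. s l))<..}"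
    by (subst nn_integral_cmult) auto
  also have "\<dots> = of_bool B * ennreal (exp (- q n * (T - (\<Sum>l<n. s l))))"
    using emeasure_holding_law_greaterThan[OF q, of "T - (\<Sum>l<n. s l)"]
    by (cases B) (auto simp: B_def)
  finally show ?thesis by (simp add: B_def mult.commute)
qed

lemma nn_integral_jump_event:
  assumes t: "\<And>i. i < m \<Longrightarrow> 0 \<le> t i \<and> t i \<le> T" and T: "0 \<le> T" and q: "\<And>i. 0 \<le> q i"
  shows "(\<integral>\<^sup>+s. of_bool (jump_event n ys T m t y s) \<partial>PiM {..n} (\<lambda>i. holding_law (q i))) =
    ennreal (\<Prod>i<n. q i) * (\<integral>\<^sup>+s. path_density n ys m t y q (simplex_point n T s) \<partial>PiM {..<n} (\<lambda>_. lborel))"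
proof -
  note hp = prob_space_holding_law[OF q]
  have setsH: "sets (PiM J (\<lambda>i. holding_law (q i))) = sets (PiM J (\<lambda>_. borel))" for J
    by (intro sets_PiM_cong) auto
  interpret H: product_prob_space "\<lambda>i. holding_law (q i)"
    by (intro product_prob_spaceI hp)
  show ?thesis
  proof (cases "\<exists>i<n. q i = 0")
    case True
    \<comment> \<open>Leaving state \<open>i\<close> would take infinitely long, so \<open>n\<close>
      jumps before \<open>T\<close> have probability 0, matching the vanishing product of the
      rates.\<close>
    then obtain i where i: "i < n" "q i = 0" by auto
    have "AE z in holding_law (q i). z = \<infinity>"
      unfolding holding_law_def i(2) if_P[OF refl] by (subst AE_return) auto
    then have "AE s in PiM {..n} (\<lambda>i. holding_law (q i)). s i = \<infinity>"
      using i by (intro AE_PiM_component hp) auto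
    then have "AE s in PiM {..n} (\<lambda>i. holding_law (q i)). of_bool (jump_event n ys T m t y s) = (0 :: ennreal)"
    proof eventually_elim
      case (elim s)
      then have "(\<Sum>l<n. s l) = \<infinity>"
        using i by auto
      then have "\<not> (\<Sum>l<n. s l) \<le> ennreal T"
        by (simp only: infinity_ennreal_def top_unique) simp
      then have "\<not> jump_event n ys T m t y s"
        unfolding jump_event_def by blast
      then show ?case by simp
    qed
    then have "(\<integral>\<^sup>+s. of_bool (jump_event n ys T m t y s) \<partial>PiM {..n} (\<lambda>i. holding_law (q i))) =
      (\<integral>\<^sup>+s. 0 \<partial>PiM {..n} (\<lambda>i. holding_law (q i)))"
      by (rule nn_integral_cong_AE)
    moreover have "(\<Prod>i<n. q i) = 0" using i by auto
    ultimately show ?thesis by (simp only: ennreal_0 mult_zero_left nn_integral_const)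
  next
    case False
    then have q0: "q i \<noteq> 0" if "i < n" for i using that by auto
    \<comment> \<open>The last time is integrated against its own law, since \<open>q n = 0\<close>
      is allowed; only the first \<open>n\<close> times are passed to Lebesgue measure.\<close>
    define g where "g s = (\<integral>\<^sup>+z. of_bool (jump_event n ys T m t y (s(n := z))) \<partial>holding_law (q n) :: ennreal)" for s
    have ins: "{..n} = insert n {..<n}" by auto
    interpret h: prob_space "holding_law (q n)" by (rule hp)
    have ev[measurable]: "Measurable.pred (PiM (insert n {..<n}) (\<lambda>_. borel)) (jump_event n ys T m t y)"
      unfolding ins[symmetric] by (rule measurable_jump_event)
    have g: "g \<in> borel_measurable (PiM {..<n} (\<lambda>_. borel))"
    proof -
      have "(\<lambda>(s, z). s(n := z)) \<in> measurable (PiM {..<n} (\<lambda>_. borel) \<Otimes>\<^sub>M holding_law (q n)) (PiM (insert n {..<n}) (\<lambda>_. borel :: ennreal measure))"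
        by (simp add: split_beta') measurable
      then have [measurable]: "Measurable.pred (PiM {..<n} (\<lambda>_. borel) \<Otimes>\<^sub>M holding_law (q n)) (\<lambda>(s, z). jump_event n ys T m t y (s(n := z)))"
        using measurable_compose[OF _ ev] by (simp add: split_beta')
      show ?thesis unfolding g_def of_bool_def by measurable
    qed
    have "(\<integral>\<^sup>+s. of_bool (jump_event n ys T m t y s) \<partial>PiM {..n} (\<lambda>i. holding_law (q i))) = (\<integral>\<^sup>+s. g s \<partial>PiM {..<n} (\<lambda>i. holding_law (q i)))"
      unfolding ins g_def of_bool_def
      by (rule H.product_nn_integral_insert) (use ev in \<open>auto simp: measurable_cong_sets[OF setsH refl]\<close>)
    also have "\<dots> = (\<integral>\<^sup>+s. (\<Prod>i<n. ennreal (exponential_density (q i) (s i))) * g (\<lambda>i\<in>{..<n}. ennreal (s i)) \<partial>PiM {..<n} (\<lambda>_. lborel))"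
      using q q0 g by (intro nn_integral_PiM_holding_law) auto
    also have "\<dots> = (\<integral>\<^sup>+s. ennreal (\<Prod>i<n. q i) * path_density n ys m t y q (simplex_point n T s) \<partial>PiM {..<n} (\<lambda>_. lborel))"
    proof (rule nn_integral_cong_AE)
      \<comment> \<open>Jumps at observation times are discarded here, which permits the closed
        sojourn intervals.\<close>
      have "AE s in PiM {..<n} (\<lambda>_. lborel). \<forall>k\<in>{..<n}. \<forall>i\<in>{..<m}. (\<Sum>l\<le>k. s l) \<noteq> t i"
        by (intro AE_finite_allI AE_partial_sum_neq) auto
      then show "AE s in PiM {..<n} (\<lambda>_. lborel). (\<Prod>i<n. ennreal (exponential_density (q i) (s i))) * g (\<lambda>i\<in>{..<n}. ennreal (s i)) =
        ennreal (\<Prod>i<n. q i) * path_density n ys m t y q (simplex_point n T s)"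
      proof eventually_elim
        case (elim s)
        show ?case
        proof (cases "\<forall>i<n. 0 \<le> s i")
          case True
          then have s: "\<And>i. i < n \<Longrightarrow> 0 \<le> s i" by auto
          have gs: "g (\<lambda>i\<in>{..<n}. ennreal (s i)) = ennreal (exp (- q n * (T - (\<Sum>l<n. s l)))) *
            of_bool (0 \<le> T - (\<Sum>l<n. s l) \<and> sojourn_event n ys m t y (simplex_point n T s))"
            unfolding g_def by (rule nn_integral_jump_event_last[where s=s]) (use t T q elim s in auto)
          have d: "(\<Prod>i<n. ennreal (exponential_density (q i) (s i))) = ennreal (\<Prod>i<n. q i) * (\<Prod>i<n. ennreal (exp (- q i * s i)))"
          proof -
            have "(\<Prod>i<n. ennreal (exponential_density (q i) (s i))) = (\<Prod>i<n. ennreal (q i) * ennreal (exp (- q i * s i)))"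
              using s q by (intro prod.cong) (auto simp: exponential_density_def ennreal_mult'[symmetric] mult.commute not_less[symmetric])
            then show ?thesis using q by (simp add: prod.distrib prod_ennreal)
          qed
          have p: "(\<Prod>i\<le>n. ennreal (exp (- q i * simplex_point n T s i))) =
            (\<Prod>i<n. ennreal (exp (- q i * s i))) * ennreal (exp (- q n * (T - (\<Sum>l<n. s l))))"
          proof -
            have "(\<Prod>i<n. ennreal (exp (- q i * simplex_point n T s i))) = (\<Prod>i<n. ennreal (exp (- q i * s i)))"
              by (intro prod.cong) (auto simp: simplex_point_def)
            then show ?thesis by (simp add: lessThan_Suc_atMost[symmetric]) (simp add: simplex_point_def)
          qed
          have nn: "(\<forall>i\<in>{..n}. 0 \<le> simplex_point n T s i) \<longleftrightarrow> 0 \<le> T - (\<Sum>l<n. s l)"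
            using s by (auto simp: simplex_point_def le_less)
          show ?thesis
            unfolding gs d path_density_def p nn by (simp add: mult.assoc)
        next
          case False
          then obtain i where i: "i < n" "s i < 0" by (auto simp: not_le)
          then have "(\<Prod>i<n. ennreal (exponential_density (q i) (s i))) = 0"
            by (auto simp: exponential_density_def intro!: prod_zero bexI[of _ i])
          moreover have "\<not> (\<forall>i\<in>{..n}. 0 \<le> simplex_point n T s i)"
            using i by (auto simp: simplex_point_def intro!: bexI[of _ i])
          ultimately show ?thesis
            unfolding path_density_def by (simp only: mult_zero_left mult_zero_right of_bool_eq simp_thms)
        qed
      qed
    qed
    also have "\<dots> = ennreal (\<Prod>i<n. q i) * (\<integral>\<^sup>+s. path_density n ys m t y q (simplex_point n T s) \<partial>PiM {..<n} (\<lambda>_. lborel))"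
      by (rule nn_integral_cmult) measurable
    finally show ?thesis .
  qed
qed

lemma sum_simplex_point: "(\<Sum>l\<le>n. simplex_point n T s l) = T"
proof -
  have "(\<Sum>l<n. simplex_point n T s l) = (\<Sum>l<n. s l)"
    by (intro sum.cong) (auto simp: simplex_point_def)
  then show ?thesis
    by (simp add: lessThan_Suc_atMost[symmetric]) (simp add: simplex_point_def)
qed

text \<open>Under reversal the beginning of the sojourn at position \<open>k\<close> becomes
  \<open>T\<close> minus the end of the one at position \<open>n - k\<close>, and vice versa; this
  uses that the total length is exactly \<open>T\<close>.\<close>

lemma path_density_rev:
  assumes len: "length ys = Suc n" and sum: "(\<Sum>l\<le>n. u l) = T"
  shows "path_density n ys m t y q (\<lambda>k\<in>{..n}. u (n - k)) =
    path_density n (rev ys) m (\<lambda>i. T - t i) y (\<lambda>i. q (n - i)) u"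
proof -
  let ?w = "\<lambda>k\<in>{..n}. u (n - k)"
  \<comment> \<open>The first \<open>k\<close> reversed times are the last \<open>k\<close> original
    ones, with indices \<open>n - k + 1\<close> to \<open>n\<close>; hence a sum over
    \<open>l < k\<close> complements one over \<open>l \<le> n - k\<close>.\<close>
  have flip: "(\<Sum>l<k. ?w l) = T - (\<Sum>l\<le>n - k. u l)" if "k \<le> n" for k
  proof -
    have "(\<Sum>l<k. ?w l) = (\<Sum>l\<in>{n - k<..n}. u l)"
      using that by (intro sum.reindex_bij_witness[where i = "\<lambda>l. n - l" and j = "\<lambda>l. n - l"]) auto
    moreover have "(\<Sum>l\<le>n. u l) = (\<Sum>l\<le>n - k. u l) + (\<Sum>l\<in>{n - k<..n}. u l)"
      by (subst sum.union_disjoint[symmetric]) (auto intro!: sum.cong)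
    ultimately show ?thesis using sum by simp
  qed
  have flip': "(\<Sum>l\<le>k. ?w l) = T - (\<Sum>l<n - k. u l)" if "k \<le> n" for k
  proof -
    have "(\<Sum>l\<le>k. ?w l) = (\<Sum>l\<in>{n - k..n}. u l)"
      using that by (intro sum.reindex_bij_witness[where i = "\<lambda>l. n - l" and j = "\<lambda>l. n - l"]) auto
    moreover have "(\<Sum>l\<le>n. u l) = (\<Sum>l<n - k. u l) + (\<Sum>l\<in>{n - k..n}. u l)"
      by (subst sum.union_disjoint[symmetric]) (auto intro!: sum.cong)
    ultimately show ?thesis using sum by simp
  qed
  have "(\<exists>k\<in>{..n}. ys ! k = y i \<and> (\<Sum>l<k. ?w l) \<le> t i \<and> t i \<le> (\<Sum>l\<le>k. ?w l)) \<longleftrightarrow>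
    (\<exists>k\<in>{..n}. rev ys ! k = y i \<and> (\<Sum>l<k. u l) \<le> T - t i \<and> T - t i \<le> (\<Sum>l\<le>k. u l))" (is "?L \<longleftrightarrow> ?R") for i
  proof
    assume ?L
    then obtain k where k: "k \<le> n" "ys ! k = y i" "(\<Sum>l<k. ?w l) \<le> t i" "t i \<le> (\<Sum>l\<le>k. ?w l)" by auto
    then show ?R unfolding flip[OF k(1)] flip'[OF k(1)]
      using len by (intro bexI[of _ "n - k"]) (auto simp: rev_nth)
  next
    assume ?R
    then obtain k where k: "k \<le> n" "rev ys ! k = y i" "(\<Sum>l<k. u l) \<le> T - t i" "T - t i \<le> (\<Sum>l\<le>k. u l)" by auto
    then show ?L
      using len flip[of "n - k"] flip'[of "n - k"] by (intro bexI[of _ "n - k"]) (auto simp: rev_nth)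
  qed
  then have "sojourn_event n ys m t y ?w \<longleftrightarrow> sojourn_event n (rev ys) m (\<lambda>i. T - t i) y u"
    by (simp add: sojourn_event_def)
  moreover have "(\<Prod>i\<le>n. ennreal (exp (- q i * ?w i))) = (\<Prod>i\<le>n. ennreal (exp (- q (n - i) * u i)))"
    by (rule prod.reindex_bij_witness[where i = "\<lambda>k. n - k" and j = "\<lambda>k. n - k"]) auto
  moreover have "(\<forall>i\<in>{..n}. 0 \<le> ?w i) \<longleftrightarrow> (\<forall>i\<in>{..n}. 0 \<le> u i)"
  proof safe
    fix i assume "\<forall>i\<in>{..n}. 0 \<le> ?w i" "i \<le> n"
    then show "0 \<le> u i" by (auto dest!: bspec[of _ _ "n - i"])
  qed auto
  ultimately show ?thesis
            unfolding path_density_def by (simp only: mult_zero_left mult_zero_right of_bool_eq simp_thms)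
qed

lemma nn_integral_path_density_rev:
  assumes "length ys = Suc n"
  shows "(\<integral>\<^sup>+s. path_density n ys m t y q (simplex_point n T s) \<partial>PiM {..<n} (\<lambda>_. lborel)) =
    (\<integral>\<^sup>+s. path_density n (rev ys) m (\<lambda>i. T - t i) y (\<lambda>i. q (n - i)) (simplex_point n T s) \<partial>PiM {..<n} (\<lambda>_. lborel))"
  by (subst nn_integral_simplex_rev[OF measurable_path_density])
     (simp only: path_density_rev[OF assms sum_simplex_point])

section \<open>Reversibility\<close>

lemma jump_path_eq:
  assumes "(\<Sum>l<k. s l) \<le> ennreal t" "ennreal t < (\<Sum>l\<le>k. s l)"
  shows "jump_path y s t = y k"
proof -
  have "(LEAST n. ennreal t < (\<Sum>i\<le>n. s i)) = k"
  proof (rule Least_equality)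
    fix n assume n: "ennreal t < (\<Sum>i\<le>n. s i)"
    show "k \<le> n"
    proof (rule ccontr)
      assume "\<not> k \<le> n"
      then have "(\<Sum>i\<le>n. s i) \<le> (\<Sum>l<k. s l)" by (intro sum_mono2) auto
      with n assms(1) show False by (meson leD le_less_trans less_le_trans)
    qed
  qed fact
  then show ?thesis by (simp add: jump_path_def)
qed

text \<open>Divergence makes the partial sums pass every finite \<open>t\<close>; the empty sum is
  0, so the first one to do so has a predecessor.\<close>

lemma ex_jump_index:
  fixes s :: "nat \<Rightarrow> ennreal"
  assumes "(\<Sum>n. s n) = \<infinity>"
  shows "\<exists>k. (\<Sum>l<k. s l) \<le> ennreal t \<and> ennreal t < (\<Sum>l\<le>k. s l)"
proof -
  have "ennreal t < (SUP n. \<Sum>l<n. s l)"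
    using assms by (simp only: suminf_eq_SUP infinity_ennreal_def ennreal_less_top)
  then obtain n where n: "ennreal t < (\<Sum>l<n. s l)"
    by (subst (asm) less_SUP_iff) blast
  define k where "k = (LEAST k. ennreal t < (\<Sum>l<k. s l))"
  have k: "ennreal t < (\<Sum>l<k. s l)"
    unfolding k_def using n by (rule LeastI)
  then obtain j where j: "k = Suc j" by (cases k) auto
  have "\<not> ennreal t < (\<Sum>l<j. s l)"
    using not_less_Least[of j "\<lambda>k. ennreal t < (\<Sum>l<k. s l)"] j by (simp add: k_def)
  then show ?thesis using k j by (intro exI[of _ j]) (auto simp: lessThan_Suc_atMost not_less)
qed

lemma jump_index_unique:
  fixes s :: "nat \<Rightarrow> ennreal"
  assumes "(\<Sum>l<k. s l) \<le> a" "a < (\<Sum>l\<le>k. s l)" "(\<Sum>l<n. s l) \<le> a" "a < (\<Sum>l\<le>n. s l)"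
  shows "k = n"
proof -
  have "k \<le> n" if "(\<Sum>l<k. s l) \<le> a" "a < (\<Sum>l\<le>n. s l)" for k n
  proof (rule ccontr)
    assume "\<not> k \<le> n"
    then have "(\<Sum>l\<le>n. s l) \<le> (\<Sum>l<k. s l)" by (intro sum_mono2) auto
    with that show False by (meson leD le_less_trans less_le_trans)
  qed
  with assms show ?thesis by (meson antisym)
qed

lemma jump_event_cong:
  assumes "\<And>i. i \<le> n \<Longrightarrow> s i = s' i"
  shows "jump_event n ys T m t y s \<longleftrightarrow> jump_event n ys T m t y s'"
proof -
  have "(\<Sum>l<k. s l) = (\<Sum>l<k. s' l)" "(\<Sum>l\<le>k. s l) = (\<Sum>l\<le>k. s' l)" if "k \<le> n" for k
    using that assms by (auto intro!: sum.cong)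
  then show ?thesis by (simp add: jump_event_def)
qed

lemma path_density_cong:
  assumes "\<And>i. i \<le> n \<Longrightarrow> q i = q' i"
  shows "path_density n ys m t y q u = path_density n ys m t y q' u"
  using assms by (simp add: path_density_def)

locale nonexplosive_process = jump_holding_process Q P Y S
  for Q :: "'s::countable \<Rightarrow> 's \<Rightarrow> real" and P :: "'s \<Rightarrow> 'w measure" and Y S +
  fixes X :: "real \<Rightarrow> 'w \<Rightarrow> 's"
  assumes nonexplosive: "AE \<omega> in P x. (\<Sum>n. S n \<omega>) = \<infinity>"
    and X_eq: "\<omega> \<in> space (P x) \<Longrightarrow> 0 \<le> t \<Longrightarrow> X t \<omega> = jump_path (\<lambda>n. Y n \<omega>) (\<lambda>n. S n \<omega>) t"
begin

lemma measurable_X: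
  assumes "0 \<le> t"
  shows "X t \<in> measurable (P x) (count_space UNIV)"
proof -
  have "(\<lambda>\<omega>. LEAST n. ennreal t < (\<Sum>i\<le>n. S i \<omega>)) \<in> measurable (P x) (count_space UNIV)"
    by measurable
  then have "(\<lambda>\<omega>. jump_path (\<lambda>n. Y n \<omega>) (\<lambda>n. S n \<omega>) t) \<in> measurable (P x) (count_space UNIV)"
    unfolding jump_path_def by (rule measurable_compose_countable[rotated]) measurable
  then show ?thesis
    using assms by (subst measurable_cong[OF X_eq]) auto
qed

lemma X_eq_Y:
  assumes "\<omega> \<in> space (P x)" "0 \<le> t" "(\<Sum>l<k. S l \<omega>) \<le> ennreal t" "ennreal t < (\<Sum>l\<le>k. S l \<omega>)"
  shows "X t \<omega> = Y k \<omega>"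
  using assms by (simp add: X_eq jump_path_eq)

text \<open>By non-explosion almost every trajectory has a definite number \<open>n\<close> of jumps
  up to \<open>T\<close>. Splitting over \<open>n\<close> and over the path leaves an event in the
  holding times, evaluated by \<open>nn_integral_jump_event\<close>.\<close>

lemma emeasure_joint_X:
  assumes t: "\<And>i. i < m \<Longrightarrow> 0 \<le> t i \<and> t i \<le> T" and T: "0 \<le> T"
  shows "emeasure (P x) {\<omega>\<in>space (P x). \<forall>i<m. X (t i) \<omega> = y i} =
    (\<integral>\<^sup>+n. \<integral>\<^sup>+ys. ennreal (pmf (paths n x) ys * (\<Prod>i<n. exit_rate Q (ys ! i))) *
      (\<integral>\<^sup>+s. path_density n ys m t y (\<lambda>i. exit_rate Q (ys ! i)) (simplex_point n T s) \<partial>PiM {..<n} (\<lambda>_. lborel))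
      \<partial>count_space UNIV \<partial>count_space UNIV)"
proof -
  let ?S = "\<lambda>n \<omega>. \<lambda>i\<in>{..n}. S i \<omega>"
  \<comment> \<open>Restriction to \<open>{..n}\<close> yields a point of the product space on which
    \<open>jump_event\<close> is measurable; the event looks at no other holding times.\<close>
  define J where "J n ys \<omega> \<longleftrightarrow> jump_event n ys T m t y (?S n \<omega>)" for n ys \<omega>
  have J: "J n ys \<omega> \<longleftrightarrow> jump_event n ys T m t y (\<lambda>i. S i \<omega>)" for n ys \<omega>
    unfolding J_def by (rule jump_event_cong) simp
  have J_meas: "Measurable.pred (P x) (J n ys)" for n ys
    unfolding J_def[abs_def] by (rule measurable_compose[OF _ measurable_jump_event]) measurable
  have Jp_meas: "Measurable.pred (P x) (\<lambda>\<omega>. J n (path n \<omega>) \<omega>)" for n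
    by (rule measurable_compose_countable[OF J_meas measurable_path])
  have X_meas: "Measurable.pred (P x) (\<lambda>\<omega>. \<forall>i<m. X (t i) \<omega> = y i)"
  proof -
    have "Measurable.pred (P x) (\<lambda>\<omega>. \<forall>i\<in>{..<m}. X (t i) \<omega> = y i)"
    proof (rule pred_intros_finite)
      fix i assume "i \<in> {..<m}"
      then have [measurable]: "X (t i) \<in> measurable (P x) (count_space UNIV)"
        using t by (intro measurable_X) auto
      show "Measurable.pred (P x) (\<lambda>\<omega>. X (t i) \<omega> = y i)" by measurable
    qed simp
    then show ?thesis unfolding Ball_def lessThan_iff .
  qed
  have "emeasure (P x) {\<omega>\<in>space (P x). \<forall>i<m. X (t i) \<omega> = y i} =
    emeasure (P x) (\<Union>n. {\<omega>\<in>space (P x). J n (path n \<omega>) \<omega>})"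
  proof (rule emeasure_eq_AE)
    from nonexplosive[of x]
    show "AE \<omega> in P x. \<omega> \<in> {\<omega>\<in>space (P x). \<forall>i<m. X (t i) \<omega> = y i} \<longleftrightarrow> \<omega> \<in> (\<Union>n. {\<omega>\<in>space (P x). J n (path n \<omega>) \<omega>})"
      using AE_space
    proof eventually_elim
      case (elim \<omega>)
      note sp = elim(2)
      obtain n where n: "(\<Sum>l<n. S l \<omega>) \<le> ennreal T" "ennreal T < (\<Sum>l\<le>n. S l \<omega>)"
        using ex_jump_index[OF elim(1)] by blast
      have p: "path n \<omega> ! k = Y k \<omega>" if "k \<le> n" for k
        unfolding path_def using that by (simp del: upt_Suc)
      have "(\<exists>k\<in>{..n}. path n \<omega> ! k = y i \<and> (\<Sum>l<k. S l \<omega>) \<le> ennreal (t i) \<and> ennreal (t i) < (\<Sum>l\<le>k. S l \<omega>)) \<longleftrightarrow>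
        X (t i) \<omega> = y i" if i: "i < m" for i
      proof
        assume "\<exists>k\<in>{..n}. path n \<omega> ! k = y i \<and> (\<Sum>l<k. S l \<omega>) \<le> ennreal (t i) \<and> ennreal (t i) < (\<Sum>l\<le>k. S l \<omega>)"
        then show "X (t i) \<omega> = y i"
          using X_eq_Y[OF sp] t[OF i] p by auto
      next
        assume X: "X (t i) \<omega> = y i"
        obtain k where k: "(\<Sum>l<k. S l \<omega>) \<le> ennreal (t i)" "ennreal (t i) < (\<Sum>l\<le>k. S l \<omega>)"
          using ex_jump_index[OF elim(1)] by blast
        have "k \<le> n"
        proof (rule ccontr)
          assume "\<not> k \<le> n"
          then have "(\<Sum>l\<le>n. S l \<omega>) \<le> (\<Sum>l<k. S l \<omega>)" by (intro sum_mono2) auto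
          also have "\<dots> \<le> ennreal T" using k(1) t[OF i] by (auto intro: order_trans ennreal_leI)
          finally show False using n(2) by simp
        qed
        moreover have "Y k \<omega> = y i" using X X_eq_Y[OF sp _ k] t[OF i] by simp
        ultimately show "\<exists>k\<in>{..n}. path n \<omega> ! k = y i \<and> (\<Sum>l<k. S l \<omega>) \<le> ennreal (t i) \<and> ennreal (t i) < (\<Sum>l\<le>k. S l \<omega>)"
          using k p by auto
      qed
      then have "(\<forall>i\<in>{..<m}. \<exists>k\<in>{..n}. path n \<omega> ! k = y i \<and> (\<Sum>l<k. S l \<omega>) \<le> ennreal (t i) \<and> ennreal (t i) < (\<Sum>l\<le>k. S l \<omega>)) \<longleftrightarrow>
        (\<forall>i\<in>{..<m}. X (t i) \<omega> = y i)"
        by (intro ball_cong refl) (simp only: lessThan_iff)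
      also have "\<dots> \<longleftrightarrow> (\<forall>i<m. X (t i) \<omega> = y i)"
        by (simp only: Ball_def lessThan_iff)
      finally have "(\<forall>i<m. X (t i) \<omega> = y i) \<longleftrightarrow> J n (path n \<omega>) \<omega>"
        by (simp only: J jump_event_def n simp_thms)
      moreover have "k = n" if "J k (path k \<omega>) \<omega>" for k
        using that n unfolding J jump_event_def by (intro jump_index_unique) auto
      ultimately show ?case using sp by blast
    qed
    show "{\<omega>\<in>space (P x). \<forall>i<m. X (t i) \<omega> = y i} \<in> sets (P x)"
      by (rule predE[OF X_meas])
    show "(\<Union>n. {\<omega>\<in>space (P x). J n (path n \<omega>) \<omega>}) \<in> sets (P x)"
      by (intro sets.countable_UN image_subsetI predE[OF Jp_meas])
  qed
  also have "\<dots> = (\<integral>\<^sup>+n. emeasure (P x) {\<omega>\<in>space (P x). J n (path n \<omega>) \<omega>} \<partial>count_space UNIV)"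
  proof (rule emeasure_UN_countable)
    show "disjoint_family_on (\<lambda>n. {\<omega>\<in>space (P x). J n (path n \<omega>) \<omega>}) UNIV"
      unfolding disjoint_family_on_def J jump_event_def by (auto dest: jump_index_unique)
  qed (rule predE[OF Jp_meas], simp)
  also have "\<dots> = (\<integral>\<^sup>+n. \<integral>\<^sup>+ys. ennreal (pmf (paths n x) ys * (\<Prod>i<n. exit_rate Q (ys ! i))) *
      (\<integral>\<^sup>+s. path_density n ys m t y (\<lambda>i. exit_rate Q (ys ! i)) (simplex_point n T s) \<partial>PiM {..<n} (\<lambda>_. lborel))
      \<partial>count_space UNIV \<partial>count_space UNIV)"
  proof (rule nn_integral_cong)
    fix n
    have "emeasure (P x) {\<omega>\<in>space (P x). J n (path n \<omega>) \<omega>} =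
      (\<integral>\<^sup>+ys. emeasure (P x) {\<omega>\<in>space (P x). path n \<omega> = ys \<and> J n (path n \<omega>) \<omega>} \<partial>count_space UNIV)"
      by (rule emeasure_split_countable[OF measurable_path Jp_meas])
    also have "\<dots> = (\<integral>\<^sup>+ys. ennreal (pmf (paths n x) ys * (\<Prod>i<n. exit_rate Q (ys ! i))) *
      (\<integral>\<^sup>+s. path_density n ys m t y (\<lambda>i. exit_rate Q (ys ! i)) (simplex_point n T s) \<partial>PiM {..<n} (\<lambda>_. lborel))
      \<partial>count_space UNIV)"
    proof (rule nn_integral_cong)
      fix ys
      have "{\<omega>\<in>space (P x). path n \<omega> = ys \<and> J n (path n \<omega>) \<omega>} = {\<omega>\<in>space (P x). path n \<omega> = ys \<and> J n ys \<omega>}"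
        by auto
      then have "emeasure (P x) {\<omega>\<in>space (P x). path n \<omega> = ys \<and> J n (path n \<omega>) \<omega>} =
        (\<integral>\<^sup>+\<omega>. indicator {\<omega>\<in>space (P x). path n \<omega> = ys \<and> J n ys \<omega>} \<omega> \<partial>P x)"
        by (simp only:) (subst nn_integral_indicator, intro predE pred_intros_logic J_meas, measurable)
      also have "\<dots> = (\<integral>\<^sup>+\<omega>. of_bool (jump_event n ys T m t y (?S n \<omega>)) * indicator {\<omega>. path n \<omega> = ys} \<omega> \<partial>P x)"
        by (intro nn_integral_cong) (auto simp: J_def indicator_def)
      also have "\<dots> = ennreal (pmf (paths n x) ys) *
        (\<integral>\<^sup>+s. of_bool (jump_event n ys T m t y s) \<partial>PiM {..n} (\<lambda>i. holding_law (exit_rate Q (ys ! i))))"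
        by (rule holding_times_law) (unfold of_bool_def, measurable)
      also have "\<dots> = ennreal (pmf (paths n x) ys) * (ennreal (\<Prod>i<n. exit_rate Q (ys ! i)) *
        (\<integral>\<^sup>+s. path_density n ys m t y (\<lambda>i. exit_rate Q (ys ! i)) (simplex_point n T s) \<partial>PiM {..<n} (\<lambda>_. lborel)))"
        by (subst nn_integral_jump_event) (use t T exit_rate_nonneg in auto)
      finally show "emeasure (P x) {\<omega>\<in>space (P x). path n \<omega> = ys \<and> J n (path n \<omega>) \<omega>} =
        ennreal (pmf (paths n x) ys * (\<Prod>i<n. exit_rate Q (ys ! i))) *
        (\<integral>\<^sup>+s. path_density n ys m t y (\<lambda>i. exit_rate Q (ys ! i)) (simplex_point n T s) \<partial>PiM {..<n} (\<lambda>_. lborel))"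
        by (simp add: ennreal_mult' mult.assoc)
    qed
    finally show "emeasure (P x) {\<omega>\<in>space (P x). J n (path n \<omega>) \<omega>} = \<dots>" .
  qed
  finally show ?thesis .
qed

end

section \<open>Stationary path measure under detailed balance\<close>

locale reversible_process = nonexplosive_process Q P Y S X
  for Q :: "'s::countable \<Rightarrow> 's \<Rightarrow> real" and P :: "'s \<Rightarrow> 'w measure" and Y S X +
  fixes w :: "'s \<Rightarrow> real"
  assumes w_nonneg: "0 \<le> w x"
    and w_has_sum: "(w has_sum 1) UNIV"
    and detailed_balance: "w x * Q x y = w y * Q y x"
begin

lemma off_diag_balance: "w x * off_diag x y = w y * off_diag y x"
  using detailed_balance[of x y] by (auto simp: off_diag_def)

lemma nn_integral_w: "(\<integral>\<^sup>+x. ennreal (w x) \<partial>count_space UNIV) = 1"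
  using w_has_sum w_nonneg by (subst nn_integral_count_space_eq_infsum) (auto simp: has_sum_imp_summable infsumI)

text \<open>Each of the \<open>n\<close> exit rates turns a jump probability into an intensity. This
  is also right at absorbing states, where the rate 0 removes the formal self-loop of the jump
  chain.\<close>

lemma path_weight_off_diag:
  assumes "length ys = Suc n"
  shows "pmf (paths n x) ys * (\<Prod>i<n. exit_rate Q (ys ! i)) = of_bool (hd ys = x) * path_weight off_diag ys"
proof -
  have "path_weight (jump_prob Q) ys * (\<Prod>i<n. exit_rate Q (ys ! i)) = path_weight off_diag ys"
    using assms by (subst (1 2) path_weight_conv_prod)
      (auto simp: prod.distrib[symmetric] jump_prob_mult_exit_rate[symmetric] mult.commute)
  then show ?thesis using assms by (simp add: pmf_paths)
qed

text \<open>Only \<open>x = hd ys\<close> contributes to the sum over initial states, so the initial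
  mass can be read off the list. What remains is a sum over lists, which \<open>rev\<close>
  permutes.\<close>

lemma stationary_joint_X:
  assumes t: "\<And>i. i < m \<Longrightarrow> 0 \<le> t i \<and> t i \<le> T" and T: "0 \<le> T"
  shows "(\<integral>\<^sup>+x. ennreal (w x) * emeasure (P x) {\<omega>\<in>space (P x). \<forall>i<m. X (t i) \<omega> = y i} \<partial>count_space UNIV) =
    (\<integral>\<^sup>+n. \<integral>\<^sup>+ys. of_bool (length ys = Suc n) * ennreal (w (hd ys) * path_weight off_diag ys) *
      (\<integral>\<^sup>+s. path_density n ys m t y (\<lambda>i. exit_rate Q (ys ! i)) (simplex_point n T s) \<partial>PiM {..<n} (\<lambda>_. lborel))
      \<partial>count_space UNIV \<partial>count_space UNIV)"
proof -
  define D where "D n ys = (\<integral>\<^sup>+s. path_density n ys m t y (\<lambda>i. exit_rate Q (ys ! i)) (simplex_point n T s) \<partial>PiM {..<n} (\<lambda>_. lborel))" for n ys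
  have "(\<integral>\<^sup>+x. ennreal (w x) * emeasure (P x) {\<omega>\<in>space (P x). \<forall>i<m. X (t i) \<omega> = y i} \<partial>count_space UNIV) =
    (\<integral>\<^sup>+x. \<integral>\<^sup>+n. \<integral>\<^sup>+ys. ennreal (w x) * (ennreal (pmf (paths n x) ys * (\<Prod>i<n. exit_rate Q (ys ! i))) * D n ys)
      \<partial>count_space UNIV \<partial>count_space UNIV \<partial>count_space UNIV)"
  proof (rule nn_integral_cong)
    fix x
    show "ennreal (w x) * emeasure (P x) {\<omega>\<in>space (P x). \<forall>i<m. X (t i) \<omega> = y i} =
      (\<integral>\<^sup>+n. \<integral>\<^sup>+ys. ennreal (w x) * (ennreal (pmf (paths n x) ys * (\<Prod>i<n. exit_rate Q (ys ! i))) * D n ys)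
      \<partial>count_space UNIV \<partial>count_space UNIV)"
      by (subst emeasure_joint_X[OF t T]) (simp_all add: D_def nn_integral_cmult)
  qed
  also have "\<dots> = (\<integral>\<^sup>+n. \<integral>\<^sup>+x. \<integral>\<^sup>+ys. ennreal (w x) * (ennreal (pmf (paths n x) ys * (\<Prod>i<n. exit_rate Q (ys ! i))) * D n ys)
      \<partial>count_space UNIV \<partial>count_space UNIV \<partial>count_space UNIV)"
    by (rule nn_integral_count_space_nn_integral) auto
  also have "\<dots> = (\<integral>\<^sup>+n. \<integral>\<^sup>+ys. \<integral>\<^sup>+x. ennreal (w x) * (ennreal (pmf (paths n x) ys * (\<Prod>i<n. exit_rate Q (ys ! i))) * D n ys)
      \<partial>count_space UNIV \<partial>count_space UNIV \<partial>count_space UNIV)"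
    by (rule nn_integral_cong, rule nn_integral_count_space_nn_integral) auto
  also have "\<dots> = (\<integral>\<^sup>+n. \<integral>\<^sup>+ys. of_bool (length ys = Suc n) * ennreal (w (hd ys) * path_weight off_diag ys) * D n ys
      \<partial>count_space UNIV \<partial>count_space UNIV)"
  proof (intro nn_integral_cong)
    fix n ys
    show "(\<integral>\<^sup>+x. ennreal (w x) * (ennreal (pmf (paths n x) ys * (\<Prod>i<n. exit_rate Q (ys ! i))) * D n ys) \<partial>count_space UNIV) =
      of_bool (length ys = Suc n) * ennreal (w (hd ys) * path_weight off_diag ys) * D n ys"
    proof (cases "length ys = Suc n")
      case True
      have "(\<integral>\<^sup>+x. ennreal (w x) * (ennreal (pmf (paths n x) ys * (\<Prod>i<n. exit_rate Q (ys ! i))) * D n ys) \<partial>count_space UNIV) =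
        (\<integral>\<^sup>+x. ennreal (w (hd ys) * path_weight off_diag ys) * D n ys * indicator {hd ys} x \<partial>count_space UNIV)"
        unfolding path_weight_off_diag[OF True]
        by (intro nn_integral_cong) (auto simp: indicator_def ennreal_mult' w_nonneg mult.assoc)
      also have "\<dots> = ennreal (w (hd ys) * path_weight off_diag ys) * D n ys"
        by (subst nn_integral_cmult_indicator) auto
      finally show ?thesis using True by simp
    next
      case False
      then have "pmf (paths n x) ys = 0" for x
        using set_pmf_paths[of ys n x] by (auto simp: set_pmf_iff)
      then show ?thesis using False by simp
    qed
  qed
  finally show ?thesis unfolding D_def .
qed

lemma joint_prob_eq:
  "joint_prob P X w m t y =
    enn2real (\<integral>\<^sup>+x. ennreal (w x) * emeasure (P x) {\<omega>\<in>space (P x). \<forall>i<m. X (t i) \<omega> = y i} \<partial>count_space UNIV)"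
proof -
  have "emeasure (P x) A = ennreal (measure (P x) A)" for x A
    using prob_space_P[of x] by (intro finite_measure.emeasure_eq_measure prob_space.finite_measure)
  then show ?thesis
    unfolding joint_prob_def by (subst infsum_eq_nn_integral) (auto simp: w_nonneg ennreal_mult')
qed

theorem reversible: "reversible P X w"
  unfolding reversible_def
proof (intro allI impI)
  fix T :: real and m :: nat and t :: "nat \<Rightarrow> real" and y :: "nat \<Rightarrow> 's"
  assume t: "\<forall>i<m. 0 \<le> t i \<and> t i \<le> T"
  show "joint_prob P X w m t y = joint_prob P X w m (\<lambda>i. T - t i) y"
  proof (cases "m = 0")
    case True
    then show ?thesis by (simp add: joint_prob_def)
  next
    case False
    \<comment> \<open>The sign of \<open>T\<close> comes from an observation time, so the empty
      family, for which \<open>T\<close> may be negative, is treated apart.\<close>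
    then have T: "0 \<le> T" using t by (metis gr0I order_trans)
    let ?D = "\<lambda>t n ys. (\<integral>\<^sup>+s. path_density n ys m t y (\<lambda>i. exit_rate Q (ys ! i)) (simplex_point n T s) \<partial>PiM {..<n} (\<lambda>_. lborel))"
    let ?f = "\<lambda>t n ys. of_bool (length ys = Suc n) * ennreal (w (hd ys) * path_weight off_diag ys) * ?D t n ys"
    have f: "?f t n ys = ?f (\<lambda>i. T - t i) n (rev ys)" for n ys
    proof (cases "length ys = Suc n")
      case True
      then have "ys \<noteq> []" by auto
      have "?D t n ys = (\<integral>\<^sup>+s. path_density n (rev ys) m (\<lambda>i. T - t i) y (\<lambda>i. exit_rate Q (ys ! (n - i))) (simplex_point n T s) \<partial>PiM {..<n} (\<lambda>_. lborel))"
        by (rule nn_integral_path_density_rev[OF True])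
      also have "\<dots> = ?D (\<lambda>i. T - t i) n (rev ys)"
        using True by (intro nn_integral_cong path_density_cong) (simp add: rev_nth)
      finally show ?thesis
        using True \<open>ys \<noteq> []\<close> path_weight_rev[of w off_diag ys] off_diag_balance by (simp add: hd_rev)
    qed simp
    have "(\<integral>\<^sup>+n. \<integral>\<^sup>+ys. ?f t n ys \<partial>count_space UNIV \<partial>count_space UNIV) =
      (\<integral>\<^sup>+n. \<integral>\<^sup>+ys. ?f (\<lambda>i. T - t i) n (rev ys) \<partial>count_space UNIV \<partial>count_space UNIV)"
      by (simp only: f)
    also have "\<dots> = (\<integral>\<^sup>+n. \<integral>\<^sup>+ys. ?f (\<lambda>i. T - t i) n ys \<partial>count_space UNIV \<partial>count_space UNIV)"
      by (intro nn_integral_cong nn_integral_bij_count_space) (auto intro!: bij_betwI[where g = rev])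
    finally show ?thesis
      unfolding joint_prob_eq using t T by (subst (1 2) stationary_joint_X) auto
  qed
qed

end

section \<open>Hitting probabilities of the jump chain\<close>

context jump_holding_process
begin

section \<open>Almost sure behaviour of the jump chain and its holding times\<close>

lemma path_nth: "i \<le> n \<Longrightarrow> path n \<omega> ! i = Y i \<omega>"
  unfolding path_def by (simp del: upt_Suc)

lemma set_pmf_paths_step:
  assumes "ys \<in> set_pmf (paths n x)" "i < n"
  shows "0 < jump_prob Q (ys ! i) (ys ! Suc i)"
proof -
  have len: "length ys = Suc n" using set_pmf_paths[OF assms(1)] by simp
  have "pmf (paths n x) ys \<noteq> 0" using assms(1) by (simp add: set_pmf_iff)
  then have "path_weight (jump_prob Q) ys \<noteq> 0" using len by (simp add: pmf_paths)
  moreover have "ys \<noteq> []" using len by auto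
  ultimately have "jump_prob Q (ys ! i) (ys ! Suc i) \<noteq> 0"
    using assms(2) len by (auto simp: path_weight_conv_prod)
  then show ?thesis using jump_prob_nonneg[of "ys ! i" "ys ! Suc i"] by simp
qed

lemma jump_prob_pos: "0 < jump_prob Q x y \<Longrightarrow> 0 < off_diag x y \<or> exit_rate Q x = 0 \<and> y = x"
  using exit_rate_nonneg[of x] jump_prob_mult_exit_rate[of x y]
  by (cases "exit_rate Q x = 0") (auto simp: jump_prob_def zero_less_mult_iff zero_less_divide_iff split: if_splits)

lemma off_diag_pos: "0 < off_diag x y \<Longrightarrow> y \<in> set_pmf (jump_pmf x)"
  using jump_prob_mult_exit_rate[of x y] by (auto simp: set_pmf_iff pmf_jump_pmf)

lemma AE_Y_0: "AE \<omega> in P x. Y 0 \<omega> = x"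
proof -
  have "AE \<omega> in P x. hd (path 0 \<omega>) = x"
    by (rule AE_path) auto
  then show ?thesis by (simp add: path_def)
qed

lemma AE_Y_step: "AE \<omega> in P x. \<forall>i. 0 < jump_prob Q (Y i \<omega>) (Y (Suc i) \<omega>)"
proof (subst AE_all_countable, rule allI)
  fix i
  have "AE \<omega> in P x. 0 < jump_prob Q (path (Suc i) \<omega> ! i) (path (Suc i) \<omega> ! Suc i)"
    by (rule AE_path) (auto intro: set_pmf_paths_step simp del: paths.simps)
  then show "AE \<omega> in P x. 0 < jump_prob Q (Y i \<omega>) (Y (Suc i) \<omega>)"
    by (simp add: path_nth)
qed

lemma AE_holding_law_finite: "0 < q \<Longrightarrow> AE z in holding_law q. z \<noteq> \<infinity>"
  unfolding holding_law_def by (subst if_not_P, simp, subst AE_distr_iff) auto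

text \<open>For a fixed path the product law has a genuine exponential factor at each nonabsorbing
  state; the countably many paths are then collected.\<close>

lemma AE_S_finite: "AE \<omega> in P x. \<forall>i. exit_rate Q (Y i \<omega>) \<noteq> 0 \<longrightarrow> S i \<omega> \<noteq> \<infinity>"
proof (subst AE_all_countable, rule allI)
  fix i
  have "AE \<omega> in P x. path i \<omega> = ys \<longrightarrow> exit_rate Q (ys ! i) \<noteq> 0 \<longrightarrow> S i \<omega> \<noteq> \<infinity>" for ys
  proof (cases "exit_rate Q (ys ! i) = 0")
    case False
    then have q: "0 < exit_rate Q (ys ! i)" using exit_rate_nonneg[of "ys ! i"] by simp
    have [measurable]: "(\<lambda>\<omega>. indicator {\<omega>. path i \<omega> = ys} \<omega> :: ennreal) \<in> borel_measurable (P x)"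
      by (subst borel_measurable_indicator_iff) measurable
    have "AE s in PiM {..i} (\<lambda>i. holding_law (exit_rate Q (ys ! i))). s i \<noteq> \<infinity>"
      using q by (intro AE_PiM_component prob_space_holding_law exit_rate_nonneg AE_holding_law_finite) auto
    then have "AE s in PiM {..i} (\<lambda>i. holding_law (exit_rate Q (ys ! i))). of_bool (s i = \<infinity>) = (0 :: ennreal)"
      by eventually_elim simp
    then have z: "(\<integral>\<^sup>+s. of_bool (s i = \<infinity>) \<partial>PiM {..i} (\<lambda>i. holding_law (exit_rate Q (ys ! i)))) =
      (\<integral>\<^sup>+s. 0 \<partial>PiM {..i} (\<lambda>i. holding_law (exit_rate Q (ys ! i))))"
      by (rule nn_integral_cong_AE)
    have m: "(\<lambda>s. of_bool (s i = \<infinity>) :: ennreal) \<in> borel_measurable (PiM {..i} (\<lambda>_. borel :: ennreal measure))"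
      unfolding of_bool_def by measurable
    have "(\<integral>\<^sup>+\<omega>. of_bool ((\<lambda>i\<in>{..i}. S i \<omega>) i = \<infinity>) * indicator {\<omega>. path i \<omega> = ys} \<omega> \<partial>P x) = 0"
      unfolding holding_times_law[OF m] z by simp
    then have "(\<integral>\<^sup>+\<omega>. of_bool (S i \<omega> = \<infinity>) * indicator {\<omega>. path i \<omega> = ys} \<omega> \<partial>P x) = 0"
      by simp
    then have "AE \<omega> in P x. of_bool (S i \<omega> = \<infinity>) * indicator {\<omega>. path i \<omega> = ys} \<omega> = (0 :: ennreal)"
      by (subst (asm) nn_integral_0_iff_AE) (unfold of_bool_def, measurable)
    then show ?thesis by eventually_elim (auto simp: indicator_def split: if_splits)
  qed simp
  then have "AE \<omega> in P x. \<forall>ys. path i \<omega> = ys \<longrightarrow> exit_rate Q (ys ! i) \<noteq> 0 \<longrightarrow> S i \<omega> \<noteq> \<infinity>"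
    by (subst AE_all_countable) simp
  then show "AE \<omega> in P x. exit_rate Q (Y i \<omega>) \<noteq> 0 \<longrightarrow> S i \<omega> \<noteq> \<infinity>"
    by eventually_elim (simp add: path_nth)
qed

lemma nn_integral_split_path:
  assumes [measurable]: "f \<in> borel_measurable (P x)"
  shows "(\<integral>\<^sup>+\<omega>. f \<omega> * g (path n \<omega>) \<partial>P x) =
    (\<integral>\<^sup>+ys. g ys * (\<integral>\<^sup>+\<omega>. f \<omega> * indicator {\<omega>. path n \<omega> = ys} \<omega> \<partial>P x) \<partial>count_space UNIV)"
proof -
  have [measurable]: "(\<lambda>\<omega>. indicator {\<omega>. path n \<omega> = ys} \<omega> :: ennreal) \<in> borel_measurable (P x)" for ys
    by (subst borel_measurable_indicator_iff) measurable
  have "(\<integral>\<^sup>+\<omega>. f \<omega> * g (path n \<omega>) \<partial>P x) =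
    (\<integral>\<^sup>+\<omega>. \<integral>\<^sup>+ys. g ys * (f \<omega> * indicator {\<omega>. path n \<omega> = ys} \<omega>) \<partial>count_space UNIV \<partial>P x)"
  proof (rule nn_integral_cong)
    fix \<omega>
    have "(\<integral>\<^sup>+ys. g ys * (f \<omega> * indicator {\<omega>. path n \<omega> = ys} \<omega>) \<partial>count_space UNIV) =
      (\<integral>\<^sup>+ys. f \<omega> * g (path n \<omega>) * indicator {path n \<omega>} ys \<partial>count_space UNIV)"
      by (intro nn_integral_cong) (auto simp: indicator_def mult.commute)
    then show "f \<omega> * g (path n \<omega>) = (\<integral>\<^sup>+ys. g ys * (f \<omega> * indicator {\<omega>. path n \<omega> = ys} \<omega>) \<partial>count_space UNIV)"
      by (simp add: nn_integral_cmult_indicator)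
  qed
  also have "\<dots> = (\<integral>\<^sup>+ys. \<integral>\<^sup>+\<omega>. g ys * (f \<omega> * indicator {\<omega>. path n \<omega> = ys} \<omega>) \<partial>P x \<partial>count_space UNIV)"
    by (rule nn_integral_count_space_nn_integral) auto
  also have "\<dots> = (\<integral>\<^sup>+ys. g ys * (\<integral>\<^sup>+\<omega>. f \<omega> * indicator {\<omega>. path n \<omega> = ys} \<omega> \<partial>P x) \<partial>count_space UNIV)"
    by (intro nn_integral_cong nn_integral_cmult) measurable
  finally show ?thesis .
qed

text \<open>For \<open>q > 0\<close> the mean is \<open>1 / q\<close>; for \<open>q = 0\<close> it
  is infinite, but \<open>0 * \<infinity> = 0\<close>, so the inequality covers absorbing states as
  well.\<close>

lemma holding_law_mean: "0 \<le> q \<Longrightarrow> ennreal q * (\<integral>\<^sup>+z. z \<partial>holding_law q) \<le> 1"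
proof (cases "q = 0")
  case False
  assume "0 \<le> q"
  with False have q: "0 < q" by simp
  then have "(\<integral>\<^sup>+z. z \<partial>holding_law q) = (\<integral>\<^sup>+z. ennreal (exponential_density q z) * ennreal z \<partial>lborel)"
    by (simp add: holding_law_def nn_integral_distr nn_integral_density)
  also have "\<dots> = (\<integral>\<^sup>+z. ennreal (erlang_density 0 q z * z ^ 1) \<partial>lborel)"
    using q by (intro nn_integral_cong) (simp add: ennreal_mult')
  also have "\<dots> = ennreal (1 / q)"
    using q by (subst nn_integral_erlang_ith_moment) auto
  finally show ?thesis using q by (simp add: ennreal_mult'[symmetric])
qed simp

lemma nn_integral_S_path:
  "(\<integral>\<^sup>+\<omega>. S n \<omega> * indicator {\<omega>. path n \<omega> = ys} \<omega> \<partial>P x) =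
    ennreal (pmf (paths n x) ys) * (\<integral>\<^sup>+z. z \<partial>holding_law (exit_rate Q (ys ! n)))"
proof -
  let ?M = "\<lambda>i. holding_law (exit_rate Q (ys ! i))"
  have "(\<integral>\<^sup>+\<omega>. S n \<omega> * indicator {\<omega>. path n \<omega> = ys} \<omega> \<partial>P x) = (\<integral>\<^sup>+\<omega>. (\<lambda>i\<in>{..n}. S i \<omega>) n * indicator {\<omega>. path n \<omega> = ys} \<omega> \<partial>P x)"
    by simp
  also have "\<dots> = ennreal (pmf (paths n x) ys) * (\<integral>\<^sup>+s. s n \<partial>PiM {..n} ?M)"
    by (rule holding_times_law) measurable
  also have "(\<integral>\<^sup>+s. s n \<partial>PiM {..n} ?M) = (\<integral>\<^sup>+z. z \<partial>distr (PiM {..n} ?M) (?M n) (\<lambda>s. s n))"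
    by (subst nn_integral_distr) auto
  also have "distr (PiM {..n} ?M) (?M n) (\<lambda>s. s n) = ?M n"
    by (intro distr_PiM_component prob_space_holding_law exit_rate_nonneg) auto
  finally show ?thesis .
qed

text \<open>Time 0 counts as a visit, so \<open>avoid_prob y y = 0\<close>. The probability of no
  return to \<open>y\<close> is obtained by averaging over the state after one jump instead.\<close>

definition avoid_prob :: "'s \<Rightarrow> 's \<Rightarrow> ennreal" where
  "avoid_prob y x = emeasure (P x) {\<omega>\<in>space (P x). \<forall>n. Y n \<omega> \<noteq> y}"

lemma avoid_in_path: "y \<notin> set (path n \<omega>) \<longleftrightarrow> (\<forall>i\<le>n. Y i \<omega> \<noteq> y)"
  unfolding path_def by (auto simp: less_Suc_eq_le simp del: upt_Suc)

lemma avoid_in_tl_path: "y \<notin> set (tl (path n \<omega>)) \<longleftrightarrow> (\<forall>i\<in>{1..n}. Y i \<omega> \<noteq> y)"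
proof -
  have "tl (path n \<omega>) = map (\<lambda>i. Y i \<omega>) [1..<Suc n]"
    unfolding path_def by (simp add: map_tl[symmetric] upt_conv_Cons del: upt_Suc)
  then show ?thesis by (auto simp: less_Suc_eq_le simp del: upt_Suc)
qed

lemma avoid_prob_INF:
  "avoid_prob y x = (INF n. emeasure (measure_pmf (paths n x)) {ys. y \<notin> set ys})"
proof -
  interpret prob_space "P x" by (rule prob_space_P)
  define A where "A n = {\<omega>\<in>space (P x). y \<notin> set (path n \<omega>)}" for n
  have [measurable]: "A n \<in> sets (P x)" for n unfolding A_def by measurable
  have "(INF n. emeasure (P x) (A n)) = emeasure (P x) (\<Inter>n. A n)"
  proof (rule INF_emeasure_decseq)
    show "decseq A"
      unfolding A_def avoid_in_path by (intro monotoneI) (blast intro: le_trans)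
  qed auto
  also have "(\<Inter>n. A n) = {\<omega>\<in>space (P x). \<forall>n. Y n \<omega> \<noteq> y}"
    by (auto simp: A_def avoid_in_path)
  finally show ?thesis
    by (simp add: avoid_prob_def A_def emeasure_path_pred[where R = "\<lambda>ys. y \<notin> set ys"])
qed

lemma emeasure_paths_Suc:
  "emeasure (measure_pmf (paths (Suc n) x)) {ys. R ys} =
    (\<integral>\<^sup>+z. emeasure (measure_pmf (paths n z)) {ys. R (x # ys)} \<partial>jump_pmf x)"
proof -
  have "emeasure (measure_pmf (paths (Suc n) x)) {ys. R ys} = (\<integral>\<^sup>+ys. indicator {ys. R ys} ys \<partial>paths (Suc n) x)"
    by (rule nn_integral_indicator[symmetric]) simp
  also have "\<dots> = (\<integral>\<^sup>+z. \<integral>\<^sup>+ys. indicator {ys. R ys} (x # ys) \<partial>paths n z \<partial>jump_pmf x)"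
    unfolding paths.simps nn_integral_map_pmf nn_integral_bind_pmf ..
  also have "\<dots> = (\<integral>\<^sup>+z. \<integral>\<^sup>+ys. indicator {ys. R (x # ys)} ys \<partial>paths n z \<partial>jump_pmf x)"
    by (simp only: indicator_def mem_Collect_eq)
  finally show ?thesis by simp
qed

lemma paths_avoid_decseq: "decseq (\<lambda>n z. emeasure (measure_pmf (paths n z)) {ys. y \<notin> set ys})"
proof (intro monotoneI le_funI)
  fix m n :: nat and z assume "m \<le> n"
  then have "emeasure (P z) {\<omega>\<in>space (P z). y \<notin> set (path n \<omega>)} \<le> emeasure (P z) {\<omega>\<in>space (P z). y \<notin> set (path m \<omega>)}"
    unfolding avoid_in_path by (intro emeasure_mono) (blast intro: le_trans, measurable)
  then show "emeasure (measure_pmf (paths n z)) {ys. y \<notin> set ys} \<le> emeasure (measure_pmf (paths m z)) {ys. y \<notin> set ys}"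
    by (simp add: emeasure_path_pred[where R = "\<lambda>ys. y \<notin> set ys"])
qed

lemma nn_integral_avoid_prob:
  "(\<integral>\<^sup>+z. avoid_prob y z \<partial>jump_pmf x) =
    (INF n. \<integral>\<^sup>+z. emeasure (measure_pmf (paths n z)) {ys. y \<notin> set ys} \<partial>jump_pmf x)"
  unfolding avoid_prob_INF
proof (rule nn_integral_monotone_convergence_INF_decseq[OF paths_avoid_decseq])
  fix n
  have "(\<integral>\<^sup>+z. emeasure (measure_pmf (paths n z)) {ys. y \<notin> set ys} \<partial>jump_pmf x) \<le> (\<integral>\<^sup>+z. 1 \<partial>jump_pmf x)"
    by (intro nn_integral_mono measure_pmf.emeasure_le_1)
  also have "\<dots> < \<infinity>" by simp
  finally show "(\<integral>\<^sup>+z. emeasure (measure_pmf (paths n z)) {ys. y \<notin> set ys} \<partial>jump_pmf x) < \<infinity>" .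
qed simp

lemma avoid_prob_self: "avoid_prob x x = 0"
proof -
  have "avoid_prob x x \<le> emeasure (measure_pmf (paths 0 x)) {ys. x \<notin> set ys}"
    unfolding avoid_prob_INF by (rule INF_lower) simp
  then show ?thesis by simp
qed

text \<open>First-step analysis for finitely many jumps, followed by the decreasing limit. At
  \<open>x = y\<close> the left side is 0, while the right side becomes the probability of no
  return.\<close>

lemma avoid_prob_harmonic:
  assumes "x \<noteq> y"
  shows "avoid_prob y x = (\<integral>\<^sup>+z. avoid_prob y z \<partial>jump_pmf x)"
proof -
  let ?u = "\<lambda>n x. emeasure (measure_pmf (paths n x)) {ys. y \<notin> set ys}"
  have "avoid_prob y x = (INF n. ?u (Suc n) x)"
    unfolding avoid_prob_INF
  proof (rule antisym)
    show "(INF n. ?u n x) \<le> (INF n. ?u (Suc n) x)"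
      by (rule INF_greatest) (rule INF_lower, simp)
    show "(INF n. ?u (Suc n) x) \<le> (INF n. ?u n x)"
    proof (rule INF_greatest)
      fix n
      have "(\<lambda>z. ?u (Suc n) z) \<le> (\<lambda>z. ?u n z)"
        by (rule decseqD[OF paths_avoid_decseq]) simp
      then have "?u (Suc n) x \<le> ?u n x" by (rule le_funD)
      then show "(INF n. ?u (Suc n) x) \<le> ?u n x" by (intro INF_lower2[of n]) auto
    qed
  qed
  also have "\<dots> = (INF n. \<integral>\<^sup>+z. ?u n z \<partial>jump_pmf x)"
    using assms by (simp add: emeasure_paths_Suc del: paths.simps)
  finally show ?thesis by (simp add: nn_integral_avoid_prob)
qed

text \<open>Links recurrence of \<open>x\<close> to its successors: if \<open>x\<close> is almost
  surely revisited, the average vanishes, hence also \<open>avoid_prob x z\<close> at every possible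
  successor \<open>z\<close>.\<close>

lemma nn_integral_avoid_prob_eq_no_return:
  "(\<integral>\<^sup>+z. avoid_prob x z \<partial>jump_pmf x) = emeasure (P x) {\<omega>\<in>space (P x). \<forall>n\<ge>1. Y n \<omega> \<noteq> x}"
proof -
  interpret prob_space "P x" by (rule prob_space_P)
  define A where "A n = {\<omega>\<in>space (P x). x \<notin> set (tl (path (Suc n) \<omega>))}" for n
  have [measurable]: "A n \<in> sets (P x)" for n unfolding A_def by measurable
  have "(\<integral>\<^sup>+z. avoid_prob x z \<partial>jump_pmf x) = (INF n. emeasure (P x) (A n))"
    unfolding nn_integral_avoid_prob A_def emeasure_path_pred[where R = "\<lambda>ys. x \<notin> set (tl ys)"] emeasure_paths_Suc
    by simp
  also have "\<dots> = emeasure (P x) (\<Inter>n. A n)"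
  proof (rule INF_emeasure_decseq)
    show "decseq A"
      unfolding A_def avoid_in_tl_path by (intro monotoneI) auto
  qed auto
  also have "(\<Inter>n. A n) = {\<omega>\<in>space (P x). \<forall>n\<ge>1. Y n \<omega> \<noteq> x}"
  proof -
    have "(\<forall>n. \<forall>i\<in>{1..Suc n}. Y i \<omega> \<noteq> x) \<longleftrightarrow> (\<forall>n\<ge>1. Y n \<omega> \<noteq> x)" for \<omega>
      by (metis atLeastAtMost_iff le_SucI order_refl)
    then show ?thesis unfolding A_def avoid_in_tl_path by blast
  qed
  finally show ?thesis .
qed

lemma avoid_prob_le_1: "avoid_prob y x \<le> 1"
  unfolding avoid_prob_def by (rule prob_space.emeasure_le_1[OF prob_space_P])

lemma AE_hits_iff: "(AE \<omega> in P x. \<exists>n. Y n \<omega> = y) \<longleftrightarrow> avoid_prob y x = 0"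
  unfolding avoid_prob_def by (subst AE_iff_measurable[OF _ refl]) auto

end

section \<open>Excursions\<close>

context reversible_process
begin

text \<open>The reversing measure of the jump chain is \<open>w\<close> weighted by the exit rates.
  Its mass may be infinite, so recurrence cannot simply be read off from it.\<close>

lemma jump_prob_balance:
  "w x * exit_rate Q x * jump_prob Q x y = w y * exit_rate Q y * jump_prob Q y x"
  using off_diag_balance[of x y] by (simp add: mult.assoc jump_prob_mult_exit_rate)

text \<open>Reversal moves the exit rate from the first state to the last, where it meets the mean
  holding time and cancels up to an inequality. What is left is the probability of the reversed path
  under the initial distribution \<open>w\<close>.\<close>

lemma excursion_term:
  assumes "length ys = Suc n"
  shows "ennreal (w x * exit_rate Q x) * (ennreal (pmf (paths n x) ys) * (\<integral>\<^sup>+z. z \<partial>holding_law (exit_rate Q (ys ! n)))) \<le>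
    of_bool (hd ys = x) * ennreal (w (last ys) * pmf (paths n (last ys)) (rev ys))"
proof (cases "hd ys = x")
  case True
  have ne: "ys \<noteq> []" using assms by auto
  let ?l = "last ys" and ?r = "path_weight (jump_prob Q) (rev ys)"
  have l: "ys ! n = ?l" using assms ne by (simp add: last_conv_nth)
  have r: "0 \<le> ?r" by (intro path_weight_nonneg jump_prob_nonneg)
  have "(w x * exit_rate Q x) * path_weight (jump_prob Q) ys = (w ?l * exit_rate Q ?l) * ?r"
    using path_weight_rev[of "\<lambda>x. w x * exit_rate Q x" "jump_prob Q" ys] jump_prob_balance ne True by simp
  moreover have "pmf (paths n x) ys = path_weight (jump_prob Q) ys"
    using assms True by (simp add: pmf_paths)
  ultimately have "(w x * exit_rate Q x) * pmf (paths n x) ys = (w ?l * ?r) * exit_rate Q ?l"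
    by simp
  then have "ennreal ((w x * exit_rate Q x) * pmf (paths n x) ys) = ennreal ((w ?l * ?r) * exit_rate Q ?l)"
    by (rule arg_cong)
  then have eq: "ennreal (w x * exit_rate Q x) * ennreal (pmf (paths n x) ys) = ennreal (w ?l * ?r) * ennreal (exit_rate Q ?l)"
    by (subst (1 2) ennreal_mult[symmetric]) (simp_all add: w_nonneg exit_rate_nonneg r)
  have "ennreal (w x * exit_rate Q x) * (ennreal (pmf (paths n x) ys) * (\<integral>\<^sup>+z. z \<partial>holding_law (exit_rate Q (ys ! n)))) =
    ennreal (w ?l * ?r) * (ennreal (exit_rate Q ?l) * (\<integral>\<^sup>+z. z \<partial>holding_law (exit_rate Q ?l)))"
    unfolding l by (simp add: mult.assoc[symmetric] eq)
  also have "\<dots> \<le> ennreal (w ?l * ?r) * 1"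
    by (intro mult_left_mono holding_law_mean exit_rate_nonneg) simp
  finally show ?thesis
    using assms True by (simp add: pmf_paths hd_rev)
next
  case False
  then show ?thesis using assms by (simp add: pmf_paths)
qed

text \<open>
  Reversing the excursion: the weighted holding times before the return to \<open>x\<close> are bounded by the
  probability that the process started from \<open>w\<close> hits \<open>x\<close>.
\<close>

lemma excursion_step:
  "ennreal (w x * exit_rate Q x) * (\<integral>\<^sup>+\<omega>. S n \<omega> * of_bool (\<forall>i\<in>{1..n}. Y i \<omega> \<noteq> x) \<partial>P x) \<le>
    (\<integral>\<^sup>+z. ennreal (w z) * emeasure (P z) {\<omega>\<in>space (P z). Y n \<omega> = x \<and> (\<forall>i<n. Y i \<omega> \<noteq> x)} \<partial>count_space UNIV)"
proof -
  \<comment> \<open>Read backwards, a stretch that starts at \<open>x\<close> and avoids it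
    afterwards reaches \<open>x\<close> for the first time at its end.\<close>
  define R where "R zs \<longleftrightarrow> length zs = Suc n \<and> last zs = x \<and> x \<notin> set (butlast zs)" for zs
  have R_path: "R (path n \<omega>) \<longleftrightarrow> Y n \<omega> = x \<and> (\<forall>i<n. Y i \<omega> \<noteq> x)" for \<omega>
    unfolding R_def path_def by (auto simp: last_map butlast_append map_butlast[symmetric])
      (metis atLeastLessThan_iff imageI le0)
  let ?c = "ennreal (w x * exit_rate Q x)" and ?I = "\<lambda>ys. \<integral>\<^sup>+\<omega>. S n \<omega> * indicator {\<omega>. path n \<omega> = ys} \<omega> \<partial>P x"
  have "?c * (\<integral>\<^sup>+\<omega>. S n \<omega> * of_bool (\<forall>i\<in>{1..n}. Y i \<omega> \<noteq> x) \<partial>P x) =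
    ?c * (\<integral>\<^sup>+ys. of_bool (x \<notin> set (tl ys)) * ?I ys \<partial>count_space UNIV)"
    unfolding avoid_in_tl_path[symmetric] by (subst nn_integral_split_path) auto
  also have "\<dots> = (\<integral>\<^sup>+ys. ?c * (of_bool (x \<notin> set (tl ys)) * ?I ys) \<partial>count_space UNIV)"
    by (rule nn_integral_cmult[symmetric]) simp
  also have "\<dots> \<le> (\<integral>\<^sup>+ys. of_bool (R (rev ys)) * ennreal (w (hd (rev ys)) * pmf (paths n (hd (rev ys))) (rev ys)) \<partial>count_space UNIV)"
  proof (rule nn_integral_mono)
    fix ys
    show "?c * (of_bool (x \<notin> set (tl ys)) * ?I ys) \<le> of_bool (R (rev ys)) * ennreal (w (hd (rev ys)) * pmf (paths n (hd (rev ys))) (rev ys))"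
    proof (cases "length ys = Suc n \<and> x \<notin> set (tl ys)")
      case True
      then have ne: "ys \<noteq> []" by auto
      have "set (butlast (rev ys)) = set (tl ys)" by (simp add: butlast_rev)
      then have "R (rev ys) \<longleftrightarrow> hd ys = x" using True ne by (auto simp: R_def last_rev)
      then show ?thesis
        using excursion_term[of ys n x] True ne unfolding nn_integral_S_path by (simp add: hd_rev)
    next
      case False
      have "pmf (paths n x) ys = 0" if "length ys \<noteq> Suc n"
        using set_pmf_paths[of ys n x] that by (auto simp: set_pmf_iff)
      then show ?thesis using False unfolding nn_integral_S_path by auto
    qed
  qed
  also have "\<dots> = (\<integral>\<^sup>+zs. of_bool (R zs) * ennreal (w (hd zs) * pmf (paths n (hd zs)) zs) \<partial>count_space UNIV)"
    by (rule nn_integral_bij_count_space[where f = "\<lambda>zs. of_bool (R zs) * ennreal (w (hd zs) * pmf (paths n (hd zs)) zs)"])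
       (auto intro!: bij_betwI[where g = rev])
  also have "\<dots> = (\<integral>\<^sup>+zs. \<integral>\<^sup>+z. ennreal (w z) * (ennreal (pmf (paths n z) zs) * of_bool (R zs)) \<partial>count_space UNIV \<partial>count_space UNIV)"
  proof (rule nn_integral_cong)
    fix zs
    have "pmf (paths n z) zs = 0" if "z \<noteq> hd zs" for z
      using set_pmf_paths[of zs n z] that by (auto simp: set_pmf_iff)
    then have "(\<integral>\<^sup>+z. ennreal (w z) * (ennreal (pmf (paths n z) zs) * of_bool (R zs)) \<partial>count_space UNIV) =
      (\<integral>\<^sup>+z. of_bool (R zs) * ennreal (w (hd zs) * pmf (paths n (hd zs)) zs) * indicator {hd zs} z \<partial>count_space UNIV)"
      by (intro nn_integral_cong) (auto simp: indicator_def ennreal_mult' w_nonneg)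
    then show "of_bool (R zs) * ennreal (w (hd zs) * pmf (paths n (hd zs)) zs) =
      (\<integral>\<^sup>+z. ennreal (w z) * (ennreal (pmf (paths n z) zs) * of_bool (R zs)) \<partial>count_space UNIV)"
      by (simp add: nn_integral_cmult_indicator)
  qed
  also have "\<dots> = (\<integral>\<^sup>+z. \<integral>\<^sup>+zs. ennreal (w z) * (ennreal (pmf (paths n z) zs) * of_bool (R zs)) \<partial>count_space UNIV \<partial>count_space UNIV)"
    by (rule nn_integral_count_space_nn_integral) auto
  also have "\<dots> = (\<integral>\<^sup>+z. ennreal (w z) * emeasure (P z) {\<omega>\<in>space (P z). Y n \<omega> = x \<and> (\<forall>i<n. Y i \<omega> \<noteq> x)} \<partial>count_space UNIV)"
  proof (rule nn_integral_cong)
    fix z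
    have "(\<integral>\<^sup>+zs. ennreal (pmf (paths n z) zs) * of_bool (R zs) \<partial>count_space UNIV) =
      (\<integral>\<^sup>+zs. ennreal (pmf (paths n z) zs) * indicator {zs. R zs} zs \<partial>count_space UNIV)"
      by (simp only: of_bool_def indicator_def mem_Collect_eq)
    also have "\<dots> = (\<integral>\<^sup>+zs. ennreal (pmf (paths n z) zs) \<partial>count_space {zs. R zs})"
      by (simp add: nn_integral_count_space_indicator)
    also have "\<dots> = emeasure (P z) {\<omega>\<in>space (P z). R (path n \<omega>)}"
      by (simp only: nn_integral_pmf emeasure_path_pred)
    finally show "(\<integral>\<^sup>+zs. ennreal (w z) * (ennreal (pmf (paths n z) zs) * of_bool (R zs)) \<partial>count_space UNIV) =
      ennreal (w z) * emeasure (P z) {\<omega>\<in>space (P z). Y n \<omega> = x \<and> (\<forall>i<n. Y i \<omega> \<noteq> x)}"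
      unfolding R_path by (subst nn_integral_cmult) auto
  qed
  finally show ?thesis .
qed

text \<open>For \<open>n = 0\<close> the condition is vacuous, so the first sojourn counts in full;
  all terms from the first return on vanish. Without a return the sum is the total holding
  time.\<close>

definition excursion_length :: "'s \<Rightarrow> 'w \<Rightarrow> ennreal" where
  "excursion_length x \<omega> = (\<Sum>n. S n \<omega> * of_bool (\<forall>i\<in>{1..n}. Y i \<omega> \<noteq> x))"

lemma measurable_excursion_length[measurable]: "excursion_length x \<in> borel_measurable (P z)"
  unfolding excursion_length_def[abs_def] of_bool_def by measurable

text \<open>First visits to \<open>x\<close> after different numbers of jumps are disjoint events.
  Summing the bounds of \<open>excursion_step\<close> thus gives at most the total mass 1 of
  \<open>w\<close>.\<close>

lemma expected_excursion_length:
  "ennreal (w x * exit_rate Q x) * (\<integral>\<^sup>+\<omega>. excursion_length x \<omega> \<partial>P x) \<le> 1"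
proof -
  let ?A = "\<lambda>n z. {\<omega>\<in>space (P z). Y n \<omega> = x \<and> (\<forall>i<n. Y i \<omega> \<noteq> x)}"
  have "ennreal (w x * exit_rate Q x) * (\<integral>\<^sup>+\<omega>. excursion_length x \<omega> \<partial>P x) =
    (\<Sum>n. ennreal (w x * exit_rate Q x) * (\<integral>\<^sup>+\<omega>. S n \<omega> * of_bool (\<forall>i\<in>{1..n}. Y i \<omega> \<noteq> x) \<partial>P x))"
    unfolding excursion_length_def by (subst nn_integral_suminf) (unfold of_bool_def, measurable)
  also have "\<dots> \<le> (\<Sum>n. \<integral>\<^sup>+z. ennreal (w z) * emeasure (P z) (?A n z) \<partial>count_space UNIV)"
    by (intro suminf_le excursion_step) auto
  also have "\<dots> = (\<integral>\<^sup>+z. (\<Sum>n. ennreal (w z) * emeasure (P z) (?A n z)) \<partial>count_space UNIV)"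
    by (rule nn_integral_suminf[symmetric]) simp
  also have "\<dots> \<le> (\<integral>\<^sup>+z. ennreal (w z) \<partial>count_space UNIV)"
  proof (rule nn_integral_mono)
    fix z
    have "disjoint_family (\<lambda>n. ?A n z)"
      unfolding disjoint_family_on_def
    proof (intro ballI impI)
      fix m n :: nat assume "m \<noteq> n"
      then consider "m < n" | "n < m" by linarith
      then show "?A m z \<inter> ?A n z = {}" by cases auto
    qed
    then have "(\<Sum>n. emeasure (P z) (?A n z)) = emeasure (P z) (\<Union>n. ?A n z)"
      by (intro suminf_emeasure) auto
    also have "\<dots> \<le> 1" by (rule prob_space.emeasure_le_1[OF prob_space_P])
    finally have "ennreal (w z) * (\<Sum>n. emeasure (P z) (?A n z)) \<le> ennreal (w z) * 1"
      by (intro mult_left_mono) auto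
    then show "(\<Sum>n. ennreal (w z) * emeasure (P z) (?A n z)) \<le> ennreal (w z)" by simp
  qed
  also have "\<dots> = 1" by (rule nn_integral_w)
  finally show ?thesis .
qed

lemma expected_excursion_length_finite:
  assumes "0 < w x" "exit_rate Q x \<noteq> 0"
  shows "(\<integral>\<^sup>+\<omega>. excursion_length x \<omega> \<partial>P x) < \<infinity>"
proof -
  have "0 < w x * exit_rate Q x" using assms exit_rate_nonneg[of x] by (simp add: less_le)
  then have "ennreal (w x * exit_rate Q x) * \<infinity> = \<infinity>"
    using assms by (simp add: ennreal_mult_top)
  then have "(\<integral>\<^sup>+\<omega>. excursion_length x \<omega> \<partial>P x) \<noteq> \<infinity>"
    using expected_excursion_length[of x] by (metis infinity_ennreal_def top_unique ennreal_one_neq_top)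
  then show ?thesis by (simp add: less_top)
qed

text \<open>An excursion without return has infinite length, as the process does not explode.\<close>

lemma AE_returns:
  assumes "0 < w x"
  shows "AE \<omega> in P x. \<exists>n\<ge>1. Y n \<omega> = x"
proof (cases "exit_rate Q x = 0")
  case True
  show ?thesis
    using AE_Y_0 AE_Y_step
  proof eventually_elim
    case (elim \<omega>)
    have "0 < jump_prob Q x (Y (Suc 0) \<omega>)" using elim by metis
    then have "Y 1 \<omega> = x" using jump_prob_pos off_diag_eq_0[OF True] by fastforce
    then show ?case by auto
  qed
next
  case False
  have "AE \<omega> in P x. excursion_length x \<omega> \<noteq> \<infinity>"
    using expected_excursion_length_finite[OF assms False] by (intro nn_integral_PInf_AE) auto
  then show ?thesis
    using nonexplosive
  proof eventually_elim
    case (elim \<omega>)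
    show ?case
    proof (rule ccontr)
      assume "\<not> (\<exists>n\<ge>1. Y n \<omega> = x)"
      then have "excursion_length x \<omega> = (\<Sum>n. S n \<omega>)" by (simp add: excursion_length_def)
      with elim show False by simp
    qed
  qed
qed

end

section \<open>Positive recurrence and uniqueness\<close>

context nonexplosive_process
begin

section \<open>From hits of the jump chain to hits in finite time\<close>

lemma X_at_jump_time:
  assumes "\<omega> \<in> space (P x)" "(\<Sum>l<k. S l \<omega>) \<noteq> \<infinity>" "0 < S k \<omega>"
  shows "X (enn2real (\<Sum>l<k. S l \<omega>)) \<omega> = Y k \<omega>"
proof (rule X_eq_Y[OF assms(1)])
  have eq: "ennreal (enn2real (\<Sum>l<k. S l \<omega>)) = (\<Sum>l<k. S l \<omega>)"
    using assms(2) by (simp add: less_top)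
  show "(\<Sum>l<k. S l \<omega>) \<le> ennreal (enn2real (\<Sum>l<k. S l \<omega>))" unfolding eq ..
  have "(\<Sum>l<k. S l \<omega>) + 0 < (\<Sum>l<k. S l \<omega>) + S k \<omega>"
    using assms(2,3) by (subst ennreal_add_left_cancel_less) auto
  then show "ennreal (enn2real (\<Sum>l<k. S l \<omega>)) < (\<Sum>l\<le>k. S l \<omega>)"
    unfolding eq by (simp add: lessThan_Suc_atMost[symmetric])
qed simp

lemma X_values:
  assumes "\<omega> \<in> space (P x)" "(\<Sum>n. S n \<omega>) = \<infinity>" "0 \<le> t"
  shows "\<exists>k. X t \<omega> = Y k \<omega>"
  using ex_jump_index[OF assms(2), of t] X_eq_Y[OF assms(1,3)] by blast

lemma AE_X_0: "AE \<omega> in P x. X 0 \<omega> = x"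
  using AE_Y_0 AE_S_pos[where x = x and i = 0] AE_space
proof eventually_elim
  case (elim \<omega>)
  then show ?case using X_at_jump_time[of \<omega> x 0] by simp
qed

lemma absorbed:
  assumes "\<forall>i. 0 < jump_prob Q (Y i \<omega>) (Y (Suc i) \<omega>)" "exit_rate Q (Y l \<omega>) = 0" "l \<le> k"
  shows "Y k \<omega> = Y l \<omega>"
  using assms(3)
proof (induction k rule: dec_induct)
  case (step k)
  then have "exit_rate Q (Y k \<omega>) = 0" using assms(2) by simp
  then have "Y (Suc k) \<omega> = Y k \<omega>"
    using assms(1)[rule_format, of k] jump_prob_pos[of "Y k \<omega>" "Y (Suc k) \<omega>"] off_diag_eq_0 by fastforce
  then show ?case using step by simp
qed simp

text \<open>An infinite holding time before the first hit would belong to an absorbing state; the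
  chain would stay there, so that state would itself be \<open>y\<close>, against
  minimality.\<close>

lemma AE_finite_hit:
  assumes "avoid_prob y x = 0"
  shows "AE \<omega> in P x. \<exists>k. Y k \<omega> = y \<and> (\<Sum>l<k. S l \<omega>) \<noteq> \<infinity> \<and> 0 < S k \<omega>"
proof -
  have "AE \<omega> in P x. \<forall>i. 0 < S i \<omega>" using AE_S_pos by (subst AE_all_countable) auto
  moreover have "AE \<omega> in P x. \<exists>n. Y n \<omega> = y" using assms by (simp add: AE_hits_iff)
  ultimately show ?thesis
    using AE_Y_step AE_S_finite
  proof eventually_elim
    case (elim \<omega>)
    define k where "k = (LEAST n. Y n \<omega> = y)"
    have k: "Y k \<omega> = y" unfolding k_def using elim(2) by (rule LeastI_ex)
    have "S l \<omega> \<noteq> \<infinity>" if "l < k" for l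
    proof
      assume "S l \<omega> = \<infinity>"
      then have "exit_rate Q (Y l \<omega>) = 0" using elim(4) by blast
      then have "Y k \<omega> = Y l \<omega>" by (rule absorbed[OF elim(3)]) (use that in simp)
      with k have "Y l \<omega> = y" by simp
      with that show False using not_less_Least[of l "\<lambda>n. Y n \<omega> = y"] by (simp add: k_def)
    qed
    then have "(\<Sum>l<k. S l \<omega>) \<noteq> \<infinity>" by simp
    with k elim(1) show ?case by blast
  qed
qed

lemma AE_X_hits:
  assumes "avoid_prob y x = 0"
  shows "AE \<omega> in P x. \<exists>t\<ge>0. X t \<omega> = y"
  using AE_finite_hit[OF assms] AE_space
proof eventually_elim
  case (elim \<omega>)
  then show ?case using X_at_jump_time[OF elim(2)] enn2real_nonneg by metis
qed

text \<open>A sojourn in \<open>y\<close> has positive length and so contains a rational time; were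
  all these times null, countably many null events would cover the hit. Uniqueness needs this
  because stationarity speaks of fixed times.\<close>

lemma ex_positive_transition:
  assumes "avoid_prob y x = 0"
  shows "\<exists>t\<ge>0. 0 < measure (P x) {\<omega>\<in>space (P x). X t \<omega> = y}"
proof (rule ccontr)
  assume no: "\<not> ?thesis"
  interpret prob_space "P x" by (rule prob_space_P)
  have "AE \<omega> in P x. 0 \<le> real_of_rat r \<longrightarrow> X (real_of_rat r) \<omega> \<noteq> y" for r
  proof (cases "0 \<le> real_of_rat r")
    case True
    then have [measurable]: "X (real_of_rat r) \<in> measurable (P x) (count_space UNIV)" by (rule measurable_X)
    have "measure (P x) {\<omega>\<in>space (P x). X (real_of_rat r) \<omega> = y} = 0"
      using no True measure_nonneg[of "P x"] by (meson not_le antisym)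
    then have "AE \<omega> in P x. X (real_of_rat r) \<omega> \<noteq> y"
      by (subst AE_iff_measurable[OF _ refl]) (auto simp: emeasure_eq_measure)
    then show ?thesis by eventually_elim simp
  qed simp
  then have "AE \<omega> in P x. \<forall>r. 0 \<le> real_of_rat r \<longrightarrow> X (real_of_rat r) \<omega> \<noteq> y"
    by (subst AE_all_countable) simp
  then have "AE \<omega> in P x. False"
    using AE_finite_hit[OF assms] AE_space
  proof eventually_elim
    case (elim \<omega>)
    then obtain k where k: "Y k \<omega> = y" "(\<Sum>l<k. S l \<omega>) \<noteq> \<infinity>" "0 < S k \<omega>" by blast
    have "(\<Sum>l<k. S l \<omega>) + 0 < (\<Sum>l<k. S l \<omega>) + S k \<omega>"
      using k by (subst ennreal_add_left_cancel_less) auto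
    then have "(\<Sum>l<k. S l \<omega>) < (\<Sum>l\<le>k. S l \<omega>)"
      by (simp add: lessThan_Suc_atMost[symmetric])
    then obtain r where r: "(\<Sum>l<k. S l \<omega>) < ennreal (real_of_rat r)" "ennreal (real_of_rat r) < (\<Sum>l\<le>k. S l \<omega>)"
      using ennreal_rat_dense by blast
    then have "0 \<le> real_of_rat r" by (metis ennreal_neg le_cases not_less_zero)
    moreover have "X (real_of_rat r) \<omega> = Y k \<omega>"
      using r calculation by (intro X_eq_Y[OF elim(3)]) auto
    ultimately show ?case using elim(1) k(1) by blast
  qed
  then show False by simp
qed

end

text \<open>
  \<open>ennreal\<close> cuts off negative values, so \<open>ennreal (p x - p' x)\<close> is the positive part of the difference.
  The transition operator can only increase it and preserves its total mass, hence leaves it invariant.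
\<close>

lemma stationary_positive_part:
  fixes P :: "'s::countable \<Rightarrow> 'w measure"
  assumes P: "\<And>x. prob_space (P x)" and X: "\<And>x. X t \<in> measurable (P x) (count_space UNIV)" and t: "0 \<le> t"
    and p: "stationary_distribution P X p" and p': "stationary_distribution P X p'"
  shows "ennreal (p x - p' x) * emeasure (P x) {\<omega>\<in>space (P x). X t \<omega> = y} \<le> ennreal (p y - p' y)"
proof -
  define K where "K x y = emeasure (P x) {\<omega>\<in>space (P x). X t \<omega> = y}" for x y
  have K_total: "(\<integral>\<^sup>+y. K x y \<partial>count_space UNIV) = 1" for x
  proof -
    interpret prob_space "P x" by (rule P)
    have "(\<integral>\<^sup>+y. K x y \<partial>count_space UNIV) = emeasure (P x) {\<omega>\<in>space (P x). True}"
      using emeasure_split_countable[OF X, of "\<lambda>_. True" x] by (simp add: K_def)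
    then show ?thesis by (simp add: emeasure_space_1)
  qed
  have nonneg: "0 \<le> p x" "0 \<le> p' x" for x using p p' by (auto simp: stationary_distribution_def)
  have total: "(\<integral>\<^sup>+x. ennreal (r x) \<partial>count_space UNIV) = 1" if "stationary_distribution P X r" for r
    using that unfolding stationary_distribution_def
    by (subst nn_integral_count_space_eq_infsum) (auto simp: has_sum_imp_summable infsumI)
  have inv: "(\<integral>\<^sup>+x. ennreal (r x) * K x y \<partial>count_space UNIV) = ennreal (r y)" if r: "stationary_distribution P X r" for r y
  proof -
    have r0: "0 \<le> r x" for x using r by (auto simp: stationary_distribution_def)
    have K: "ennreal (r x) * K x y = ennreal (r x * measure (P x) {\<omega>\<in>space (P x). X t \<omega> = y})" for x
      unfolding K_def using P[of x] r0
      by (subst finite_measure.emeasure_eq_measure[OF prob_space.finite_measure]) (auto simp: ennreal_mult)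
    have le: "(\<integral>\<^sup>+x. ennreal (r x) * K x y \<partial>count_space UNIV) \<le> (\<integral>\<^sup>+x. ennreal (r x) * 1 \<partial>count_space UNIV)"
      unfolding K_def by (intro nn_integral_mono mult_left_mono prob_space.emeasure_le_1[OF P]) simp
    have "r y = enn2real (\<integral>\<^sup>+x. ennreal (r x) * K x y \<partial>count_space UNIV)"
      using r t unfolding stationary_distribution_def K
      by (subst infsum_eq_nn_integral[symmetric]) (auto simp: r0)
    moreover have "(\<integral>\<^sup>+x. ennreal (r x) * K x y \<partial>count_space UNIV) < \<infinity>"
      using le total[OF r] by (auto intro: le_less_trans)
    ultimately show ?thesis by simp
  qed
  let ?f = "\<lambda>x. ennreal (p x - p' x)" and ?g = "\<lambda>x. ennreal (p' x - p x)"
  let ?A = "\<lambda>f y. \<integral>\<^sup>+x. f x * K x y \<partial>count_space UNIV"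
  \<comment> \<open>This is \<open>p - p' = f - g\<close>, with \<open>f\<close> and
    \<open>g\<close> the positive and the negative part, written without the truncated subtraction
    of \<open>ennreal\<close>.\<close>
  have fg: "ennreal (p x) + ?g x = ennreal (p' x) + ?f x" for x
    using nonneg by (cases "p x \<le> p' x") (auto simp: ennreal_neg ennreal_plus[symmetric] simp del: ennreal_plus)
  have f_le: "?f y \<le> ?A ?f y" for y
  proof (cases "p' y \<le> p y")
    case True
    have "ennreal (p y) + ?A ?g y = (\<integral>\<^sup>+x. (ennreal (p x) + ?g x) * K x y \<partial>count_space UNIV)"
      by (simp add: distrib_right nn_integral_add inv[OF p])
    also have "\<dots> = ennreal (p' y) + ?A ?f y"
      unfolding fg by (simp add: distrib_right nn_integral_add inv[OF p'])
    finally have "ennreal (p' y) + ?A ?f y = ennreal (p' y) + ?f y + ?A ?g y"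
      using True nonneg by (simp add: ennreal_plus[symmetric] del: ennreal_plus)
    then have "ennreal (p' y) + ?f y \<le> ennreal (p' y) + ?A ?f y"
      by simp
    then show ?thesis by (simp add: ennreal_add_left_cancel_le)
  qed (simp add: ennreal_neg)
  have "?f x \<le> ennreal (p x)" for x using nonneg by (intro ennreal_leI) simp
  then have "(\<integral>\<^sup>+x. ?f x \<partial>count_space UNIV) \<le> 1"
    unfolding total[OF p, symmetric] by (intro nn_integral_mono)
  then have fin: "(\<integral>\<^sup>+x. ?f x \<partial>count_space UNIV) \<noteq> \<infinity>" by (auto simp: top_unique)
  have eq: "(\<integral>\<^sup>+y. ?A ?f y \<partial>count_space UNIV) = (\<integral>\<^sup>+x. ?f x \<partial>count_space UNIV)"
  proof -
    have "(\<integral>\<^sup>+y. ?A ?f y \<partial>count_space UNIV) = (\<integral>\<^sup>+x. \<integral>\<^sup>+y. ?f x * K x y \<partial>count_space UNIV \<partial>count_space UNIV)"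
      by (rule nn_integral_count_space_nn_integral) auto
    also have "\<dots> = (\<integral>\<^sup>+x. ?f x * 1 \<partial>count_space UNIV)"
      by (rule nn_integral_cong) (simp add: nn_integral_cmult K_total)
    finally show ?thesis by simp
  qed
  have "(\<integral>\<^sup>+y. ?A ?f y - ?f y \<partial>count_space UNIV) = (\<integral>\<^sup>+y. ?A ?f y \<partial>count_space UNIV) - (\<integral>\<^sup>+x. ?f x \<partial>count_space UNIV)"
    using fin f_le by (intro nn_integral_diff) auto
  also have "\<dots> = 0" unfolding eq using fin by (simp add: diff_eq_0_iff_ennreal less_top)
  finally have "?A ?f y - ?f y = 0"
    by (simp add: nn_integral_0_iff_AE AE_count_space)
  then have "?A ?f y \<le> ?f y" by (simp add: diff_eq_0_ennreal ennreal_minus_eq_0)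
  moreover have "?f x * K x y \<le> ?A ?f y"
  proof -
    have "?f x * K x y = (\<integral>\<^sup>+z. ?f z * K z y * indicator {x} z \<partial>count_space UNIV)"
      by (simp add: nn_integral_indicator_singleton)
    also have "\<dots> \<le> ?A ?f y" by (intro nn_integral_mono) (auto simp: indicator_def)
    finally show ?thesis .
  qed
  ultimately show ?thesis unfolding K_def by (rule order_trans[rotated])
qed

text \<open>Detailed balance yields recurrence only on the support of \<open>w\<close>. At a state
  of weight 0 a finite closed set takes its place: on it the probability of avoiding a given state
  attains a maximum.\<close>

locale ergodic_process = reversible_process Q P Y S X w
  for Q :: "'s::countable \<Rightarrow> 's \<Rightarrow> real" and P :: "'s \<Rightarrow> 'w measure" and Y S X w +
  assumes reachable: "0 < w y \<Longrightarrow> (x, y) \<in> {(a, b). a \<noteq> b \<and> 0 < Q a b}\<^sup>*"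
    and finite_closed: "w x = 0 \<Longrightarrow> \<exists>F. finite F \<and> x \<in> F \<and> (\<forall>a\<in>F. \<forall>b. a \<noteq> b \<longrightarrow> 0 < Q a b \<longrightarrow> b \<in> F)"
begin

section \<open>Certain hitting of the support\<close>

lemma off_diag_pos_iff: "0 < off_diag a b \<longleftrightarrow> a \<noteq> b \<and> 0 < Q a b"
  by (auto simp: off_diag_def)

text \<open>A vanishing average of nonnegative values vanishes at every possible successor, so 0
  spreads along the edges. At \<open>y\<close> the average is the probability of no return,
  elsewhere it is \<open>avoid_prob\<close> itself by harmonicity.\<close>

lemma avoid_prob_reachable:
  assumes y: "0 < w y" and "(y, z) \<in> {(a, b). a \<noteq> b \<and> 0 < Q a b}\<^sup>*"
  shows "avoid_prob y z = 0"
  using assms(2)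
proof (induction rule: rtrancl_induct)
  case base
  show ?case by (rule avoid_prob_self)
next
  case (step a b)
  have "(\<integral>\<^sup>+z. avoid_prob y z \<partial>jump_pmf a) = 0"
  proof (cases "a = y")
    case True
    have "AE \<omega> in P y. \<exists>n\<ge>1. Y n \<omega> = y" by (rule AE_returns[OF y])
    then have "emeasure (P y) {\<omega>\<in>space (P y). \<forall>n\<ge>1. Y n \<omega> \<noteq> y} = 0"
      by (subst (asm) AE_iff_measurable[OF _ refl]) auto
    then show ?thesis using True by (simp add: nn_integral_avoid_prob_eq_no_return)
  next
    case False
    then show ?thesis using step.IH avoid_prob_harmonic by simp
  qed
  moreover have "b \<in> set_pmf (jump_pmf a)"
    using step.hyps by (intro off_diag_pos) (simp add: off_diag_pos_iff)
  ultimately show ?case by (simp add: nn_integral_0_iff_AE AE_measure_pmf_iff)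
qed

text \<open>
  Outside the support of \<open>w\<close> this is the maximum principle for the harmonic function
  \<open>avoid_prob y\<close> on a finite closed set.
\<close>

lemma avoid_prob_eq_0:
  assumes y: "0 < w y"
  shows "avoid_prob y x = 0"
proof (cases "0 < w x")
  case True
  then show ?thesis using avoid_prob_reachable[OF y reachable] by blast
next
  case False
  then have "w x = 0" using w_nonneg[of x] by simp
  from finite_closed[OF this] obtain F where "finite F" "x \<in> F"
    and "\<forall>a\<in>F. \<forall>b. a \<noteq> b \<longrightarrow> 0 < Q a b \<longrightarrow> b \<in> F" by (elim exE conjE)
  then have F: "finite F" "x \<in> F" "\<And>a b. a \<in> F \<Longrightarrow> a \<noteq> b \<Longrightarrow> 0 < Q a b \<Longrightarrow> b \<in> F" by simp_all
  define M where "M = Max (avoid_prob y ` F)"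
  have M: "avoid_prob y a \<le> M" if "a \<in> F" for a
    unfolding M_def using F(1) that by (intro Max_ge) auto
  have "M \<in> avoid_prob y ` F" unfolding M_def using F by (intro Max_in) auto
  then obtain z where z: "z \<in> F" "avoid_prob y z = M" by auto
  have "M \<le> 1" using z avoid_prob_le_1 by metis
  then have M_fin: "M \<noteq> \<infinity>" by (auto simp: top_unique)
  have "M = 0"
  proof (rule ccontr)
    assume M0: "M \<noteq> 0"
    have "b \<in> F \<and> avoid_prob y b = M" if "(z, b) \<in> {(a, b). a \<noteq> b \<and> 0 < Q a b}\<^sup>*" for b
      using that
    proof (induction rule: rtrancl_induct)
      case base
      show ?case using z by simp
    next
      case (step a b)
      then have a: "a \<in> F" "avoid_prob y a = M" by auto
      have "a \<noteq> y" using a M0 avoid_prob_self by metis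
      then have int: "(\<integral>\<^sup>+z. avoid_prob y z \<partial>jump_pmf a) = M"
        using avoid_prob_harmonic[of a y] a by simp
      have le: "avoid_prob y c \<le> M" if "c \<in> set_pmf (jump_pmf a)" for c
      proof -
        have "0 < jump_prob Q a c"
          using that jump_prob_nonneg[of a c] by (simp add: set_pmf_iff pmf_jump_pmf)
        then show ?thesis
          using jump_prob_pos[of a c] a F(3)[of a c] M by (auto simp: off_diag_pos_iff)
      qed
      have "(\<integral>\<^sup>+z. M - avoid_prob y z \<partial>jump_pmf a) = (\<integral>\<^sup>+z. M \<partial>jump_pmf a) - (\<integral>\<^sup>+z. avoid_prob y z \<partial>jump_pmf a)"
        using le int M_fin by (intro nn_integral_diff) (auto simp: AE_measure_pmf_iff)
      also have "\<dots> = 0" unfolding int using M_fin by (simp add: less_top)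
      finally have "(\<integral>\<^sup>+z. M - avoid_prob y z \<partial>jump_pmf a) = 0" .
      moreover have b: "b \<in> set_pmf (jump_pmf a)"
        using step.hyps by (intro off_diag_pos) (simp add: off_diag_pos_iff)
      ultimately have "M - avoid_prob y b = 0"
        by (simp add: nn_integral_0_iff_AE AE_measure_pmf_iff)
      then have "M \<le> avoid_prob y b" by (simp add: ennreal_minus_eq_0)
      moreover have "b \<in> F" using F(3)[of a b] a step.hyps by auto
      ultimately show ?case using le[OF b] by (simp add: antisym)
    qed
    from this[OF reachable[OF y]] M0 avoid_prob_self show False by auto
  qed
  then show ?thesis using M[OF F(2)] by simp
qed

text \<open>If \<open>w b\<close> were 0, balance would force \<open>w a * Q a b = 0\<close>, so no
  jump from \<open>a\<close> to \<open>b\<close> could occur.\<close>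

lemma w_step: "0 < w a \<Longrightarrow> 0 < jump_prob Q a b \<Longrightarrow> 0 < w b"
  using jump_prob_pos[of a b] detailed_balance[of a b] w_nonneg[of b]
  by (cases "w b = 0") (auto simp: off_diag_pos_iff)

lemma AE_Y_support:
  assumes "0 < w x"
  shows "AE \<omega> in P x. \<forall>n. 0 < w (Y n \<omega>)"
  using AE_Y_0 AE_Y_step
proof eventually_elim
  case (elim \<omega>)
  have "0 < w (Y n \<omega>)" for n
    by (induction n) (use elim assms w_step in auto)
  then show ?case by blast
qed

lemma AE_X_support:
  assumes "0 < w x"
  shows "AE \<omega> in P x. \<forall>t\<ge>0. 0 < w (X t \<omega>)"
  using AE_Y_support[OF assms] nonexplosive AE_space
proof eventually_elim
  case (elim \<omega>)
  show ?case
  proof (intro allI impI)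
    fix t :: real assume "0 \<le> t"
    then show "0 < w (X t \<omega>)" using X_values[OF elim(3,2)] elim(1) by metis
  qed
qed

text \<open>The first return of the jump chain supplies one candidate in the infimum defining
  \<open>return_time\<close>; finiteness of the mean requires only this inequality.\<close>

lemma AE_return_time_le:
  assumes x: "0 < w x" "exit_rate Q x \<noteq> 0"
  shows "AE \<omega> in P x. return_time X x \<omega> \<le> excursion_length x \<omega>"
proof -
  have "AE \<omega> in P x. \<forall>i. 0 < S i \<omega>" using AE_S_pos by (subst AE_all_countable) auto
  moreover have "AE \<omega> in P x. excursion_length x \<omega> \<noteq> \<infinity>"
    using expected_excursion_length_finite[OF x] by (intro nn_integral_PInf_AE) auto
  ultimately show ?thesis
    using AE_returns[OF x(1)] AE_Y_0 AE_Y_step AE_S_finite AE_X_0 AE_space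
  proof eventually_elim
    case (elim \<omega>)
    note pos = elim(1) and fin = elim(2) and sp = elim(8)
    define k where "k = (LEAST n. 1 \<le> n \<and> Y n \<omega> = x)"
    have k: "1 \<le> k \<and> Y k \<omega> = x"
      unfolding k_def by (rule LeastI_ex) (use elim(3) in simp)
    have before: "Y i \<omega> \<noteq> x" if "1 \<le> i" "i < k" for i
      using not_less_Least[of i "\<lambda>n. 1 \<le> n \<and> Y n \<omega> = x"] that by (auto simp: k_def)
    have "(\<Sum>l<k. S l \<omega>) = (\<Sum>l<k. S l \<omega> * of_bool (\<forall>i\<in>{1..l}. Y i \<omega> \<noteq> x))"
      using before by (intro sum.cong) auto
    also have "\<dots> \<le> excursion_length x \<omega>"
      unfolding excursion_length_def by (rule sum_le_suminf) auto
    finally have le: "(\<Sum>l<k. S l \<omega>) \<le> excursion_length x \<omega>" .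
    with fin have sum_fin: "(\<Sum>l<k. S l \<omega>) \<noteq> \<infinity>" by (metis infinity_ennreal_def top_unique)
    have S0: "S 0 \<omega> \<noteq> \<infinity>" using elim(4,6) x by metis
    \<comment> \<open>The jump chain has no self-loop at a nonabsorbing state, so the exit occurs no
      later than the end of the first sojourn.\<close>
    have "0 < jump_prob Q x (Y 1 \<omega>)" using elim(4,5) by (metis One_nat_def)
    then have Y1: "Y 1 \<omega> \<noteq> x" using jump_prob_pos[of x "Y 1 \<omega>"] x by (auto simp: off_diag_pos_iff)
    have "X (enn2real (S 0 \<omega>)) \<omega> = Y 1 \<omega>"
      using X_at_jump_time[OF sp, of 1] S0 pos by simp
    then have "exit_time X \<omega> \<le> ennreal (enn2real (S 0 \<omega>))"
      unfolding exit_time_def using Y1 elim(7) by (intro INF_lower) auto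
    also have "\<dots> = S 0 \<omega>" using S0 by (simp add: less_top)
    also have "\<dots> = (\<Sum>l<1. S l \<omega>)" by simp
    also have "\<dots> \<le> (\<Sum>l<k. S l \<omega>)" using k by (intro sum_mono2) auto
    also have "\<dots> = ennreal (enn2real (\<Sum>l<k. S l \<omega>))" using sum_fin by (simp add: less_top)
    finally have "return_time X x \<omega> \<le> ennreal (enn2real (\<Sum>l<k. S l \<omega>))"
      unfolding return_time_def using X_at_jump_time[OF sp sum_fin] pos k by (intro INF_lower) auto
    also have "\<dots> = (\<Sum>l<k. S l \<omega>)" using sum_fin by (simp add: less_top)
    also note le
    finally show ?case .
  qed
qed

lemma positive_recurrent_support: "positive_recurrent P X {x. 0 < w x}"
  unfolding positive_recurrent_def
proof (intro conjI ballI allI)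
  show "{x. 0 < w x} \<noteq> {}"
  proof
    assume E: "{x. 0 < w x} = {}"
    have "w x = 0" for x
    proof -
      have "\<not> 0 < w x" using E by blast
      with w_nonneg[of x] show ?thesis by simp
    qed
    then have "w = (\<lambda>_. 0)" by auto
    then show False using w_has_sum has_sum_unique[OF _ has_sum_0] by force
  qed
next
  fix x assume "x \<in> {x. 0 < w x}"
  then show "AE \<omega> in P x. \<forall>t\<ge>0. X t \<omega> \<in> {x. 0 < w x}"
    using AE_X_support[of x] by simp
next
  fix x assume "x \<in> {x. 0 < w x}"
  then have x: "0 < w x" by simp
  show "positive_recurrent_state P X x"
  proof (cases "exit_rate Q x = 0")
    case True
    have "AE \<omega> in P x. \<forall>t\<ge>0. X t \<omega> = x"
      using AE_Y_0 AE_Y_step nonexplosive AE_space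
    proof eventually_elim
      case (elim \<omega>)
      have "Y k \<omega> = x" for k
        using absorbed[OF elim(2), of 0 k] elim(1) True by simp
      then show ?case using X_values[OF elim(4,3)] by force
    qed
    then show ?thesis by (simp add: positive_recurrent_state_def)
  next
    case False
    have "(\<integral>\<^sup>+\<omega>. return_time X x \<omega> \<partial>P x) \<le> (\<integral>\<^sup>+\<omega>. excursion_length x \<omega> \<partial>P x)"
      by (rule nn_integral_mono_AE[OF AE_return_time_le[OF x False]])
    also have "\<dots> < \<infinity>" by (rule expected_excursion_length_finite[OF x False])
    finally show ?thesis by (simp add: positive_recurrent_state_def)
  qed
next
  fix x y assume "y \<in> {x. 0 < w x}"
  then show "AE \<omega> in P x. \<exists>t\<ge>0. X t \<omega> = y"
    by (intro AE_X_hits avoid_prob_eq_0) simp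
qed

lemma stationary_w: "stationary_distribution P X w"
  unfolding stationary_distribution_def
proof (intro conjI allI impI)
  fix t :: real and y assume t: "0 \<le> t"
  \<comment> \<open>Reversal on the interval from 0 to \<open>t\<close> exchanges the observation
    time \<open>t\<close> with \<open>t - t = 0\<close>, at which the law is
    \<open>w\<close>.\<close>
  have "joint_prob P X w 1 (\<lambda>_. t) (\<lambda>_. y) = joint_prob P X w 1 (\<lambda>i. t - t) (\<lambda>_. y)"
    by (rule reversible[unfolded reversible_def, rule_format]) (use t in simp)
  also have "\<dots> = (\<Sum>\<^sub>\<infinity>x. w x * of_bool (x = y))"
    unfolding joint_prob_def
  proof (intro infsum_cong arg_cong2[where f = "(*)"] refl)
    fix x
    interpret prob_space "P x" by (rule prob_space_P)
    have [measurable]: "X 0 \<in> measurable (P x) (count_space UNIV)" by (rule measurable_X) simp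
    have "prob {\<omega>\<in>space (P x). X 0 \<omega> = y} = of_bool (x = y)"
    proof (cases "x = y")
      case True
      have "AE \<omega> in P x. X 0 \<omega> = y" using AE_X_0[of x] True by simp
      then have "prob {\<omega>\<in>space (P x). X 0 \<omega> = y} = 1" by (subst prob_Collect_eq_1) simp_all
      then show ?thesis using True by simp
    next
      case False
      have "AE \<omega> in P x. X 0 \<omega> \<noteq> y" using AE_X_0[of x] by eventually_elim (use False in simp)
      then have "prob {\<omega>\<in>space (P x). X 0 \<omega> = y} = 0" by (subst prob_Collect_eq_0) simp_all
      then show ?thesis using False by simp
    qed
    then show "prob {\<omega>\<in>space (P x). \<forall>i<1::nat. X (t - t) \<omega> = y} = of_bool (x = y)" by simp
  qed
  also have "\<dots> = (\<Sum>\<^sub>\<infinity>x\<in>{y}. w x)"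
    by (rule infsum_cong_neutral) auto
  finally show "(\<Sum>\<^sub>\<infinity>x. w x * measure (P x) {\<omega> \<in> space (P x). X t \<omega> = y}) = w y"
    by (simp add: joint_prob_def)
qed (use w_nonneg w_has_sum in auto)

section \<open>Uniqueness of the stationary distribution\<close>

lemma stationary_unique:
  assumes p: "stationary_distribution P X p"
  shows "p = w"
proof (rule ccontr)
  assume "p \<noteq> w"
  \<comment> \<open>The difference of two distributions has total mass 0, so if it had only one sign
    it would vanish.\<close>
  have ex_less: "\<exists>x. r x < r' x"
    if "stationary_distribution P X r" "stationary_distribution P X r'" "r \<noteq> r'" for r r'
  proof (rule ccontr)
    assume "\<not> ?thesis"
    then have le: "0 \<le> r x - r' x" for x by (simp add: not_less)
    have "((\<lambda>x. r x - r' x) has_sum (1 - 1)) UNIV"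
      unfolding diff_conv_add_uminus using that
      by (intro has_sum_add) (auto simp: stationary_distribution_def has_sum_uminus)
    then have "r x - r' x = 0" for x
      by (rule nonneg_has_sum_le_0D) (use le in auto)
    then show False using that(3) by (auto simp: fun_eq_iff)
  qed
  obtain y where y: "0 < w y" using positive_recurrent_support by (auto simp: positive_recurrent_def)
  have "r' y < r y" if r: "stationary_distribution P X r" "stationary_distribution P X r'" and ne: "r \<noteq> r'" for r r'
  proof -
    obtain x where x: "r' x < r x" using ex_less[OF r(2,1)] ne by auto
    obtain t where t: "0 \<le> t" "0 < measure (P x) {\<omega>\<in>space (P x). X t \<omega> = y}"
      using ex_positive_transition[OF avoid_prob_eq_0[OF y]] by blast
    interpret prob_space "P x" by (rule prob_space_P)
    have "0 < ennreal (r x - r' x) * emeasure (P x) {\<omega>\<in>space (P x). X t \<omega> = y}"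
      using x t by (simp add: emeasure_eq_measure ennreal_mult[symmetric])
    also have "\<dots> \<le> ennreal (r y - r' y)"
      using r t(1) by (intro stationary_positive_part prob_space_P measurable_X)
    finally show ?thesis by simp
  qed
  from this[OF p stationary_w] this[OF stationary_w p] \<open>p \<noteq> w\<close> show False by auto
qed

end

section \<open>The network\<close>

lemma has_sum_prod_UNIV:
  fixes f :: "'a::finite \<Rightarrow> nat \<Rightarrow> real"
  assumes "\<And>q m. 0 \<le> f q m" "\<And>q. (f q has_sum s q) UNIV"
  shows "((\<lambda>n. \<Prod>q\<in>UNIV. f q (n q)) has_sum (\<Prod>q\<in>UNIV. s q)) UNIV"
proof -
  have "f q summable_on UNIV" for q using assms(2) by (auto simp: summable_on_def)
  then have abs: "Infinite_Sum.abs_summable_on (f q) UNIV" for q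
    using summable_on_iff_abs_summable_on_real by blast
  have P: "PiE UNIV (\<lambda>_. UNIV) = (UNIV :: ('a \<Rightarrow> nat) set)" by auto
  have "Infinite_Set_Sum.abs_summable_on (\<lambda>n. \<Prod>q\<in>UNIV. f q (n q)) (PiE UNIV (\<lambda>_. UNIV))"
    by (rule abs_summable_on_prod_PiE) (use abs in \<open>auto simp only: abs_summable_equivalent[symmetric] finite\<close>)
  then have "(\<lambda>n. \<Prod>q\<in>UNIV. f q (n q)) summable_on UNIV"
    unfolding P abs_summable_equivalent[symmetric] by (rule abs_summable_summable)
  moreover have "infsum (\<lambda>n. \<Prod>q\<in>UNIV. f q (n q)) (PiE UNIV (\<lambda>_. UNIV)) = (\<Prod>q\<in>UNIV. infsum (f q) UNIV)"
    by (rule infsum_prod_PiE_abs) (use abs in auto)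
  moreover have "infsum (f q) UNIV = s q" for q using assms(2) by (rule infsumI)
  ultimately show ?thesis unfolding P by (simp add: has_sum_iff)
qed

text \<open>\<open>gam_bar_pos\<close> is tied to the existence of a second site because its
  reciprocal occurs only in moves of the customer. With a single site \<open>gam\<close> may vanish
  and truncate the number of tasks.\<close>

locale loaded_network =
  fixes lam mu :: "'a::finite \<Rightarrow> nat \<Rightarrow> 'a \<Rightarrow> real"
    and gam :: "'a \<Rightarrow> nat \<Rightarrow> real"
    and beta theta :: "'a \<Rightarrow> 'a \<Rightarrow> nat \<Rightarrow> nat \<Rightarrow> 'a \<Rightarrow> real"
    and tau :: "'a \<Rightarrow> 'a \<Rightarrow> ('a \<Rightarrow> nat) \<Rightarrow> real"
  assumes lam_nonneg: "0 \<le> lam i n j"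
    and mu_bounded_below: "\<exists>c>0. \<forall>i n j. 1 \<le> n \<longrightarrow> c \<le> mu i n j"
    and lam_support: "0 < lam i (n + 1) j \<Longrightarrow> 0 < lam i n j"
    and gam_nonneg: "0 \<le> gam i n"
    and gam_support: "0 < gam i (n + 1) \<Longrightarrow> 0 < gam i n"
    and gam_bar_pos: "j' \<noteq> j \<Longrightarrow> 0 < gam_bar gam j n"
    and beta_pos: "i \<noteq> k \<Longrightarrow> 0 < beta i k a b j"
    and theta_pos: "i \<noteq> k \<Longrightarrow> 0 < theta i k a b j"
    and tau_pos: "i \<noteq> k \<Longrightarrow> 0 < tau i k v"
    and beta_balance: "i \<noteq> k \<Longrightarrow> 1 \<le> a \<Longrightarrow>
      lam i (a - 1) j / mu i a j * beta i k a b j =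
      lam k b j / mu k (b + 1) j * beta k i (b + 1) (a - 1) j"
    and theta_balance: "i \<noteq> k \<Longrightarrow> 1 \<le> a \<Longrightarrow>
      lam i (a - 1) j / mu i a j * theta i k a b j =
      lam k b j / mu k (b + 1) j * theta k i (b + 1) (a - 1) j"
    and tau_balance: "i \<noteq> k \<Longrightarrow>
      tau i k v * (\<Prod>q\<in>UNIV. lam_bar lam q (v q) i / mu_bar mu q (v q) i) =
      tau k i v * (\<Prod>q\<in>UNIV. lam_bar lam q (v q) k / mu_bar mu q (v q) k)"
    and U_finite: "i \<noteq> j \<Longrightarrow> summable (\<lambda>n. lam_bar lam i n j / mu_bar mu i n j)"
    and L_finite: "summable (\<lambda>n. lam_bar lam j n j * gam_bar gam j n / mu_bar mu j n j)"
begin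

abbreviation "G \<equiv> generator lam mu gam beta theta tau"
abbreviation "R \<equiv> rate lam mu gam beta theta tau"

definition ratio :: "'a \<Rightarrow> nat \<Rightarrow> 'a \<Rightarrow> real" where
  "ratio i n j = lam_bar lam i n j / mu_bar mu i n j"

definition weight :: "'a \<Rightarrow> ('a \<Rightarrow> nat) \<Rightarrow> real" where
  "weight j n = gam_bar gam j (n j) * (\<Prod>q\<in>UNIV. ratio q (n q) j)"

definition arrival :: "'a \<Rightarrow> 'a \<Rightarrow> ('a \<Rightarrow> nat) \<Rightarrow> real" where
  "arrival j k n = (if k = j then lam j (n j) j * gam j (n j) else lam k (n k) j)"

definition migration :: "'a \<Rightarrow> 'a \<Rightarrow> 'a \<Rightarrow> ('a \<Rightarrow> nat) \<Rightarrow> real" where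
  "migration j k l n = (if k = j then theta j l (n j) (n l) j
     else if l = j then theta k j (n k) (n j) j * gam j (n j)
     else beta k l (n k) (n l) j)"

section \<open>Birth-and-death ratios and product weights\<close>

lemma mu_pos: "1 \<le> n \<Longrightarrow> 0 < mu i n j"
  using mu_bounded_below by (meson less_le_trans)

lemma mu_bar_pos: "0 < mu_bar mu i n j"
  unfolding mu_bar_def by (intro prod_pos) (simp add: mu_pos)

lemma lam_bar_nonneg: "0 \<le> lam_bar lam i n j"
  unfolding lam_bar_def by (intro prod_nonneg) (simp add: lam_nonneg)

lemma gam_bar_nonneg: "0 \<le> gam_bar gam i n"
  unfolding gam_bar_def by (intro prod_nonneg) (simp add: gam_nonneg)

lemma gam_bar_Suc: "gam_bar gam i (Suc n) = gam_bar gam i n * gam i n"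
  by (simp add: gam_bar_def)

lemma ratio_nonneg: "0 \<le> ratio i n j"
  using lam_bar_nonneg mu_bar_pos by (simp add: ratio_def less_imp_le)

lemma ratio_0: "ratio i 0 j = 1"
  by (simp add: ratio_def lam_bar_def mu_bar_def)

lemma ratio_Suc: "ratio i (Suc n) j = ratio i n j * (lam i n j / mu i (Suc n) j)"
  by (simp add: ratio_def lam_bar_def mu_bar_def)

lemma ratio_eq_0_iff: "ratio i n j = 0 \<longleftrightarrow> lam_bar lam i n j = 0"
  using mu_bar_pos[of i n j] by (simp add: ratio_def)

lemma weight_nonneg: "0 \<le> weight j n"
  unfolding weight_def by (intro mult_nonneg_nonneg gam_bar_nonneg prod_nonneg ballI ratio_nonneg)

lemma prod_ratio_remove:
  "(\<Prod>q\<in>UNIV. ratio q (n q) j) = ratio k (n k) j * (\<Prod>q\<in>UNIV - {k}. ratio q (n q) j)"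
  by (rule prod.remove) auto

lemma prod_ratio_upd:
  "(\<Prod>q\<in>UNIV. ratio q ((n(k := m)) q) j) = ratio k m j * (\<Prod>q\<in>UNIV - {k}. ratio q (n q) j)"
proof -
  have "(\<Prod>q\<in>UNIV - {k}. ratio q ((n(k := m)) q) j) = (\<Prod>q\<in>UNIV - {k}. ratio q (n q) j)"
    by (intro prod.cong) auto
  then show ?thesis by (simp add: prod_ratio_remove[of _ _ k])
qed

text \<open>A new task multiplies the ratio by \<open>lam / mu\<close>; at the loaded site
  \<open>gam_bar\<close> gains exactly the factor \<open>gam\<close> by which the arrival intensity
  is modified.\<close>

lemma arrival_balance:
  "weight j n * arrival j k n = weight j (n(k := Suc (n k))) * mu k (Suc (n k)) j"
proof -
  have "0 < mu k (Suc (n k)) j" by (rule mu_pos) simp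
  then show ?thesis
    unfolding weight_def prod_ratio_upd prod_ratio_remove[of n j k] ratio_Suc
    by (cases "k = j") (simp_all add: arrival_def gam_bar_Suc)
qed

text \<open>Both configurations share the product \<open>c\<close> belonging to the configuration
  without the moving task. Putting the task back at \<open>k\<close> or at \<open>l\<close>
  contributes \<open>lam / mu\<close> of that site, and the balance hypotheses compare precisely
  these factors.\<close>

lemma migration_balance:
  assumes kl: "k \<noteq> l" and k: "1 \<le> n k"
  shows "weight j n * migration j k l n =
    weight j (n(k := n k - 1, l := n l + 1)) * migration j l k (n(k := n k - 1, l := n l + 1))"
proof -
  obtain a where a: "n k = Suc a" using k by (cases "n k") auto
  let ?n = "n(k := n k - 1, l := n l + 1)" and ?b = "n l"
  define rest where "rest = (\<Prod>q\<in>UNIV - {l} - {k}. ratio q (n q) j)"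
  define c where "c = ratio k a j * ratio l ?b j * rest"
  have r1: "(\<Prod>q\<in>UNIV. ratio q (n q) j) = c * (lam k a j / mu k (Suc a) j)"
  proof -
    have "(\<Prod>q\<in>UNIV - {l}. ratio q (n q) j) = ratio k (n k) j * rest"
      unfolding rest_def using kl by (intro prod.remove) auto
    then show ?thesis by (simp add: prod_ratio_remove[of n j l] a ratio_Suc c_def)
  qed
  have r2: "(\<Prod>q\<in>UNIV. ratio q (?n q) j) = c * (lam l ?b j / mu l (Suc ?b) j)"
  proof -
    have "(\<Prod>q\<in>UNIV - {l}. ratio q ((n(k := n k - 1)) q) j) = ratio k a j * (\<Prod>q\<in>UNIV - {l} - {k}. ratio q ((n(k := n k - 1)) q) j)"
      using kl a by (subst prod.remove[of _ k]) auto
    also have "(\<Prod>q\<in>UNIV - {l} - {k}. ratio q ((n(k := n k - 1)) q) j) = rest"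
      unfolding rest_def by (intro prod.cong) auto
    finally have e: "(\<Prod>q\<in>UNIV - {l}. ratio q ((n(k := n k - 1)) q) j) = ratio k a j * rest" .
    show ?thesis unfolding prod_ratio_upd e by (simp add: ratio_Suc c_def)
  qed
  consider "k = j" | "l = j" "k \<noteq> j" | "k \<noteq> j" "l \<noteq> j" by blast
  then show ?thesis
  proof cases
    case 1
    \<comment> \<open>The weight of the source contains one more factor \<open>gam j a\<close> than
      that of the target; the opposite migration into \<open>j\<close> supplies it.\<close>
    have "lam j a j / mu j (Suc a) j * theta j l (Suc a) ?b j = lam l ?b j / mu l (Suc ?b) j * theta l j (Suc ?b) a j"
      using theta_balance[of j l "Suc a" j ?b] kl 1 by simp
    then have "c * gam_bar gam j a * gam j a * (lam j a j / mu j (Suc a) j * theta j l (Suc a) ?b j) =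
      c * gam_bar gam j a * gam j a * (lam l ?b j / mu l (Suc ?b) j * theta l j (Suc ?b) a j)" by simp
    then show ?thesis
      unfolding weight_def r1 r2 using 1 kl a by (simp add: migration_def gam_bar_Suc mult.assoc mult.left_commute)
  next
    case 2
    have "lam k a j / mu k (Suc a) j * theta k j (Suc a) ?b j = lam j ?b j / mu j (Suc ?b) j * theta j k (Suc ?b) a j"
      using theta_balance[of k j "Suc a" j ?b] kl 2 by simp
    then have "c * gam_bar gam j ?b * gam j ?b * (lam k a j / mu k (Suc a) j * theta k j (Suc a) ?b j) =
      c * gam_bar gam j ?b * gam j ?b * (lam j ?b j / mu j (Suc ?b) j * theta j k (Suc ?b) a j)" by simp
    then show ?thesis
      unfolding weight_def r1 r2 using 2 kl a by (simp add: migration_def gam_bar_Suc mult_ac)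
  next
    case 3
    have "lam k a j / mu k (Suc a) j * beta k l (Suc a) ?b j = lam l ?b j / mu l (Suc ?b) j * beta l k (Suc ?b) a j"
      using beta_balance[of k l "Suc a" j ?b] kl by simp
    then have "c * gam_bar gam j (n j) * (lam k a j / mu k (Suc a) j * beta k l (Suc a) ?b j) =
      c * gam_bar gam j (n j) * (lam l ?b j / mu l (Suc ?b) j * beta l k (Suc ?b) a j)" by simp
    then show ?thesis
      unfolding weight_def r1 r2 using 3 kl a by (simp add: migration_def mult.assoc mult.left_commute)
  qed
qed

section \<open>Detailed balance for the full rate matrix\<close>

definition arrivals :: "'a \<Rightarrow> ('a \<Rightarrow> nat) \<Rightarrow> ('a \<Rightarrow> nat) \<Rightarrow> real" where
  "arrivals j n n' = (\<Sum>k\<in>UNIV. if n' = n(k := n k + 1) then arrival j k n else 0)"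

definition departures :: "'a \<Rightarrow> ('a \<Rightarrow> nat) \<Rightarrow> ('a \<Rightarrow> nat) \<Rightarrow> real" where
  "departures j n n' = (\<Sum>k\<in>UNIV. if n k \<ge> 1 \<and> n' = n(k := n k - 1) then mu k (n k) j else 0)"

definition migrations :: "'a \<Rightarrow> ('a \<Rightarrow> nat) \<Rightarrow> ('a \<Rightarrow> nat) \<Rightarrow> real" where
  "migrations j n n' = (\<Sum>k\<in>UNIV. \<Sum>l\<in>UNIV - {k}.
     if n k \<ge> 1 \<and> n' = n(k := n k - 1, l := n l + 1) then migration j k l n else 0)"

lemma rate_same: "R (j, n) (j, n') = arrivals j n n' + departures j n n' + migrations j n n'"
  by (simp only: rate_def prod.case arrivals_def departures_def migrations_def arrival_def migration_def
      simp_thms if_False not_True_eq_False)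

lemma rate_diff: "j' \<noteq> j \<Longrightarrow> R (j, n) (j', n') = (if n' = n then inverse (gam_bar gam j (n j)) * tau j j' n else 0)"
  by (simp add: rate_def)

lemma arrival_nonneg: "0 \<le> arrival j k n"
  by (simp add: arrival_def lam_nonneg gam_nonneg)

lemma migration_nonneg: "k \<noteq> l \<Longrightarrow> 0 \<le> migration j k l n"
  by (auto simp: migration_def gam_nonneg less_imp_le[OF theta_pos] less_imp_le[OF beta_pos])

lemma arrivals_nonneg: "0 \<le> arrivals j n n'"
  unfolding arrivals_def by (intro sum_nonneg) (simp add: arrival_nonneg)

lemma departures_nonneg: "0 \<le> departures j n n'"
  unfolding departures_def by (intro sum_nonneg) (simp add: less_imp_le[OF mu_pos])

lemma migrations_nonneg: "0 \<le> migrations j n n'"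
  unfolding migrations_def by (intro sum_nonneg) (simp add: migration_nonneg)

lemma rate_nonneg: "0 \<le> R x y"
proof (cases x; cases y)
  fix j n j' n' assume xy: "x = (j, n)" "y = (j', n')"
  show ?thesis
  proof (cases "j' = j")
    case True
    then show ?thesis unfolding xy
      by (simp add: rate_same arrivals_nonneg departures_nonneg migrations_nonneg)
  next
    case False
    then show ?thesis unfolding xy rate_diff[OF False]
      using gam_bar_nonneg[of j "n j"] tau_pos[of j j' n] by simp
  qed
qed

text \<open>The terms match site by site; exchanging \<open>n\<close> and \<open>n'\<close> yields
  the balance of the departures from \<open>n\<close> as well.\<close>

lemma arrivals_departures_balance: "weight j n * arrivals j n n' = weight j n' * departures j n' n"
  unfolding arrivals_def departures_def sum_distrib_left
proof (intro sum.cong refl)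
  fix k
  show "weight j n * (if n' = n(k := n k + 1) then arrival j k n else 0) =
    weight j n' * (if n' k \<ge> 1 \<and> n = n'(k := n' k - 1) then mu k (n' k) j else 0)"
  proof (cases "n' = n(k := n k + 1)")
    case True
    then show ?thesis using arrival_balance[of j n k] by simp
  next
    case False
    then have "\<not> (n' k \<ge> 1 \<and> n = n'(k := n' k - 1))" by auto
    with False show ?thesis by (simp only: if_False mult_zero_right)
  qed
qed

text \<open>A move from \<open>k\<close> to \<open>l\<close> is undone by one from \<open>l\<close>
  to \<open>k\<close>, so the double sums match after exchanging the summation indices.\<close>

lemma migrations_balance: "weight j n * migrations j n n' = weight j n' * migrations j n' n"
proof -
  \<comment> \<open>The condition \<open>k \<noteq> l\<close> is moved from the range into the
    summand, so that both indices run over all sites and the sums can be swapped.\<close>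
  let ?t = "\<lambda>n n' k l. if k \<noteq> l \<and> n k \<ge> 1 \<and> n' = n(k := n k - 1, l := n l + 1) then migration j k l n else 0"
  have eq: "migrations j n n' = (\<Sum>k\<in>UNIV. \<Sum>l\<in>UNIV. ?t n n' k l)" for n n'
    unfolding migrations_def by (intro sum.cong sum.mono_neutral_cong_left refl) auto
  have "weight j n * ?t n n' k l = weight j n' * ?t n' n l k" for k l
  proof (cases "k \<noteq> l \<and> n k \<ge> 1 \<and> n' = n(k := n k - 1, l := n l + 1)")
    case True
    then have "l \<noteq> k \<and> n' l \<ge> 1 \<and> n = n'(l := n' l - 1, k := n' k + 1)"
      by (auto simp: fun_eq_iff)
    then show ?thesis using True migration_balance[of k l n j] by simp
  next
    case False
    have "\<not> (l \<noteq> k \<and> n' l \<ge> 1 \<and> n = n'(l := n' l - 1, k := n' k + 1))"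
    proof
      assume "l \<noteq> k \<and> n' l \<ge> 1 \<and> n = n'(l := n' l - 1, k := n' k + 1)"
      then have "k \<noteq> l \<and> n k \<ge> 1 \<and> n' = n(k := n k - 1, l := n l + 1)"
        by (auto simp: fun_eq_iff)
      with False show False by blast
    qed
    with False show ?thesis by (simp only: if_False mult_zero_right)
  qed
  then have "weight j n * migrations j n n' = (\<Sum>k\<in>UNIV. \<Sum>l\<in>UNIV. weight j n' * ?t n' n l k)"
    unfolding eq sum_distrib_left by (intro sum.cong refl)
  also have "\<dots> = (\<Sum>l\<in>UNIV. \<Sum>k\<in>UNIV. weight j n' * ?t n' n l k)"
    by (rule sum.swap)
  finally show ?thesis unfolding eq sum_distrib_left .
qed

lemma rate_balance: "weight j n * R (j, n) (j', n') = weight j' n' * R (j', n') (j, n)"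
proof (cases "j' = j")
  case True
  then show ?thesis
    using arrivals_departures_balance[of j n n'] arrivals_departures_balance[of j n' n] migrations_balance[of j n n']
    by (simp add: rate_same distrib_left)
next
  case False
  show ?thesis
  proof (cases "n' = n")
    case True
    \<comment> \<open>Each weight cancels the reciprocal of \<open>gam_bar\<close> in its rate, and
      \<open>tau_balance\<close> is what remains. Positivity is available because \<open>j\<close>
      and \<open>j'\<close> are distinct sites.\<close>
    have "0 < gam_bar gam j (n j)" "0 < gam_bar gam j' (n j')"
      using gam_bar_pos[of j' j "n j"] gam_bar_pos[of j j' "n j'"] False by auto
    then show ?thesis
      using tau_balance[of j j' n] False True
      by (simp add: rate_diff[OF False] rate_diff[OF False[symmetric]] weight_def ratio_def mult.commute field_simps)
  next
    case n: False
    then show ?thesis using False by (simp add: rate_diff)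
  qed
qed

text \<open>Ensures that the infinite sum on the diagonal of \<open>generator\<close> converges and
  is not the default value 0.\<close>

lemma finite_rate_support: "finite {y. R x y \<noteq> 0}"
proof (cases x)
  case (Pair j n)
  let ?A = "(\<lambda>j'. (j', n)) ` UNIV \<union> (\<lambda>k. (j, n(k := n k + 1))) ` UNIV \<union> (\<lambda>k. (j, n(k := n k - 1))) ` UNIV \<union>
    (\<lambda>(k, l). (j, n(k := n k - 1, l := n l + 1))) ` UNIV"
  have "R x y = 0" if "y \<notin> ?A" for y
  proof (cases y)
    case y: (Pair j' n')
    show ?thesis
    proof (cases "j' = j")
      case True
      have "arrivals j n n' = 0" unfolding arrivals_def
        by (rule sum.neutral) (use that y True in auto)
      moreover have "departures j n n' = 0" unfolding departures_def
        by (rule sum.neutral) (use that y True in auto)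
      moreover have "migrations j n n' = 0" unfolding migrations_def
        by (intro sum.neutral ballI) (use that y True in \<open>auto simp: image_iff\<close>)
      ultimately show ?thesis using Pair y True by (simp add: rate_same)
    next
      case False
      then show ?thesis using that Pair y by (auto simp: rate_diff)
    qed
  qed
  then have "{y. R x y \<noteq> 0} \<subseteq> ?A" by blast
  then show ?thesis by (rule finite_subset) simp
qed

lemma generator_eq_rate: "y \<noteq> x \<Longrightarrow> G x y = R x y"
  by (simp add: generator_def)

sublocale generator_matrix G
proof
  fix x y :: "'a state" assume "x \<noteq> y"
  then show "0 \<le> G x y" using rate_nonneg by (simp add: generator_def)
next
  fix x :: "'a state"
  have "R x summable_on (UNIV - {x})"
    using finite_rate_support[of x] by (intro finite_nonzero_values_imp_summable_on) (auto elim: finite_subset[rotated])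
  then have "(R x has_sum (\<Sum>\<^sub>\<infinity>z\<in>UNIV - {x}. R x z)) (UNIV - {x})" by (rule has_sum_infsum)
  also have "(\<Sum>\<^sub>\<infinity>z\<in>UNIV - {x}. R x z) = exit_rate G x"
    by (simp add: exit_rate_def generator_def)
  finally show "(G x has_sum exit_rate G x) (UNIV - {x})"
    by (subst has_sum_cong[where g = "R x"]) (auto simp: generator_eq_rate)
qed

section \<open>Accessibility of the support\<close>

lemma arrivals_ge: "arrival j k n \<le> arrivals j n (n(k := n k + 1))"
proof -
  have "(if n(k := n k + 1) = n(k := n k + 1) then arrival j k n else 0) \<le> arrivals j n (n(k := n k + 1))"
    unfolding arrivals_def by (rule member_le_sum) (auto simp: arrival_nonneg)
  then show ?thesis by simp
qed

lemma departures_pos: "1 \<le> n k \<Longrightarrow> 0 < departures j n (n(k := n k - 1))"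
proof -
  assume k: "1 \<le> n k"
  have "(if n k \<ge> 1 \<and> n(k := n k - 1) = n(k := n k - 1) then mu k (n k) j else 0) \<le> departures j n (n(k := n k - 1))"
    unfolding departures_def by (rule member_le_sum) (auto simp: less_imp_le[OF mu_pos])
  then show ?thesis using k mu_pos[OF k, of k j] by simp
qed

abbreviation "E \<equiv> {(a, b). a \<noteq> b \<and> 0 < G a b}"

lemma edgeI: "a \<noteq> b \<Longrightarrow> 0 < R a b \<Longrightarrow> (a, b) \<in> E"
  by (simp add: generator_eq_rate)

lemma departure_edge: "1 \<le> n k \<Longrightarrow> ((j, n), (j, n(k := n k - 1))) \<in> E"
proof (rule edgeI)
  assume k: "1 \<le> n k"
  show "(j, n) \<noteq> (j, n(k := n k - 1))" using k by (auto simp: fun_eq_iff intro!: exI[of _ k])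
  show "0 < R (j, n) (j, n(k := n k - 1))"
    using departures_pos[of n k j] arrivals_nonneg[of j n] migrations_nonneg[of j n] k
    by (simp add: rate_same add_pos_nonneg add_nonneg_pos)
qed

lemma arrival_edge: "0 < arrival j k n \<Longrightarrow> ((j, n), (j, n(k := n k + 1))) \<in> E"
proof (rule edgeI)
  assume k: "0 < arrival j k n"
  show "(j, n) \<noteq> (j, n(k := n k + 1))" by (auto simp: fun_eq_iff intro!: exI[of _ k])
  have "0 < arrivals j n (n(k := n k + 1))" using k arrivals_ge by (rule less_le_trans)
  then show "0 < R (j, n) (j, n(k := n k + 1))"
    using departures_nonneg[of j n] migrations_nonneg[of j n]
    by (simp add: rate_same add_pos_nonneg)
qed

lemma sum_upd: "(\<Sum>q\<in>UNIV. (n(k := m)) q) + n k = (\<Sum>q\<in>UNIV. n q) + (m :: nat)" for n :: "'a \<Rightarrow> nat"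
proof -
  have "(\<Sum>q\<in>UNIV - {k}. (n(k := m)) q) = (\<Sum>q\<in>UNIV - {k}. n q)" by (intro sum.cong) auto
  then show ?thesis by (simp add: sum.remove[of UNIV k])
qed

lemma reach_empty: "((j, n), (j, \<lambda>_. 0)) \<in> E\<^sup>*"
proof (induction "\<Sum>q\<in>UNIV. n q" arbitrary: n rule: less_induct)
  case less
  show ?case
  proof (cases "n = (\<lambda>_. 0)")
    case False
    then obtain k where k: "1 \<le> n k" by (auto simp: fun_eq_iff Suc_le_eq)
    have "(\<Sum>q\<in>UNIV. (n(k := n k - 1)) q) < (\<Sum>q\<in>UNIV. n q)"
      using sum_upd[of n k "n k - 1"] k by simp
    from less.hyps[OF this] departure_edge[of n k j, OF k] show ?thesis
      by (rule converse_rtrancl_into_rtrancl[rotated])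
  qed simp
qed

text \<open>Tasks are taken away one at a time. By \<open>arrival_balance\<close> the positive
  number \<open>weight j n * mu k (n k) j\<close> factors into the smaller weight and the arrival
  intensity leading back, so both are positive.\<close>

lemma reach_from_empty: "0 < weight j n \<Longrightarrow> ((j, \<lambda>_. 0), (j, n)) \<in> E\<^sup>*"
proof (induction "\<Sum>q\<in>UNIV. n q" arbitrary: n rule: less_induct)
  case less
  show ?case
  proof (cases "n = (\<lambda>_. 0)")
    case False
    then obtain k where k: "1 \<le> n k" by (auto simp: fun_eq_iff Suc_le_eq)
    let ?n = "n(k := n k - 1)"
    have n: "?n(k := ?n k + 1) = n" using k by auto
    have "weight j ?n * arrival j k ?n = weight j n * mu k (n k) j"
      using arrival_balance[of j ?n k] n k by simp
    also have "\<dots> > 0" using less.prems mu_pos[OF k] by simp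
    finally have pos: "0 < weight j ?n" "0 < arrival j k ?n"
      using weight_nonneg[of j ?n] arrival_nonneg[of j k ?n] by (auto simp: zero_less_mult_iff)
    have "(\<Sum>q\<in>UNIV. ?n q) < (\<Sum>q\<in>UNIV. n q)"
      using sum_upd[of n k "n k - 1"] k by simp
    from less.hyps[OF this pos(1)] arrival_edge[OF pos(2)] show ?thesis
      unfolding n by (rule rtrancl_into_rtrancl)
  qed simp
qed

text \<open>The route goes through the empty network, where the customer moves from \<open>j\<close>
  to \<open>j'\<close> at a positive rate if the sites differ.\<close>

lemma reach_weight_pos:
  assumes "0 < weight j' n'"
  shows "((j, n), (j', n')) \<in> E\<^sup>*"
proof -
  have "((j, \<lambda>_. 0), (j', \<lambda>_. 0)) \<in> E\<^sup>*"
  proof (cases "j' = j")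
    case False
    then have "0 < inverse (gam_bar gam j 0) * tau j j' (\<lambda>_. 0)"
      using gam_bar_pos[of j' j 0] tau_pos[of j j' "\<lambda>_. 0"] by simp
    then have "((j, \<lambda>_. 0), (j', \<lambda>_. 0)) \<in> E"
      using False by (intro edgeI) (auto simp: rate_diff)
    then show ?thesis by (rule r_into_rtrancl)
  qed simp
  then show ?thesis
    using reach_empty[of j n] reach_from_empty[OF assms] by (meson rtrancl_trans)
qed

text \<open>
  With at least two sites the balance conditions spread the vanishing of one arrival intensity to all
  of them, because \<open>beta\<close> and \<open>tau\<close> are strictly positive off the diagonal.
\<close>

lemma lam_eq_0_all:
  assumes "lam i m j = 0" "k \<noteq> i"
  shows "lam i' m' j' = 0"
proof -
  have other: "lam k b j = 0" if "lam i m j = 0" "i \<noteq> k" for i k m b j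
  proof -
    have "lam k b j / mu k (b + 1) j * beta k i (b + 1) m j = 0"
      using beta_balance[of i k "m + 1" j b] that by simp
    moreover have "0 < mu k (b + 1) j" by (rule mu_pos) simp
    ultimately show ?thesis using beta_pos[of k i "b + 1" m j] that(2) by auto
  qed
  have site: "lam i' m' j = 0" if "lam i m j = 0" for i m i' m' j
  proof -
    have "\<exists>k'. k' \<noteq> i" using assms(2) by metis
    then obtain k' where "k' \<noteq> i" by blast
    then show ?thesis using other[OF that] other[of k' 0 j i] by metis
  qed
  show ?thesis
  proof (cases "j' = j")
    case True
    then show ?thesis using site assms(1) by blast
  next
    case False
    \<comment> \<open>With exactly one task at every site each factor is
      \<open>lam q 0 j / mu q 1 j\<close>, so a zero of the product for \<open>j'\<close> exhibits a
      vanishing arrival intensity at some site.\<close>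
    have r1: "ratio q 1 j = 0" for q
      using site[OF assms(1), of q 0] by (simp add: ratio_Suc)
    have "(\<Prod>q\<in>UNIV. ratio q 1 j) = 0" using r1 by (intro prod_zero) auto
    moreover have "tau j j' (\<lambda>_. 1) * (\<Prod>q\<in>UNIV. ratio q 1 j) = tau j' j (\<lambda>_. 1) * (\<Prod>q\<in>UNIV. ratio q 1 j')"
      unfolding ratio_def by (rule tau_balance) (use False in simp)
    ultimately have "tau j' j (\<lambda>_. 1) * (\<Prod>q\<in>UNIV. ratio q 1 j') = 0"
      by (simp only: mult_zero_right)
    then have "(\<Prod>q\<in>UNIV. ratio q 1 j') = 0"
      using False tau_pos[of j' j "\<lambda>_. 1"] by (simp only: mult_eq_0_iff) auto
    then obtain q where "ratio q 1 j' = 0" by auto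
    then have "lam q 0 j' = 0"
      by (simp add: ratio_eq_0_iff lam_bar_def)
    then show ?thesis by (rule site)
  qed
qed

text \<open>With several sites the weight can vanish only through some \<open>lam\<close>, and then
  every \<open>lam\<close> is 0. With one site equal totals mean equal configurations; by the
  support conditions zeros of \<open>lam\<close> and \<open>gam\<close> persist upwards, so a
  vanishing weight at \<open>n\<close> stops the arrivals there.\<close>

lemma arrival_eq_0:
  assumes w: "weight j n = 0" and total: "(\<Sum>q\<in>UNIV. n' q) = (\<Sum>q\<in>UNIV. n q)"
  shows "arrival j' k n' = 0"
proof (cases "\<exists>i. i \<noteq> j")
  case True
  then obtain i where i: "i \<noteq> j" by blast
  then have "(\<Prod>q\<in>UNIV. ratio q (n q) j) = 0"
    using w gam_bar_pos[of i j "n j"] by (simp add: weight_def)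
  then obtain q where "lam_bar lam q (n q) j = 0" by (auto simp: ratio_eq_0_iff)
  then obtain m where m: "lam q m j = 0" by (auto simp: lam_bar_def)
  have "\<exists>k. k \<noteq> q" using i by metis
  then obtain k' where "k' \<noteq> q" by blast
  from lam_eq_0_all[OF m this] show ?thesis by (simp add: arrival_def)
next
  case False
  then have all: "i = j" for i by blast
  then have U: "UNIV = {j}" by auto
  have n: "n' j = n j" using total by (simp add: U)
  have lam_mono: "0 < lam j m j" if "0 < lam j (n j) j" "m \<le> n j" for m
    using that(2,1) by (induction rule: inc_induct) (use lam_support in auto)
  have gam_mono: "0 < gam j m" if "0 < gam j (n j)" "m \<le> n j" for m
    using that(2,1) by (induction rule: inc_induct) (use gam_support in auto)
  have "lam j (n j) j = 0 \<or> gam j (n j) = 0"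
  proof (rule ccontr)
    assume "\<not> ?thesis"
    then have "0 < lam j (n j) j" "0 < gam j (n j)"
      using lam_nonneg[of j "n j" j] gam_nonneg[of j "n j"] by auto
    then have "0 < lam_bar lam j (n j) j" "0 < gam_bar gam j (n j)"
      unfolding lam_bar_def gam_bar_def by (auto intro!: prod_pos lam_mono gam_mono)
    then have "0 < weight j n"
      using mu_bar_pos[of j "n j" j] by (simp add: weight_def U ratio_def)
    with w show False by simp
  qed
  then show ?thesis using all[of k] all[of j'] n by (auto simp: arrival_def)
qed

text \<open>Take all configurations with at most as many tasks as \<open>n\<close>, at any loaded
  site. Only arrivals raise the total, and those that would leave this set start from the maximal
  total, where \<open>arrival_eq_0\<close> excludes them.\<close>

lemma finite_closed_weight_0:
  assumes "weight j n = 0"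
  shows "\<exists>F. finite F \<and> (j, n) \<in> F \<and> (\<forall>a\<in>F. \<forall>b. a \<noteq> b \<longrightarrow> 0 < G a b \<longrightarrow> b \<in> F)"
proof -
  let ?N = "\<Sum>q\<in>UNIV. n q"
  define F where "F = (UNIV :: 'a set) \<times> {n' :: 'a \<Rightarrow> nat. (\<Sum>q\<in>UNIV. n' q) \<le> ?N}"
  have "{n' :: 'a \<Rightarrow> nat. (\<Sum>q\<in>UNIV. n' q) \<le> ?N} \<subseteq> PiE UNIV (\<lambda>_. {..?N})"
  proof
    fix n' :: "'a \<Rightarrow> nat" assume "n' \<in> {n'. (\<Sum>q\<in>UNIV. n' q) \<le> ?N}"
    moreover have "n' q \<le> (\<Sum>q\<in>UNIV. n' q)" for q by (rule member_le_sum) auto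
    ultimately show "n' \<in> PiE UNIV (\<lambda>_. {..?N})" by (auto intro: order_trans)
  qed
  then have fin: "finite F"
    unfolding F_def by (intro finite_cartesian_product) (simp, erule finite_subset, intro finite_PiE, simp_all)
  have "(j'', n'') \<in> F" if a: "(j', n') \<in> F" and pos: "0 < R (j', n') (j'', n'')" for j' n' j'' n''
  proof (cases "j'' = j'")
    case False
    then show ?thesis using a pos by (auto simp: F_def rate_diff split: if_splits)
  next
    case True
    have n': "(\<Sum>q\<in>UNIV. n' q) \<le> ?N" using a by (simp add: F_def)
    have "0 < arrivals j' n' n'' \<or> 0 < departures j' n' n'' \<or> 0 < migrations j' n' n''"
      using pos True arrivals_nonneg[of j' n' n''] departures_nonneg[of j' n' n''] migrations_nonneg[of j' n' n'']
      by (auto simp: rate_same)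
    then have "(\<Sum>q\<in>UNIV. n'' q) \<le> ?N"
    proof (elim disjE)
      assume "0 < arrivals j' n' n''"
      then have "arrivals j' n' n'' \<noteq> 0" by simp
      then obtain k where "(if n'' = n'(k := n' k + 1) then arrival j' k n' else 0) \<noteq> 0"
        unfolding arrivals_def by (rule sum.not_neutral_contains_not_neutral)
      then have k: "n'' = n'(k := n' k + 1)" "arrival j' k n' \<noteq> 0"
        by (simp_all only: simp_thms split: if_splits)
      from k(2) have "(\<Sum>q\<in>UNIV. n' q) \<noteq> ?N" using arrival_eq_0[OF assms, of n' j' k] by blast
      then have "Suc (\<Sum>q\<in>UNIV. n' q) \<le> ?N" using n' by linarith
      then show ?thesis using sum_upd[of n' k "n' k + 1"] unfolding k(1) by linarith
    next
      assume "0 < departures j' n' n''"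
      then have "departures j' n' n'' \<noteq> 0" by simp
      then obtain k where "(if n' k \<ge> 1 \<and> n'' = n'(k := n' k - 1) then mu k (n' k) j' else 0) \<noteq> 0"
        unfolding departures_def by (rule sum.not_neutral_contains_not_neutral)
      then have k: "n'' = n'(k := n' k - 1)"
        by (simp only: simp_thms split: if_splits)
      show ?thesis using n' sum_upd[of n' k "n' k - 1"] unfolding k by linarith
    next
      assume "0 < migrations j' n' n''"
      then have "migrations j' n' n'' \<noteq> 0" by simp
      then obtain k where "(\<Sum>l\<in>UNIV - {k}. if n' k \<ge> 1 \<and> n'' = n'(k := n' k - 1, l := n' l + 1) then migration j' k l n' else 0) \<noteq> 0"
        unfolding migrations_def by (rule sum.not_neutral_contains_not_neutral)
      then obtain l where l: "l \<in> UNIV - {k}"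
        "(if n' k \<ge> 1 \<and> n'' = n'(k := n' k - 1, l := n' l + 1) then migration j' k l n' else 0) \<noteq> 0"
        by (rule sum.not_neutral_contains_not_neutral)
      from l(2) have k: "n' k \<ge> 1" "n'' = n'(k := n' k - 1, l := n' l + 1)"
        by (simp_all only: simp_thms split: if_splits)
      have "(n'(k := n' k - 1)) l = n' l" using l(1) by simp
      then show ?thesis
        using n' k(1) sum_upd[of n' k "n' k - 1"] sum_upd[of "n'(k := n' k - 1)" l "n' l + 1"]
        unfolding k(2) by linarith
    qed
    then show ?thesis by (simp add: F_def)
  qed
  then have "\<forall>a\<in>F. \<forall>b. a \<noteq> b \<longrightarrow> 0 < G a b \<longrightarrow> b \<in> F"
    by (auto simp: generator_eq_rate)
  moreover have "(j, n) \<in> F" by (simp add: F_def)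
  ultimately show ?thesis using fin by blast
qed

section \<open>Normalisation\<close>

abbreviation "Xi \<equiv> partition_function lam mu gam"

lemma U_has_sum: "i \<noteq> j \<Longrightarrow> ((\<lambda>n. ratio i n j) has_sum U_sum lam mu i j) UNIV"
  unfolding U_sum_def using U_finite[of i j] ratio_nonneg
  by (intro norm_summable_imp_has_sum) (auto simp: ratio_def[symmetric] summable_sums)

lemma L_has_sum: "((\<lambda>n. ratio j n j * gam_bar gam j n) has_sum L_sum lam mu gam j) UNIV"
proof -
  have eq: "lam_bar lam j n j * gam_bar gam j n / mu_bar mu j n j = ratio j n j * gam_bar gam j n" for n
    by (simp add: ratio_def)
  show ?thesis
    unfolding L_sum_def using L_finite[of j] ratio_nonneg gam_bar_nonneg unfolding eq
    by (intro norm_summable_imp_has_sum) (auto simp: summable_sums)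
qed

lemma weight_has_sum: "((\<lambda>(j, n). weight j n) has_sum Xi) UNIV"
proof -
  have j: "((\<lambda>n. weight j n) has_sum (L_sum lam mu gam j * (\<Prod>i\<in>UNIV - {j}. U_sum lam mu i j))) UNIV" for j
  proof -
    \<comment> \<open>Assigning \<open>gam_bar\<close> to site \<open>j\<close> turns the weight
      into a product over sites; this is the origin of the single factor \<open>L_sum\<close> in
      each summand.\<close>
    define f where "f q m = (if q = j then ratio j m j * gam_bar gam j m else ratio q m j)" for q m
    define s where "s q = (if q = j then L_sum lam mu gam j else U_sum lam mu q j)" for q
    have "((\<lambda>n. \<Prod>q\<in>UNIV. f q (n q)) has_sum (\<Prod>q\<in>UNIV. s q)) UNIV"
    proof (rule has_sum_prod_UNIV)
      show "0 \<le> f q m" for q m by (simp add: f_def ratio_nonneg gam_bar_nonneg)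
      show "(f q has_sum s q) UNIV" for q
        using L_has_sum[of j] U_has_sum[of q j] by (cases "q = j") (simp_all add: f_def[abs_def] s_def)
    qed
    moreover have "(\<Prod>q\<in>UNIV. f q (n q)) = weight j n" for n
    proof -
      have "(\<Prod>q\<in>UNIV - {j}. f q (n q)) = (\<Prod>q\<in>UNIV - {j}. ratio q (n q) j)"
        by (intro prod.cong) (auto simp: f_def)
      moreover have "(\<Prod>q\<in>UNIV. f q (n q)) = f j (n j) * (\<Prod>q\<in>UNIV - {j}. f q (n q))"
        by (rule prod.remove) auto
      ultimately show ?thesis
        unfolding weight_def prod_ratio_remove[of n j j] by (simp add: f_def mult.commute mult.left_commute)
    qed
    moreover have "(\<Prod>q\<in>UNIV. s q) = L_sum lam mu gam j * (\<Prod>i\<in>UNIV - {j}. U_sum lam mu i j)"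
    proof -
      have "(\<Prod>q\<in>UNIV - {j}. s q) = (\<Prod>i\<in>UNIV - {j}. U_sum lam mu i j)"
        by (intro prod.cong) (auto simp: s_def)
      moreover have "(\<Prod>q\<in>UNIV. s q) = s j * (\<Prod>q\<in>UNIV - {j}. s q)"
        by (rule prod.remove) auto
      ultimately show ?thesis by (simp add: s_def)
    qed
    ultimately show ?thesis by simp
  qed
  have "((\<lambda>(j, n). weight j n) has_sum Xi) (UNIV \<times> UNIV)"
  proof (rule has_sum_SigmaI)
    show g: "((\<lambda>j. L_sum lam mu gam j * (\<Prod>i\<in>UNIV - {j}. U_sum lam mu i j)) has_sum Xi) UNIV"
      unfolding partition_function_def by (rule has_sum_finite) simp
    show "(\<lambda>(j, n). weight j n) summable_on UNIV \<times> UNIV"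
      by (rule summable_on_SigmaI) (use j g weight_nonneg in \<open>auto simp: summable_on_def\<close>)
  qed (use j in simp)
  then show ?thesis by simp
qed

text \<open>Every series has the term 1 at \<open>n = 0\<close> and no negative terms.\<close>

lemma partition_function_pos: "0 < Xi"
proof -
  have "0 < U_sum lam mu i j" if "i \<noteq> j" for i j
    unfolding U_sum_def using U_finite[OF that] ratio_nonneg ratio_0[of i j]
    by (intro suminf_pos2[of _ 0]) (auto simp: ratio_def)
  moreover have "0 < L_sum lam mu gam j" for j
    unfolding L_sum_def
  proof (rule suminf_pos2[of _ 0])
    show "0 \<le> lam_bar lam j n j * gam_bar gam j n / mu_bar mu j n j" for n
      by (intro divide_nonneg_pos mult_nonneg_nonneg lam_bar_nonneg gam_bar_nonneg mu_bar_pos)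
  qed (use L_finite in \<open>auto simp: lam_bar_def gam_bar_def mu_bar_def\<close>)
  ultimately show ?thesis
    unfolding partition_function_def by (intro sum_pos mult_pos_pos prod_pos) auto
qed

lemma stat_prob_eq: "stat_prob lam mu gam (j, n) = weight j n / Xi"
  by (simp add: stat_prob_def weight_def ratio_def)

end

theorem theorem3p2:
  fixes lam mu :: "'a::finite \<Rightarrow> nat \<Rightarrow> 'a \<Rightarrow> real"
    and gam :: "'a \<Rightarrow> nat \<Rightarrow> real"
    and beta theta :: "'a \<Rightarrow> 'a \<Rightarrow> nat \<Rightarrow> nat \<Rightarrow> 'a \<Rightarrow> real"
    and tau :: "'a \<Rightarrow> 'a \<Rightarrow> ('a \<Rightarrow> nat) \<Rightarrow> real"
    and P :: "'a state \<Rightarrow> 'w measure"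
    and X :: "real \<Rightarrow> 'w \<Rightarrow> 'a state"
  assumes lam_nonneg: "\<And>i n j. 0 \<le> lam i n j"
    and lam_bounded: "bdd_above (range (\<lambda>(i, n, j). lam i n j))"
    and mu_bounded_below: "\<exists>c>0. \<forall>i n j. 1 \<le> n \<longrightarrow> c \<le> mu i n j"
    and lam_support: "\<And>i n j. 0 < lam i (n + 1) j \<Longrightarrow> 0 < lam i n j"
    and gam_nonneg: "\<And>i n. 0 \<le> gam i n"
    and gam_0: "\<And>i. gam i 0 = 1"
    and gam_support: "\<And>i n. 0 < gam i (n + 1) \<Longrightarrow> 0 < gam i n"
    and gam_bar_pos: "\<And>j j' n. j' \<noteq> j \<Longrightarrow> 0 < gam_bar gam j n"
    and beta_diag: "\<And>i a b j. beta i i a b j = 0"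
    and beta_pos: "\<And>i k a b j. i \<noteq> k \<Longrightarrow> 0 < beta i k a b j"
    and theta_diag: "\<And>i a b j. theta i i a b j = 0"
    and theta_pos: "\<And>i k a b j. i \<noteq> k \<Longrightarrow> 0 < theta i k a b j"
    and tau_diag: "\<And>i n. tau i i n = 0"
    and tau_pos: "\<And>i k n. i \<noteq> k \<Longrightarrow> 0 < tau i k n"
    and beta_balance: "\<And>i k a b j. i \<noteq> k \<Longrightarrow> 1 \<le> a \<Longrightarrow>
      lam i (a - 1) j / mu i a j * beta i k a b j =
      lam k b j / mu k (b + 1) j * beta k i (b + 1) (a - 1) j"
    and theta_balance: "\<And>i k a b j. i \<noteq> k \<Longrightarrow> 1 \<le> a \<Longrightarrow>
      lam i (a - 1) j / mu i a j * theta i k a b j =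
      lam k b j / mu k (b + 1) j * theta k i (b + 1) (a - 1) j"
    and tau_balance: "\<And>i k n. i \<noteq> k \<Longrightarrow>
      tau i k n * (\<Prod>q\<in>UNIV. lam_bar lam q (n q) i / mu_bar mu q (n q) i) =
      tau k i n * (\<Prod>q\<in>UNIV. lam_bar lam q (n q) k / mu_bar mu q (n q) k)"
    and U_finite: "\<And>i j. i \<noteq> j \<Longrightarrow> summable (\<lambda>n. lam_bar lam i n j / mu_bar mu i n j)"
    and L_finite: "\<And>j. summable (\<lambda>n. lam_bar lam j n j * gam_bar gam j n / mu_bar mu j n j)"
    and process: "markov_process (generator lam mu gam beta theta tau) P X"
  shows "positive_recurrent P X {x. 0 < stat_prob lam mu gam x} \<and>
    reversible P X (stat_prob lam mu gam) \<and>
    stationary_distribution P X (stat_prob lam mu gam) \<and>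
    (\<forall>p. stationary_distribution P X p \<longrightarrow> p = stat_prob lam mu gam)"
proof -
  interpret N: loaded_network lam mu gam beta theta tau
    by unfold_locales fact+
  let ?Q = "generator lam mu gam beta theta tau" and ?w = "stat_prob lam mu gam"
  obtain Y S where YS: "\<forall>x. prob_space (P x) \<and>
        (\<forall>n. Y n \<in> measurable (P x) (count_space UNIV)) \<and>
        (\<forall>n. S n \<in> borel_measurable (P x)) \<and>
        (\<forall>n ys (ss :: nat \<Rightarrow> real). (\<forall>i\<le>n. 0 \<le> ss i) \<longrightarrow>
           measure (P x)
             {\<omega> \<in> space (P x). \<forall>i\<le>n. Y i \<omega> = ys i \<and> ennreal (ss i) < S i \<omega>} =
           of_bool (ys 0 = x) * (\<Prod>i<n. jump_prob ?Q (ys i) (ys (Suc i))) *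
             (\<Prod>i\<le>n. exp (- exit_rate ?Q (ys i) * ss i))) \<and>
        (AE \<omega> in P x. (\<Sum>n. S n \<omega>) = \<infinity>) \<and>
        (\<forall>\<omega> \<in> space (P x). \<forall>t\<ge>0. X t \<omega> = jump_path (\<lambda>n. Y n \<omega>) (\<lambda>n. S n \<omega>) t)"
    using process unfolding markov_process_def by (elim exE)
  note Xi = N.partition_function_pos
  interpret ergodic_process ?Q P Y S X ?w
  proof (intro ergodic_process.intro reversible_process.intro nonexplosive_process.intro jump_holding_process.intro
      ergodic_process_axioms.intro reversible_process_axioms.intro nonexplosive_process_axioms.intro
      jump_holding_process_axioms.intro N.generator_matrix_axioms)
    fix x
    note YSx = YS[rule_format, of x]
    show "prob_space (P x)" using YSx by (elim conjE)
    show "Y n \<in> measurable (P x) (count_space UNIV)" for n using YSx by (elim conjE) (erule spec)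
    show "S n \<in> borel_measurable (P x)" for n using YSx by (elim conjE) (erule spec)
    show "AE \<omega> in P x. (\<Sum>n. S n \<omega>) = \<infinity>" using YSx by (elim conjE)
    show "X t \<omega> = jump_path (\<lambda>n. Y n \<omega>) (\<lambda>n. S n \<omega>) t" if "\<omega> \<in> space (P x)" "0 \<le> t" for t \<omega>
      using YSx that by (elim conjE) blast
    show "measure (P x) {\<omega> \<in> space (P x). \<forall>i\<le>n. Y i \<omega> = ys i \<and> ennreal (ss i) < S i \<omega>} =
           of_bool (ys 0 = x) * (\<Prod>i<n. jump_prob ?Q (ys i) (ys (Suc i))) *
             (\<Prod>i\<le>n. exp (- exit_rate ?Q (ys i) * ss i))"
      if "\<forall>i\<le>n. 0 \<le> ss i" for n ss ys
      using YSx that by (elim conjE) blast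
    obtain j n where x: "x = (j, n)" by (cases x)
    show "0 \<le> ?w x"
      unfolding x N.stat_prob_eq using N.weight_nonneg Xi by simp
    show "\<exists>F. finite F \<and> x \<in> F \<and> (\<forall>a\<in>F. \<forall>b. a \<noteq> b \<longrightarrow> 0 < ?Q a b \<longrightarrow> b \<in> F)" if "?w x = 0"
      using that Xi unfolding x N.stat_prob_eq by (intro N.finite_closed_weight_0) simp
    fix y :: "'a state"
    obtain j' n' where y: "y = (j', n')" by (cases y)
    show "?w x * ?Q x y = ?w y * ?Q y x"
    proof (cases "x = y")
      case False
      \<comment> \<open>Detailed balance was established for \<open>rate\<close>, which represents
        the generator off the diagonal; on the diagonal the equation is trivial.\<close>
      then have e: "?Q x y = N.R x y" "?Q y x = N.R y x"
        using N.generator_eq_rate[of x y] N.generator_eq_rate[of y x] by auto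
      show ?thesis
        unfolding e unfolding x y N.stat_prob_eq using N.rate_balance[of j n j' n'] by simp
    qed simp
    show "(x, y) \<in> {(a, b). a \<noteq> b \<and> 0 < ?Q a b}\<^sup>*" if "0 < ?w y"
      using that Xi unfolding x y N.stat_prob_eq by (intro N.reach_weight_pos) (simp add: zero_less_divide_iff)
  next
    have "((\<lambda>x. (case x of (j, n) \<Rightarrow> N.weight j n) * inverse N.Xi) has_sum (N.Xi * inverse N.Xi)) UNIV"
      by (rule has_sum_cmult_left[OF N.weight_has_sum])
    then show "(?w has_sum 1) UNIV"
      using Xi by (subst has_sum_cong) (auto simp: N.stat_prob_eq divide_inverse)
  qed
  show ?thesis
    using positive_recurrent_support reversible stationary_w stationary_unique by blast
qed

end
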